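(* (i) $\Omega^n_d(\mathcal{A}_{fin})=0$ for $n\ge 2$. (ii) $\Omega^1_d(\mathcal{A}_{fin})\cong\mathbb{C}[z,z^{-1}]$ (isomorphism of $\mathcal{A}_{fin}$-bimodules).
   Context: Let $q$ be real with $|q|<1$ and let $c>0$. $C(S^2_{qc})$ (the Podleś quantum sphere) is the universal $C^*$-algebra generated by $A,B$ with relations $A^*=A$, $B^*B=A-A^2+cI$, $BA=q^2AB$, $BB^*=q^2A-q^4A^2+cI$. $\mathcal{A}_{fin}$ is its $*$-subalgebra generated by $A$ and $B$. Let $\mathcal{H}_+=\mathcal{H}_-=\ell^2(\mathbb{N})$ with $\mathbb{N}=\{0,1,2,\dots\}$ and canonical orthonormal basis $(e_n)_{n\ge0}$. Put $\lambda_\pm=\frac12\pm\left(c+\frac14\right)^{1/2}$ and $c_\pm(n)=\lambda_\pm q^{2n}-(\lambda_\pm q^{2n})^2+c$ (note $c_\pm(0)=0$). The representations $\pi_\pm$ on $\mathcal{H}_\pm$ are given by $\pi_\pm(A)e_n=\lambda_\pm q^{2n}e_n$, $\pi_\pm(B)e_n=c_\pm(n)^{1/2}e_{n-1}$ (with $\pi_\pm(B)e_0=0$), and $\pi=\pi_+\oplus\pi_-$ on $\mathcal{H}=\mathcal{H}_+\oplus\mathcal{H}_-$ is faithful. Let $N:e_n\mapsto ne_n$ on $\ell^2(\mathbb{N})$ and $D=\begin{pmatrix}0&N\\N&0\end{pmatrix}$ on $\mathcal{H}$; $[D,\pi(a)]$ extends to a bounded operator for all $a\in\mathcal{A}_{fin}$.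 Let $\Omega^\bullet(\mathcal{A}_{fin})$ be the universal graded differential algebra over $\mathcal{A}_{fin}$ with differential $\delta$: $\Omega^0(\mathcal{A}_{fin})=\mathcal{A}_{fin}$, $\Omega^n(\mathcal{A}_{fin})=\mathrm{span}\{a_0(\delta a_1)\cdots(\delta a_n):a_i\in\mathcal{A}_{fin}\}$, $\delta(ab)=a(\delta b)+(\delta a)b$ for $a,b\in\mathcal{A}_{fin}$. Let $\theta:\mathcal{L}(\mathcal{H})\to\mathcal{L}(\mathcal{H})/\mathcal{K}(\mathcal{H})$ be the quotient map onto the Calkin algebra. Define $\psi_n$ on $\Omega^n(\mathcal{A}_{fin})$ by $\psi_n(a_0(\delta a_1)\cdots(\delta a_n))=\theta\big(\pi(a_0)[D,\pi(a_1)]\cdots[D,\pi(a_n)]\big)$, let $J_n=\ker\psi_n$, and for $n\ge1$ let $\Omega^n_d(\mathcal{A}_{fin})=\Omega^n(\mathcal{A}_{fin})/(J_n+\delta J_{n-1})$. $\mathbb{C}[z,z^{-1}]$ is regarded as an $\mathcal{A}_{fin}$-bimodule through the symbol homomorphism $\mathcal{A}_{fin}\to\mathbb{C}[z,z^{-1}]$, $A\mapsto 0$, $B\mapsto\sqrt{c}\,z$, $B^*\mapsto\sqrt{c}\,z^{-1}$. *)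

theory Defs
  imports
    "HOL-Analysis.Analysis"
    "HOL-Library.Poly_Mapping"
    "HOL-Algebra.Module"
    "HOL-Algebra.QuotRing"
begin

section \<open>Complex algebras and unital C*-algebras\<close>

definition complex_ring :: "complex ring" where
  "complex_ring = \<lparr>carrier = UNIV, mult = (*), one = 1, zero = 0, add = (+)\<rparr>"

record 'a cstar = "(complex, 'a) module" +
  star :: "'a \<Rightarrow> 'a"
  cnrm :: "'a \<Rightarrow> real"

definition complex_algebra :: "(complex, 'a, 'x) module_scheme \<Rightarrow> bool" where
  "complex_algebra C \<longleftrightarrow>
     ring C \<and> Module.module complex_ring C \<and>
     (\<forall>z. \<forall>x\<in>carrier C. \<forall>y\<in>carrier C.
        (z \<odot>\<^bsub>C\<^esub> x) \<otimes>\<^bsub>C\<^esub> y = z \<odot>\<^bsub>C\<^esub> (x \<otimes>\<^bsub>C\<^esub> y) \<and>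
        x \<otimes>\<^bsub>C\<^esub> (z \<odot>\<^bsub>C\<^esub> y) = z \<odot>\<^bsub>C\<^esub> (x \<otimes>\<^bsub>C\<^esub> y))"

definition cstar_algebra :: "('a, 'x) cstar_scheme \<Rightarrow> bool" where
  "cstar_algebra C \<longleftrightarrow>
     complex_algebra C \<and>
     (\<forall>x\<in>carrier C. star C x \<in> carrier C \<and> star C (star C x) = x) \<and>
     (\<forall>x\<in>carrier C. \<forall>y\<in>carrier C.
        star C (x \<oplus>\<^bsub>C\<^esub> y) = star C x \<oplus>\<^bsub>C\<^esub> star C y \<and>
        star C (x \<otimes>\<^bsub>C\<^esub> y) = star C y \<otimes>\<^bsub>C\<^esub> star C x) \<and>
     (\<forall>z. \<forall>x\<in>carrier C. star C (z \<odot>\<^bsub>C\<^esub> x) = cnj z \<odot>\<^bsub>C\<^esub> star C x) \<and>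
     (\<forall>x\<in>carrier C. 0 \<le> cnrm C x \<and> (cnrm C x = 0 \<longleftrightarrow> x = \<zero>\<^bsub>C\<^esub>)) \<and>
     (\<forall>z. \<forall>x\<in>carrier C. cnrm C (z \<odot>\<^bsub>C\<^esub> x) = cmod z * cnrm C x) \<and>
     (\<forall>x\<in>carrier C. \<forall>y\<in>carrier C.
        cnrm C (x \<oplus>\<^bsub>C\<^esub> y) \<le> cnrm C x + cnrm C y \<and>
        cnrm C (x \<otimes>\<^bsub>C\<^esub> y) \<le> cnrm C x * cnrm C y) \<and>
     (\<forall>x\<in>carrier C. cnrm C (star C x \<otimes>\<^bsub>C\<^esub> x) = (cnrm C x)\<^sup>2) \<and>
     (\<forall>X :: nat \<Rightarrow> 'a. (\<forall>n. X n \<in> carrier C) \<longrightarrow>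
        (\<forall>e>0. \<exists>N. \<forall>m\<ge>N. \<forall>n\<ge>N. cnrm C (X m \<ominus>\<^bsub>C\<^esub> X n) < e) \<longrightarrow>
        (\<exists>x\<in>carrier C. (\<lambda>n. cnrm C (X n \<ominus>\<^bsub>C\<^esub> x)) \<longlonglongrightarrow> 0))"

definition alg_hom ::
    "(complex, 'a, 'x) module_scheme \<Rightarrow> (complex, 'b, 'y) module_scheme \<Rightarrow> ('a \<Rightarrow> 'b) set" where
  "alg_hom C E = {f \<in> ring_hom C E. \<forall>z. \<forall>x\<in>carrier C. f (z \<odot>\<^bsub>C\<^esub> x) = z \<odot>\<^bsub>E\<^esub> f x}"

definition star_hom :: "('a, 'x) cstar_scheme \<Rightarrow> ('b, 'y) cstar_scheme \<Rightarrow> ('a \<Rightarrow> 'b) set" where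
  "star_hom C E = {f \<in> alg_hom C E. \<forall>x\<in>carrier C. f (star C x) = star E (f x)}"

inductive_set star_generated :: "('a, 'x) cstar_scheme \<Rightarrow> 'a set \<Rightarrow> 'a set"
  for C and G where
  gen: "x \<in> G \<Longrightarrow> x \<in> star_generated C G"
| add: "x \<in> star_generated C G \<Longrightarrow> y \<in> star_generated C G \<Longrightarrow> x \<oplus>\<^bsub>C\<^esub> y \<in> star_generated C G"
| mult: "x \<in> star_generated C G \<Longrightarrow> y \<in> star_generated C G \<Longrightarrow> x \<otimes>\<^bsub>C\<^esub> y \<in> star_generated C G"
| smult: "x \<in> star_generated C G \<Longrightarrow> z \<odot>\<^bsub>C\<^esub> x \<in> star_generated C G"
| star: "x \<in> star_generated C G \<Longrightarrow> star C x \<in> star_generated C G"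


section \<open>The Podles quantum sphere\<close>

definition podles_relations ::
    "real \<Rightarrow> real \<Rightarrow> ('a, 'x) cstar_scheme \<Rightarrow> 'a \<Rightarrow> 'a \<Rightarrow> bool" where
  "podles_relations q c C A B \<longleftrightarrow>
     A \<in> carrier C \<and> B \<in> carrier C \<and>
     star C A = A \<and>
     star C B \<otimes>\<^bsub>C\<^esub> B = (A \<ominus>\<^bsub>C\<^esub> A \<otimes>\<^bsub>C\<^esub> A) \<oplus>\<^bsub>C\<^esub> complex_of_real c \<odot>\<^bsub>C\<^esub> \<one>\<^bsub>C\<^esub> \<and>
     B \<otimes>\<^bsub>C\<^esub> A = complex_of_real (q ^ 2) \<odot>\<^bsub>C\<^esub> (A \<otimes>\<^bsub>C\<^esub> B) \<and>
     B \<otimes>\<^bsub>C\<^esub> star C B =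
       (complex_of_real (q ^ 2) \<odot>\<^bsub>C\<^esub> A \<ominus>\<^bsub>C\<^esub> complex_of_real (q ^ 4) \<odot>\<^bsub>C\<^esub> (A \<otimes>\<^bsub>C\<^esub> A))
         \<oplus>\<^bsub>C\<^esub> complex_of_real c \<odot>\<^bsub>C\<^esub> \<one>\<^bsub>C\<^esub>"

text \<open>
  \<open>C\<close> is the universal C*-algebra on \<open>A\<close>, \<open>B\<close>: it is generated by \<open>A\<close> and \<open>B\<close>, and every
  pair satisfying the relations in a unital C*-algebra \<open>E\<close> is the image of \<open>(A, B)\<close> under a
  unital *-homomorphism (unique, by density).  It suffices to let \<open>E\<close> range over C*-algebras
  carried by sets of reals: \<open>E\<close> may be replaced by the C*-subalgebra generated by the two
  elements, which is separable and so has at most the cardinality of the continuum.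
\<close>
definition podles_sphere ::
    "real \<Rightarrow> real \<Rightarrow> ('a, 'x) cstar_scheme \<Rightarrow> 'a \<Rightarrow> 'a \<Rightarrow> bool" where
  "podles_sphere q c C A B \<longleftrightarrow>
     cstar_algebra C \<and> podles_relations q c C A B \<and>
     (\<forall>x\<in>carrier C. \<forall>e>0. \<exists>y\<in>star_generated C {A, B}. cnrm C (x \<ominus>\<^bsub>C\<^esub> y) < e) \<and>
     (\<forall>(E :: real cstar) A' B'. cstar_algebra E \<longrightarrow> podles_relations q c E A' B' \<longrightarrow>
        (\<exists>f\<in>star_hom C E. f A = A' \<and> f B = B'))"

text \<open>Since \<open>c > 0\<close>, the relation for \<open>B*B\<close> shows that this *-subalgebra contains the unit.\<close>
definition podles_fin :: "('a, 'x) cstar_scheme \<Rightarrow> 'a \<Rightarrow> 'a \<Rightarrow> ('a, 'x) cstar_scheme" where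
  "podles_fin C A B = C\<lparr>carrier := star_generated C {A, B}\<rparr>"


section \<open>Bounded and compact operators on complex normed spaces\<close>

class complex_normed_vector = real_normed_vector +
  fixes scaleC :: "complex \<Rightarrow> 'a \<Rightarrow> 'a" (infixr "*\<^sub>C" 75)
  assumes scaleC_add_right: "z *\<^sub>C (x + y) = z *\<^sub>C x + z *\<^sub>C y"
    and scaleC_add_left: "(z + w) *\<^sub>C x = z *\<^sub>C x + w *\<^sub>C x"
    and scaleC_scaleC: "z *\<^sub>C (w *\<^sub>C x) = (z * w) *\<^sub>C x"
    and scaleR_scaleC: "r *\<^sub>R x = complex_of_real r *\<^sub>C x"
    and norm_scaleC: "norm (z *\<^sub>C x) = cmod z * norm x"

instantiation prod :: (complex_normed_vector, complex_normed_vector) complex_normed_vector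
begin

definition scaleC_prod :: "complex \<Rightarrow> 'a \<times> 'b \<Rightarrow> 'a \<times> 'b" where
  "scaleC_prod z p = (z *\<^sub>C fst p, z *\<^sub>C snd p)"

instance
proof
  fix z :: complex and p :: "'a \<times> 'b"
  have "norm (z *\<^sub>C p) = sqrt ((cmod z)\<^sup>2 * ((norm (fst p))\<^sup>2 + (norm (snd p))\<^sup>2))"
    by (simp add: scaleC_prod_def norm_prod_def norm_scaleC power_mult_distrib distrib_left)
  then show "norm (z *\<^sub>C p) = cmod z * norm p"
    by (simp add: real_sqrt_mult norm_prod_def)
qed (auto simp: scaleC_prod_def scaleC_add_right scaleC_add_left scaleC_scaleC scaleR_scaleC
       scaleR_prod_def)

end

definition bounded_ops :: "('h::complex_normed_vector \<Rightarrow> 'h) set" where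
  "bounded_ops = {T. bounded_linear T \<and> (\<forall>z x. T (z *\<^sub>C x) = z *\<^sub>C T x)}"

definition compact_ops :: "('h::complex_normed_vector \<Rightarrow> 'h) set" where
  "compact_ops = {T \<in> bounded_ops. compact (closure (T ` cball 0 1))}"

text \<open>The coset of \<open>T\<close> in the Calkin algebra.\<close>
definition calkin :: "('h::complex_normed_vector \<Rightarrow> 'h) \<Rightarrow> ('h \<Rightarrow> 'h) set" where
  "calkin T = {S \<in> bounded_ops. (\<lambda>v. S v - T v) \<in> compact_ops}"

text \<open>
  The bounded extension of \<open>[D, T]\<close>, where \<open>D\<close> is an operator with domain \<open>V\<close>;
  it is unique when the natural domain of the commutator is dense.
\<close>
definition bounded_commutator ::
    "'h set \<Rightarrow> ('h \<Rightarrow> 'h) \<Rightarrow> ('h \<Rightarrow> 'h) \<Rightarrow> ('h::complex_normed_vector \<Rightarrow> 'h)" where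
  "bounded_commutator V D T =
     (THE S. S \<in> bounded_ops \<and> (\<forall>v\<in>V. T v \<in> V \<longrightarrow> S v = D (T v) - T (D v)))"


section \<open>The Hilbert space of square-summable sequences\<close>

definition square_summable :: "(nat \<Rightarrow> complex) \<Rightarrow> bool" where
  "square_summable f \<longleftrightarrow> summable (\<lambda>n. (cmod (f n))\<^sup>2)"

lemma square_summable_scale: "square_summable f \<Longrightarrow> square_summable (\<lambda>n. z * f n)"
  by (simp add: square_summable_def norm_mult power_mult_distrib summable_mult)

lemma square_summable_add:
  assumes "square_summable f" "square_summable g"
  shows "square_summable (\<lambda>n. f n + g n)"
  unfolding square_summable_def
proof (rule summable_comparison_test')
  show "summable (\<lambda>n. 2 * (cmod (f n))\<^sup>2 + 2 * (cmod (g n))\<^sup>2)"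
    using assms by (simp add: square_summable_def summable_add summable_mult)
next
  fix n :: nat assume "n \<ge> 0"
  have "(cmod (f n + g n))\<^sup>2 \<le> (cmod (f n) + cmod (g n))\<^sup>2"
    by (simp add: norm_triangle_ineq power_mono)
  also have "\<dots> \<le> 2 * (cmod (f n))\<^sup>2 + 2 * (cmod (g n))\<^sup>2"
    using zero_le_power2[of "cmod (f n) - cmod (g n)"]
    by (simp add: power2_sum power2_diff)
  finally show "norm ((cmod (f n + g n))\<^sup>2) \<le> 2 * (cmod (f n))\<^sup>2 + 2 * (cmod (g n))\<^sup>2"
    by simp
qed

definition l2norm :: "(nat \<Rightarrow> complex) \<Rightarrow> real" where
  "l2norm f = sqrt (suminf (\<lambda>n. (cmod (f n))\<^sup>2))"

lemma l2norm_scale: "l2norm (\<lambda>n. z * f n) = cmod z * l2norm f" if "square_summable f"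
  using that
  by (simp add: l2norm_def norm_mult power_mult_distrib suminf_mult square_summable_def
        real_sqrt_mult)

lemma L2_set_le_l2norm:
  assumes "square_summable f"
  shows "L2_set (\<lambda>n. cmod (f n)) {..<N} \<le> l2norm f"
  using assms
  by (auto simp: L2_set_def l2norm_def square_summable_def intro!: sum_le_suminf)

lemma l2norm_triangle:
  assumes f: "square_summable f" and g: "square_summable g"
  shows "l2norm (\<lambda>n. f n + g n) \<le> l2norm f + l2norm g"
proof -
  have fin: "(\<Sum>n<N. (cmod (f n + g n))\<^sup>2) \<le> (l2norm f + l2norm g)\<^sup>2" for N
  proof -
    have "L2_set (\<lambda>n. cmod (f n + g n)) {..<N} \<le> L2_set (\<lambda>n. cmod (f n) + cmod (g n)) {..<N}"
      by (rule L2_set_mono) (auto simp: norm_triangle_ineq)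
    also have "\<dots> \<le> L2_set (\<lambda>n. cmod (f n)) {..<N} + L2_set (\<lambda>n. cmod (g n)) {..<N}"
      by (rule L2_set_triangle_ineq)
    also have "\<dots> \<le> l2norm f + l2norm g"
      using L2_set_le_l2norm[OF f] L2_set_le_l2norm[OF g] by (rule add_mono)
    finally have "(L2_set (\<lambda>n. cmod (f n + g n)) {..<N})\<^sup>2 \<le> (l2norm f + l2norm g)\<^sup>2"
      by (simp add: power_mono)
    then show ?thesis
      by (simp add: L2_set_def sum_nonneg)
  qed
  have "suminf (\<lambda>n. (cmod (f n + g n))\<^sup>2) \<le> (l2norm f + l2norm g)\<^sup>2"
    using square_summable_add[OF f g] fin
    by (intro suminf_le_const) (auto simp: square_summable_def)
  then have "l2norm (\<lambda>n. f n + g n) \<le> sqrt ((l2norm f + l2norm g)\<^sup>2)"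
    by (simp only: l2norm_def real_sqrt_le_iff)
  also have "\<dots> = l2norm f + l2norm g"
  proof -
    have "0 \<le> l2norm f" "0 \<le> l2norm g"
      using f g by (auto simp: l2norm_def square_summable_def suminf_nonneg)
    then show ?thesis by simp
  qed
  finally show ?thesis .
qed

lemma l2norm_eq_0:
  assumes "square_summable f"
  shows "l2norm f = 0 \<longleftrightarrow> f = (\<lambda>n. 0)"
  using assms suminf_eq_zero_iff[of "\<lambda>n. (cmod (f n))\<^sup>2"]
  by (auto simp: l2norm_def square_summable_def fun_eq_iff)

typedef ell2 = "{f. square_summable f}"
  by (rule exI[of _ "\<lambda>n. 0"]) (simp add: square_summable_def)

lemma square_summable_Rep: "square_summable (Rep_ell2 x)"
  using Rep_ell2[of x] by simp

instantiation ell2 :: complex_normed_vector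
begin

definition zero_ell2 :: ell2 where
  "zero_ell2 = Abs_ell2 (\<lambda>n. 0)"
definition plus_ell2 :: "ell2 \<Rightarrow> ell2 \<Rightarrow> ell2" where
  "plus_ell2 x y = Abs_ell2 (\<lambda>n. Rep_ell2 x n + Rep_ell2 y n)"
definition scaleC_ell2 :: "complex \<Rightarrow> ell2 \<Rightarrow> ell2" where
  "scaleC_ell2 z x = Abs_ell2 (\<lambda>n. z * Rep_ell2 x n)"
definition scaleR_ell2 :: "real \<Rightarrow> ell2 \<Rightarrow> ell2" where
  "scaleR_ell2 r x = Abs_ell2 (\<lambda>n. complex_of_real r * Rep_ell2 x n)"
definition uminus_ell2 :: "ell2 \<Rightarrow> ell2" where
  "uminus_ell2 x = Abs_ell2 (\<lambda>n. (-1) * Rep_ell2 x n)"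
definition minus_ell2 :: "ell2 \<Rightarrow> ell2 \<Rightarrow> ell2" where
  "minus_ell2 x y = x + (- y)"
definition norm_ell2 :: "ell2 \<Rightarrow> real" where
  "norm_ell2 x = l2norm (Rep_ell2 x)"
definition sgn_ell2 :: "ell2 \<Rightarrow> ell2" where
  "sgn_ell2 x = inverse (norm x) *\<^sub>R x"
definition dist_ell2 :: "ell2 \<Rightarrow> ell2 \<Rightarrow> real" where
  "dist_ell2 x y = norm (x - y)"
definition uniformity_ell2 :: "(ell2 \<times> ell2) filter" where
  "uniformity_ell2 = (INF e\<in>{0<..}. principal {(x, y). dist x y < e})"
definition open_ell2 :: "ell2 set \<Rightarrow> bool" where
  "open_ell2 U = (\<forall>x\<in>U. eventually (\<lambda>(x', y). x' = x \<longrightarrow> y \<in> U) uniformity)"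

lemma Rep_ell2_ops:
  "Rep_ell2 0 = (\<lambda>n. 0)"
  "Rep_ell2 (x + y) = (\<lambda>n. Rep_ell2 x n + Rep_ell2 y n)"
  "Rep_ell2 (z *\<^sub>C x) = (\<lambda>n. z * Rep_ell2 x n)"
  "Rep_ell2 (r *\<^sub>R x) = (\<lambda>n. complex_of_real r * Rep_ell2 x n)"
  "Rep_ell2 (- x) = (\<lambda>n. (-1) * Rep_ell2 x n)"
  unfolding zero_ell2_def plus_ell2_def scaleC_ell2_def scaleR_ell2_def uminus_ell2_def
  by (subst Abs_ell2_inverse; simp only: mem_Collect_eq;
      (intro square_summable_add square_summable_scale square_summable_Rep)?;
      simp add: square_summable_def)+

instance
proof
  fix x y z :: ell2 and a b :: real and u v :: complex
  note eqI = Rep_ell2_inject[THEN iffD1] and ops = Rep_ell2_ops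
  show "x + y + z = x + (y + z)" "x + y = y + x" "0 + x = x" "- x + x = 0"
    by (rule eqI, simp add: ops algebra_simps)+
  show "x - y = x + - y" by (simp add: minus_ell2_def)
  show "a *\<^sub>R (x + y) = a *\<^sub>R x + a *\<^sub>R y" "(a + b) *\<^sub>R x = a *\<^sub>R x + b *\<^sub>R x"
    "a *\<^sub>R b *\<^sub>R x = (a * b) *\<^sub>R x" "1 *\<^sub>R x = x"
    "u *\<^sub>C (x + y) = u *\<^sub>C x + u *\<^sub>C y" "(u + v) *\<^sub>C x = u *\<^sub>C x + v *\<^sub>C x"
    "u *\<^sub>C v *\<^sub>C x = (u * v) *\<^sub>C x" "a *\<^sub>R x = complex_of_real a *\<^sub>C x"
    by (rule eqI, simp add: ops algebra_simps)+
  show "sgn x = inverse (norm x) *\<^sub>R x" "dist x y = norm (x - y)"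
    by (simp_all add: sgn_ell2_def dist_ell2_def)
  show "uniformity = (INF e\<in>{0<..}. principal {(x :: ell2, y). dist x y < e})"
    by (rule uniformity_ell2_def)
  show "open U = (\<forall>x\<in>U. eventually (\<lambda>(x', y). x' = x \<longrightarrow> y \<in> U) uniformity)" for U :: "ell2 set"
    by (rule open_ell2_def)
  show "norm x = 0 \<longleftrightarrow> x = 0"
    by (simp add: norm_ell2_def l2norm_eq_0 square_summable_Rep ops(1)[symmetric] Rep_ell2_inject)
  show "norm (x + y) \<le> norm x + norm y"
    by (simp add: norm_ell2_def ops l2norm_triangle square_summable_Rep)
  show "norm (a *\<^sub>R x) = \<bar>a\<bar> * norm x"
    by (simp add: norm_ell2_def ops l2norm_scale square_summable_Rep)
  show "norm (u *\<^sub>C x) = cmod u * norm x"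
    by (simp add: norm_ell2_def ops l2norm_scale square_summable_Rep)
qed

end

definition cinner :: "ell2 \<Rightarrow> ell2 \<Rightarrow> complex" where
  "cinner x y = suminf (\<lambda>n. cnj (Rep_ell2 x n) * Rep_ell2 y n)"

definition ket :: "nat \<Rightarrow> ell2" where
  "ket n = Abs_ell2 (\<lambda>k. if k = n then 1 else 0)"

definition dom_N :: "ell2 set" where
  "dom_N = {x. square_summable (\<lambda>n. of_nat n * Rep_ell2 x n)}"

definition op_N :: "ell2 \<Rightarrow> ell2" where
  "op_N x = Abs_ell2 (\<lambda>n. of_nat n * Rep_ell2 x n)"

text \<open>
  The product norm on \<open>ell2 \<times> ell2\<close> is the norm of the Hilbert space direct sum.
\<close>
type_synonym hilb = "ell2 \<times> ell2"

definition dom_D :: "hilb set" where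
  "dom_D = dom_N \<times> dom_N"

definition op_D :: "hilb \<Rightarrow> hilb" where
  "op_D = (\<lambda>(x, y). (op_N y, op_N x))"


section \<open>The representations of the Podles sphere\<close>

definition star_rep :: "('a, 'x) cstar_scheme \<Rightarrow> ('a \<Rightarrow> ell2 \<Rightarrow> ell2) \<Rightarrow> bool" where
  "star_rep C \<rho> \<longleftrightarrow>
     (\<forall>a\<in>carrier C. \<rho> a \<in> bounded_ops) \<and>
     (\<forall>a\<in>carrier C. \<forall>b\<in>carrier C. \<forall>v.
        \<rho> (a \<oplus>\<^bsub>C\<^esub> b) v = \<rho> a v + \<rho> b v \<and> \<rho> (a \<otimes>\<^bsub>C\<^esub> b) v = \<rho> a (\<rho> b v)) \<and>
     (\<forall>z. \<forall>a\<in>carrier C. \<forall>v. \<rho> (z \<odot>\<^bsub>C\<^esub> a) v = z *\<^sub>C \<rho> a v) \<and>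
     (\<forall>v. \<rho> \<one>\<^bsub>C\<^esub> v = v) \<and>
     (\<forall>a\<in>carrier C. \<forall>v w. cinner (\<rho> (star C a) v) w = cinner v (\<rho> a w))"

definition lam_plus :: "real \<Rightarrow> real" where
  "lam_plus c = 1 / 2 + sqrt (c + 1 / 4)"

definition lam_minus :: "real \<Rightarrow> real" where
  "lam_minus c = 1 / 2 - sqrt (c + 1 / 4)"

definition podles_coeff :: "real \<Rightarrow> real \<Rightarrow> real \<Rightarrow> nat \<Rightarrow> real" where
  "podles_coeff l q c n = l * q ^ (2 * n) - (l * q ^ (2 * n))\<^sup>2 + c"

definition podles_rep ::
    "real \<Rightarrow> real \<Rightarrow> real \<Rightarrow> ('a, 'x) cstar_scheme \<Rightarrow> 'a \<Rightarrow> 'a \<Rightarrow> ('a \<Rightarrow> ell2 \<Rightarrow> ell2) \<Rightarrow> bool" where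
  "podles_rep l q c C A B \<rho> \<longleftrightarrow>
     star_rep C \<rho> \<and>
     (\<forall>n. \<rho> A (ket n) = complex_of_real (l * q ^ (2 * n)) *\<^sub>C ket n) \<and>
     (\<forall>n. \<rho> B (ket n) =
        (if n = 0 then 0 else complex_of_real (sqrt (podles_coeff l q c n)) *\<^sub>C ket (n - 1)))"

definition direct_sum_rep ::
    "('a \<Rightarrow> ell2 \<Rightarrow> ell2) \<Rightarrow> ('a \<Rightarrow> ell2 \<Rightarrow> ell2) \<Rightarrow> 'a \<Rightarrow> hilb \<Rightarrow> hilb" where
  "direct_sum_rep \<rho> \<rho>' a = map_prod (\<rho> a) (\<rho>' a)"


section \<open>The universal graded differential algebra\<close>

text \<open>
  Letters of the free algebra: \<open>Elt a\<close> stands for the element \<open>a\<close> in degree 0, \<open>Dif a\<close> for the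
  symbol \<open>\<delta> a\<close>.  Finitely supported functions on a monoid form its monoid algebra under
  convolution, so those on the free monoid \<open>'g fmon\<close> (words, written additively) form a free algebra
  and those on \<open>int\<close> form the Laurent polynomials.
\<close>
datatype 'a letter = Elt 'a | Dif 'a

datatype 'g fmon = FMon (letters: "'g list")

instantiation fmon :: (type) monoid_add
begin

definition zero_fmon :: "'a fmon" where "zero_fmon = FMon []"
definition plus_fmon :: "'a fmon \<Rightarrow> 'a fmon \<Rightarrow> 'a fmon" where
  "plus_fmon u w = FMon (letters u @ letters w)"

instance
  by standard (simp_all add: zero_fmon_def plus_fmon_def)

end

definition monoid_algebra :: "'m::monoid_add set \<Rightarrow> (complex, 'm \<Rightarrow>\<^sub>0 complex) module" where
  "monoid_algebra S =
     \<lparr>carrier = {p. Poly_Mapping.keys p \<subseteq> S}, mult = (*), one = 1, zero = 0, add = (+),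
      smult = (\<lambda>z p. Poly_Mapping.single 0 z * p)\<rparr>"

type_synonym 'a form = "'a letter fmon \<Rightarrow>\<^sub>0 complex"

definition elt :: "'a \<Rightarrow> 'a form" where
  "elt a = Poly_Mapping.single (FMon [Elt a]) 1"

definition dif :: "'a \<Rightarrow> 'a form" where
  "dif a = Poly_Mapping.single (FMon [Dif a]) 1"

definition free_forms :: "(complex, 'a, 'x) module_scheme \<Rightarrow> (complex, 'a form) module" where
  "free_forms A =
     monoid_algebra {w. set (letters w) \<subseteq> Elt ` carrier A \<union> Dif ` carrier A}"

definition form_relations :: "(complex, 'a, 'x) module_scheme \<Rightarrow> 'a form set" where
  "form_relations A =
     {elt (a \<oplus>\<^bsub>A\<^esub> b) - elt a - elt b | a b. a \<in> carrier A \<and> b \<in> carrier A} \<union>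
     {elt (z \<odot>\<^bsub>A\<^esub> a) - Poly_Mapping.single 0 z * elt a | z a. a \<in> carrier A} \<union>
     {elt (a \<otimes>\<^bsub>A\<^esub> b) - elt a * elt b | a b. a \<in> carrier A \<and> b \<in> carrier A} \<union>
     {elt \<one>\<^bsub>A\<^esub> - 1} \<union>
     {dif (a \<oplus>\<^bsub>A\<^esub> b) - dif a - dif b | a b. a \<in> carrier A \<and> b \<in> carrier A} \<union>
     {dif (z \<odot>\<^bsub>A\<^esub> a) - Poly_Mapping.single 0 z * dif a | z a. a \<in> carrier A} \<union>
     {dif (a \<otimes>\<^bsub>A\<^esub> b) - elt a * dif b - dif a * elt b | a b. a \<in> carrier A \<and> b \<in> carrier A}"

definition form_ideal :: "(complex, 'a, 'x) module_scheme \<Rightarrow> 'a form set" where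
  "form_ideal A = Idl\<^bsub>free_forms A\<^esub> (form_relations A)"

definition form_class :: "(complex, 'a, 'x) module_scheme \<Rightarrow> 'a form \<Rightarrow> 'a form set" where
  "form_class A p = form_ideal A +>\<^bsub>free_forms A\<^esub> p"

definition Omega :: "(complex, 'a, 'x) module_scheme \<Rightarrow> 'a form set ring" where
  "Omega A = free_forms A Quot form_ideal A"

text \<open>
  The differential is induced by the graded derivation of the free algebra with
  \<open>Elt a \<mapsto> Dif a\<close> and \<open>Dif a \<mapsto> 0\<close>.
\<close>
primrec dword :: "'a letter list \<Rightarrow> 'a form" where
  "dword [] = 0"
| "dword (g # w) =
     (case g of
        Elt a \<Rightarrow> dif a * Poly_Mapping.single (FMon w) 1 + elt a * dword w
      | Dif a \<Rightarrow> - (dif a * dword w))"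

definition dform :: "'a form \<Rightarrow> 'a form" where
  "dform p = (\<Sum>w\<in>Poly_Mapping.keys p.
     Poly_Mapping.single 0 (Poly_Mapping.lookup p w) * dword (letters w))"

definition delta :: "(complex, 'a, 'x) module_scheme \<Rightarrow> 'a form set \<Rightarrow> 'a form set" where
  "delta A X = (\<Union>p\<in>X. form_class A (dform p))"

text \<open>Linear combinations of words \<open>a\<^sub>0 (\<delta> a\<^sub>1) \<dots> (\<delta> a\<^sub>n)\<close>.\<close>
definition standard_forms :: "(complex, 'a, 'x) module_scheme \<Rightarrow> nat \<Rightarrow> 'a form set" where
  "standard_forms A n =
     {p. Poly_Mapping.keys p \<subseteq>
           {FMon (Elt a # map Dif as) | a as.
              a \<in> carrier A \<and> set as \<subseteq> carrier A \<and> length as = n}}"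

definition Omega_deg :: "(complex, 'a, 'x) module_scheme \<Rightarrow> nat \<Rightarrow> 'a form set set" where
  "Omega_deg A n = form_class A ` standard_forms A n"


section \<open>The quotient calculus\<close>

primrec eval_word ::
    "('a \<Rightarrow> hilb \<Rightarrow> hilb) \<Rightarrow> 'a letter list \<Rightarrow> hilb \<Rightarrow> hilb" where
  "eval_word \<pi> [] = id"
| "eval_word \<pi> (g # w) =
     (case g of
        Elt a \<Rightarrow> \<pi> a
      | Dif a \<Rightarrow> bounded_commutator dom_D op_D (\<pi> a)) \<circ> eval_word \<pi> w"

definition eval_form :: "('a \<Rightarrow> hilb \<Rightarrow> hilb) \<Rightarrow> 'a form \<Rightarrow> hilb \<Rightarrow> hilb" where
  "eval_form \<pi> p v = (\<Sum>w\<in>Poly_Mapping.keys p.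
     Poly_Mapping.lookup p w *\<^sub>C eval_word \<pi> (letters w) v)"

text \<open>
  The value of \<open>\<psi>\<^sub>n\<close> on a form is computed from any representative of the
  shape \<open>\<Sum> a\<^sub>0 (\<delta> a\<^sub>1) \<dots> (\<delta> a\<^sub>n)\<close>; \<open>the_elem\<close> extracts the common value.
\<close>
definition psi ::
    "('a \<Rightarrow> hilb \<Rightarrow> hilb) \<Rightarrow> (complex, 'a, 'x) module_scheme \<Rightarrow> nat \<Rightarrow> 'a form set
      \<Rightarrow> (hilb \<Rightarrow> hilb) set" where
  "psi \<pi> A n X =
     the_elem ((\<lambda>p. calkin (eval_form \<pi> p)) ` {p \<in> standard_forms A n. form_class A p = X})"

definition J ::
    "('a \<Rightarrow> hilb \<Rightarrow> hilb) \<Rightarrow> (complex, 'a, 'x) module_scheme \<Rightarrow> nat \<Rightarrow> 'a form set set" where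
  "J \<pi> A n = {X \<in> Omega_deg A n. psi \<pi> A n X = calkin (\<lambda>v. 0)}"

definition junk ::
    "('a \<Rightarrow> hilb \<Rightarrow> hilb) \<Rightarrow> (complex, 'a, 'x) module_scheme \<Rightarrow> nat \<Rightarrow> 'a form set set" where
  "junk \<pi> A n = J \<pi> A n <+>\<^bsub>Omega A\<^esub> delta A ` J \<pi> A (n - 1)"

text \<open>The group operation of a bimodule is its addition, written \<open>mult\<close>, \<open>one\<close> as in \<open>monoid\<close>.\<close>
record ('a, 'm) bimodule = "'m monoid" +
  lact :: "'a \<Rightarrow> 'm \<Rightarrow> 'm"
  ract :: "'m \<Rightarrow> 'a \<Rightarrow> 'm"

definition is_bimodule ::
    "(complex, 'a, 'x) module_scheme \<Rightarrow> ('a, 'm, 'y) bimodule_scheme \<Rightarrow> bool" where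
  "is_bimodule A M \<longleftrightarrow>
     comm_group M \<and>
     (\<forall>a\<in>carrier A. \<forall>m\<in>carrier M. lact M a m \<in> carrier M \<and> ract M m a \<in> carrier M) \<and>
     (\<forall>a\<in>carrier A. \<forall>m\<in>carrier M. \<forall>n\<in>carrier M.
        lact M a (m \<otimes>\<^bsub>M\<^esub> n) = lact M a m \<otimes>\<^bsub>M\<^esub> lact M a n \<and>
        ract M (m \<otimes>\<^bsub>M\<^esub> n) a = ract M m a \<otimes>\<^bsub>M\<^esub> ract M n a) \<and>
     (\<forall>a\<in>carrier A. \<forall>b\<in>carrier A. \<forall>m\<in>carrier M.
        lact M (a \<oplus>\<^bsub>A\<^esub> b) m = lact M a m \<otimes>\<^bsub>M\<^esub> lact M b m \<and>
        ract M m (a \<oplus>\<^bsub>A\<^esub> b) = ract M m a \<otimes>\<^bsub>M\<^esub> ract M m b \<and>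
        lact M (a \<otimes>\<^bsub>A\<^esub> b) m = lact M a (lact M b m) \<and>
        ract M m (a \<otimes>\<^bsub>A\<^esub> b) = ract M (ract M m a) b \<and>
        ract M (lact M a m) b = lact M a (ract M m b)) \<and>
     (\<forall>m\<in>carrier M. lact M \<one>\<^bsub>A\<^esub> m = m \<and> ract M m \<one>\<^bsub>A\<^esub> = m) \<and>
     (\<forall>z. \<forall>m\<in>carrier M. lact M (z \<odot>\<^bsub>A\<^esub> \<one>\<^bsub>A\<^esub>) m = ract M m (z \<odot>\<^bsub>A\<^esub> \<one>\<^bsub>A\<^esub>))"

definition bimodule_iso ::
    "(complex, 'a, 'x) module_scheme \<Rightarrow> ('a, 'm, 'y) bimodule_scheme \<Rightarrow> ('a, 'n, 'z) bimodule_scheme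
      \<Rightarrow> ('m \<Rightarrow> 'n) set" where
  "bimodule_iso A M N =
     {f \<in> iso M N. \<forall>a\<in>carrier A. \<forall>m\<in>carrier M.
        f (lact M a m) = lact N a (f m) \<and> f (ract M m a) = ract N (f m) a}"

definition bimodule_isomorphic ::
    "(complex, 'a, 'x) module_scheme \<Rightarrow> ('a, 'm, 'y) bimodule_scheme \<Rightarrow> ('a, 'n, 'z) bimodule_scheme
      \<Rightarrow> bool" where
  "bimodule_isomorphic A M N \<longleftrightarrow>
     is_bimodule A M \<and> is_bimodule A N \<and> bimodule_iso A M N \<noteq> {}"

text \<open>\<open>\<Omega>\<^sup>n / (J\<^sub>n + \<delta> J\<^sub>n\<^sub>-\<^sub>1)\<close> for \<open>n \<ge> 1\<close>; the complex scalars act through the unit of \<open>A\<close>.\<close>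
definition Omega_d ::
    "('a \<Rightarrow> hilb \<Rightarrow> hilb) \<Rightarrow> (complex, 'a, 'x) module_scheme \<Rightarrow> nat
      \<Rightarrow> ('a, 'a form set set) bimodule" where
  "Omega_d \<pi> A n =
     (let G = Omega A\<lparr>carrier := Omega_deg A n\<rparr> A_Mod junk \<pi> A n in
      \<lparr>carrier = carrier G, mult = mult G, one = one G,
       lact = (\<lambda>a X. \<Union>\<omega>\<in>X. junk \<pi> A n +>\<^bsub>Omega A\<^esub> (form_class A (elt a) \<otimes>\<^bsub>Omega A\<^esub> \<omega>)),
       ract = (\<lambda>X a. \<Union>\<omega>\<in>X. junk \<pi> A n +>\<^bsub>Omega A\<^esub> (\<omega> \<otimes>\<^bsub>Omega A\<^esub> form_class A (elt a)))\<rparr>)"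


section \<open>Laurent polynomials as a bimodule\<close>

type_synonym laurent = "int \<Rightarrow>\<^sub>0 complex"

definition is_symbol_hom ::
    "real \<Rightarrow> ('a, 'x) cstar_scheme \<Rightarrow> 'a \<Rightarrow> 'a \<Rightarrow> ('a \<Rightarrow> laurent) \<Rightarrow> bool" where
  "is_symbol_hom c C A B \<sigma> \<longleftrightarrow>
     \<sigma> \<in> alg_hom (podles_fin C A B) (monoid_algebra UNIV) \<and>
     \<sigma> A = 0 \<and>
     \<sigma> B = Poly_Mapping.single 1 (complex_of_real (sqrt c)) \<and>
     \<sigma> (star C B) = Poly_Mapping.single (-1) (complex_of_real (sqrt c))"

definition laurent_bimodule :: "('a \<Rightarrow> laurent) \<Rightarrow> ('a, laurent) bimodule" where
  "laurent_bimodule \<sigma> =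
     \<lparr>carrier = UNIV, mult = (+), one = 0, lact = (\<lambda>a f. \<sigma> a * f), ract = (\<lambda>f a. f * \<sigma> a)\<rparr>"

end

theory Submission
  imports Defs
begin

text \<open>
  Modulo compact operators, \<open>\<pi> a\<close> is a direct sum of two copies of the Toeplitz operator with symbol
  \<open>\<sigma> a\<close>, and \<open>[D, \<pi> a]\<close> is the off-diagonal operator with both entries the Toeplitz operator with
  symbol \<open>\<partial>(\<sigma> a)\<close>, where \<open>\<partial> = - z d/dz\<close>: this is seen on the generators, where the error terms are
  weighted shifts with square-summable weights, and it propagates along sums, products and
  commutators.  As a Toeplitz operator with a nonzero symbol is not compact,
  \<open>\<psi>\<^sub>n\<close> has the same kernel as
  \<open>a\<^sub>0 (\<delta> a\<^sub>1) \<dots> (\<delta> a\<^sub>n) \<mapsto> \<sigma> a\<^sub>0 \<cdot> \<partial>(\<sigma> a\<^sub>1) \<cdots> \<partial>(\<sigma> a\<^sub>n)\<close>.  In degree 1 this map is onto the Laurent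
  polynomials, and \<open>\<delta> J\<^sub>0\<close> adds nothing to \<open>J\<^sub>1\<close>.  In degree \<open>n \<ge> 2\<close> the symbols of \<open>\<delta> J\<^sub>n\<^sub>-\<^sub>1\<close>
  already exhaust the Laurent polynomials.
\<close>

section \<open>Compact operators\<close>

text \<open>The commutator couples the two representations: for T = diag(S, S') the entries of
  [D, T] are N S' - S N and N S - S' N. They are bounded because the weights of both representations
  have the same limit; with different limits, n times the difference would remain. The factor n
  coming from N is beaten by the geometric decay q^(2n), which is why square summability is required
  with an additional factor n + 1. As \<open>bounded_commutator\<close> is a definite description,
  nothing can be said about it before a bounded extension is exhibited and the domain of D is known
  to be preserved and dense. Hence the predicate \<open>regular\<close> carries an explicit
  extension through sums and products. Likewise \<open>psi\<close> is given by
  \<open>the_elem\<close>. It is well defined because the symbol is an algebra homomorphism on the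
  free algebra of words that kills the defining relations. Degree 1 and the higher degrees part ways
  because only in degree 0 is the symbol of a differential a function of the symbol of the
  form.\<close>

lemma scaleC_zero_right [simp]: "z *\<^sub>C (0 :: 'h::complex_normed_vector) = 0"
  using scaleC_add_right[of z 0 0] by simp

lemma scaleC_zero_left [simp]: "0 *\<^sub>C (x :: 'h::complex_normed_vector) = 0"
  using scaleC_add_left[of 0 0 x] by simp

lemma scaleC_one [simp]: "1 *\<^sub>C (x :: 'h::complex_normed_vector) = x"
  using scaleR_scaleC[of 1 x] by simp

lemma scaleC_minus_right: "z *\<^sub>C (- x) = - (z *\<^sub>C (x :: 'h::complex_normed_vector))"
  using scaleC_add_right[of z x "-x"] by (simp add: eq_neg_iff_add_eq_0 add.commute)

lemma scaleC_diff_right: "z *\<^sub>C (x - y) = z *\<^sub>C x - z *\<^sub>C (y :: 'h::complex_normed_vector)"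
  using scaleC_add_right[of z x "-y"] by (simp add: scaleC_minus_right)

lemma bounded_opsI:
  assumes "\<And>x y. T (x + y) = T x + T y" "\<And>z x. T (z *\<^sub>C x) = z *\<^sub>C T x"
    and "\<And>x. norm (T x) \<le> norm x * K"
  shows "T \<in> bounded_ops"
  unfolding bounded_ops_def
  by (auto intro!: bounded_linear_intro[where K = K] assms simp: scaleR_scaleC)

lemma bounded_ops_linear:
  assumes "T \<in> bounded_ops"
  shows "T (x + y) = T x + T y" "T (x - y) = T x - T y" "T 0 = 0" "T (z *\<^sub>C x) = z *\<^sub>C T x"
  using assms unfolding bounded_ops_def
  by (auto intro: linear_simps bounded_linear.linear linear_0 linear_add linear_diff)

lemma bounded_ops_zero: "(\<lambda>v. 0) \<in> bounded_ops"
  by (rule bounded_opsI[where K = 0]) auto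

lemma bounded_ops_id: "(\<lambda>v. v) \<in> bounded_ops"
  by (rule bounded_opsI[where K = 1]) auto

lemma bounded_ops_scaleC: "(\<lambda>v. z *\<^sub>C v) \<in> bounded_ops"
  by (rule bounded_opsI[where K = "cmod z"])
    (auto simp: scaleC_add_right scaleC_scaleC norm_scaleC mult.commute)

lemma bounded_ops_add: "S \<in> bounded_ops \<Longrightarrow> T \<in> bounded_ops \<Longrightarrow> (\<lambda>v. S v + T v) \<in> bounded_ops"
  unfolding bounded_ops_def by (auto intro: bounded_linear_add simp: scaleC_add_right)

lemma bounded_ops_comp: "S \<in> bounded_ops \<Longrightarrow> T \<in> bounded_ops \<Longrightarrow> (\<lambda>v. S (T v)) \<in> bounded_ops"
  unfolding bounded_ops_def by (auto intro: bounded_linear_compose)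

lemma bounded_ops_sum:
  "(\<And>i. i \<in> I \<Longrightarrow> f i \<in> bounded_ops) \<Longrightarrow> (\<lambda>v. \<Sum>i\<in>I. f i v) \<in> bounded_ops"
  by (induction I rule: infinite_finite_induct) (auto intro: bounded_ops_zero bounded_ops_add)

lemma compact_ops_bounded: "T \<in> compact_ops \<Longrightarrow> T \<in> bounded_ops"
  by (simp add: compact_ops_def)

lemma compact_opsI:
  assumes "T \<in> bounded_ops" "compact K" "\<And>v. norm v \<le> 1 \<Longrightarrow> T v \<in> K"
  shows "T \<in> compact_ops"
proof -
  have "closure (T ` cball 0 1) \<subseteq> K"
    by (rule closure_minimal[OF _ compact_imp_closed[OF assms(2)]]) (use assms(3) in auto)
  then have "compact (closure (T ` cball 0 1))"
    using compact_Int_closed[OF assms(2), of "closure (T ` cball 0 1)"] by (simp add: Int_absorb1)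
  then show ?thesis using assms(1) by (simp add: compact_ops_def)
qed

lemma compact_ops_compact: "T \<in> compact_ops \<Longrightarrow> compact (closure (T ` cball 0 1))"
  by (simp add: compact_ops_def)

lemma image_unit_ball_in_closure: "norm v \<le> 1 \<Longrightarrow> T v \<in> closure (T ` cball 0 1)"
  by (rule closure_subset[THEN subsetD], rule imageI) simp

lemma compact_ops_add:
  assumes "S \<in> compact_ops" "T \<in> compact_ops"
  shows "(\<lambda>v. S v + T v) \<in> compact_ops"
proof (rule compact_opsI)
  show "(\<lambda>v. S v + T v) \<in> bounded_ops"
    by (rule bounded_ops_add) (intro compact_ops_bounded assms)+
  show "compact {x + y | x y. x \<in> closure (S ` cball 0 1) \<and> y \<in> closure (T ` cball 0 1)}"
    by (intro compact_sums compact_ops_compact assms)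
  show "S v + T v \<in> {x + y | x y. x \<in> closure (S ` cball 0 1) \<and> y \<in> closure (T ` cball 0 1)}"
    if "norm v \<le> 1" for v
    using image_unit_ball_in_closure[OF that, of S] image_unit_ball_in_closure[OF that, of T] by auto
qed

lemma compact_ops_comp_left:
  assumes "S \<in> bounded_ops" "T \<in> compact_ops"
  shows "(\<lambda>v. S (T v)) \<in> compact_ops"
proof (rule compact_opsI)
  show "(\<lambda>v. S (T v)) \<in> bounded_ops"
    by (rule bounded_ops_comp) (intro compact_ops_bounded assms)+
  have "bounded_linear S" using assms(1) by (simp add: bounded_ops_def)
  then show "compact (S ` closure (T ` cball 0 1))"
    by (intro compact_continuous_image linear_continuous_on compact_ops_compact assms)
  show "S (T v) \<in> S ` closure (T ` cball 0 1)" if "norm v \<le> 1" for v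
    by (rule imageI[OF image_unit_ball_in_closure[OF that]])
qed

text \<open>T maps the unit ball into a ball of some radius M > 0, and the image of that ball under
  S is M times the image of the unit ball.\<close>

lemma compact_ops_comp_right:
  assumes "S \<in> compact_ops" "T \<in> bounded_ops"
  shows "(\<lambda>v. S (T v)) \<in> compact_ops"
proof -
  have "bounded_linear T" using assms(2) by (simp add: bounded_ops_def)
  from bounded_linear.pos_bounded[OF this] obtain M
    where M: "M > 0" "\<And>x. norm (T x) \<le> norm x * M" by blast
  have S: "S (complex_of_real M *\<^sub>C y) = M *\<^sub>R S y" for y
    unfolding scaleR_scaleC by (rule bounded_ops_linear(4)[OF compact_ops_bounded[OF assms(1)]])
  have eq: "S (T v) = M *\<^sub>R S ((1 / M) *\<^sub>R T v)" for v
    using S[of "(1 / M) *\<^sub>R T v"] M(1) by (simp flip: scaleR_scaleC)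
  show ?thesis
  proof (rule compact_opsI)
    show "(\<lambda>v. S (T v)) \<in> bounded_ops"
      by (rule bounded_ops_comp) (intro compact_ops_bounded assms)+
    show "compact ((*\<^sub>R) M ` closure (S ` cball 0 1))"
      by (intro compact_scaling compact_ops_compact assms)
    show "S (T v) \<in> (*\<^sub>R) M ` closure (S ` cball 0 1)" if v: "norm v \<le> 1" for v
    proof -
      have "norm (T v) \<le> 1 * M"
        using M(1) v by (intro order_trans[OF M(2)[of v]] mult_right_mono) auto
      then have "norm ((1 / M) *\<^sub>R T v) \<le> 1"
        using M(1) by (simp add: field_simps)
      then show ?thesis
        unfolding eq[of v] by (intro imageI image_unit_ball_in_closure)
    qed
  qed
qed

lemma compact_ops_zero: "(\<lambda>v. 0) \<in> compact_ops"
  by (rule compact_opsI[where K = "{0}"]) (auto intro: bounded_ops_zero)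

lemma compact_ops_scaleC: "T \<in> compact_ops \<Longrightarrow> (\<lambda>v. z *\<^sub>C T v) \<in> compact_ops"
  by (rule compact_ops_comp_left[OF bounded_ops_scaleC])

lemma compact_ops_diff:
  assumes "S \<in> compact_ops" "T \<in> compact_ops"
  shows "(\<lambda>v. S v - T v) \<in> compact_ops"
proof -
  have "- 1 *\<^sub>C x = - x" for x :: 'a
    using scaleR_scaleC[of "-1" x] by simp
  then show ?thesis
    using compact_ops_add[OF assms(1) compact_ops_scaleC[OF assms(2), of "-1"]] by simp
qed

lemma calkin_cong:
  assumes "S \<in> bounded_ops" "T \<in> bounded_ops" "(\<lambda>v. S v - T v) \<in> compact_ops"
  shows "calkin S = calkin T"
proof -
  have "(\<lambda>v. R v - T v) \<in> compact_ops" if "(\<lambda>v. R v - S v) \<in> compact_ops" for R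
    using compact_ops_add[OF that assms(3)] by simp
  moreover have "(\<lambda>v. R v - S v) \<in> compact_ops" if "(\<lambda>v. R v - T v) \<in> compact_ops" for R
    using compact_ops_diff[OF that assms(3)] by simp
  ultimately show ?thesis by (auto simp: calkin_def)
qed

lemma calkin_eq_zero_iff:
  assumes "T \<in> bounded_ops"
  shows "calkin T = calkin (\<lambda>v. 0) \<longleftrightarrow> T \<in> compact_ops"
proof
  assume "calkin T = calkin (\<lambda>v. 0)"
  moreover have "T \<in> calkin T" using assms compact_ops_zero by (simp add: calkin_def)
  ultimately show "T \<in> compact_ops" by (simp add: calkin_def)
next
  assume "T \<in> compact_ops"
  then show "calkin T = calkin (\<lambda>v. 0)"
    using assms bounded_ops_zero by (intro calkin_cong) auto
qed

section \<open>Coordinates in \<open>ell2\<close> and Hilbert cubes\<close>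

lemma Rep_ell2_diff: "Rep_ell2 (x - y) = (\<lambda>n. Rep_ell2 x n - Rep_ell2 y n)"
  unfolding minus_ell2_def Rep_ell2_ops by simp

lemma Rep_ell2_sum: "Rep_ell2 (\<Sum>i\<in>I. f i) n = (\<Sum>i\<in>I. Rep_ell2 (f i) n)"
  by (induction I rule: infinite_finite_induct) (simp_all add: Rep_ell2_ops(1,2))

lemma ell2_eqI: "(\<And>n. Rep_ell2 x n = Rep_ell2 y n) \<Longrightarrow> x = y"
  by (rule iffD1[OF Rep_ell2_inject], rule ext)

lemma norm_ell2_sq: "(norm x)\<^sup>2 = suminf (\<lambda>n. (cmod (Rep_ell2 x n))\<^sup>2)"
proof -
  have "suminf (\<lambda>n. (cmod (Rep_ell2 x n))\<^sup>2) \<ge> 0"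
    by (rule suminf_nonneg) (use square_summable_Rep[of x] in \<open>auto simp: square_summable_def\<close>)
  then show ?thesis by (simp add: norm_ell2_def l2norm_def)
qed

lemma norm_Rep_ell2_le: "cmod (Rep_ell2 x n) \<le> norm x"
proof (rule power2_le_imp_le)
  have "(\<Sum>n\<in>{n}. (cmod (Rep_ell2 x n))\<^sup>2) \<le> suminf (\<lambda>n. (cmod (Rep_ell2 x n))\<^sup>2)"
    by (rule sum_le_suminf) (use square_summable_Rep[of x] in \<open>auto simp: square_summable_def\<close>)
  then show "(cmod (Rep_ell2 x n))\<^sup>2 \<le> (norm x)\<^sup>2"
    unfolding norm_ell2_sq by simp
qed simp

text \<open>By Tychonoff the product of the discs is compact for coordinatewise convergence. The
  square summable bound dominates all differences, so Tannery's theorem turns coordinatewise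
  convergence of a subsequence into convergence in norm.\<close>

lemma compact_Hilbert_cube:
  fixes d :: "nat \<Rightarrow> real"
  assumes d: "summable (\<lambda>n. (d n)\<^sup>2)"
  shows "compact {x. \<forall>n. cmod (Rep_ell2 x n) \<le> d n}"
proof -
  let ?P = "PiE UNIV (\<lambda>n. cball (0::complex) (d n))"
  have "compactin (product_topology (\<lambda>i. euclidean) UNIV) ?P"
    unfolding compactin_PiE by simp
  then have "compact ?P" unfolding euclidean_product_topology by simp
  then have sc: "seq_compact ?P" by (rule compact_imp_seq_compact)
  have "seq_compact {x. \<forall>n. cmod (Rep_ell2 x n) \<le> d n}"
    unfolding seq_compact_def
  proof (intro allI impI)
    fix X :: "nat \<Rightarrow> ell2" assume X: "\<forall>k. X k \<in> {x. \<forall>n. cmod (Rep_ell2 x n) \<le> d n}"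
    then have "\<forall>k. Rep_ell2 (X k) \<in> ?P" by auto
    from seq_compactE[OF sc this] obtain l r where l: "l \<in> ?P" and r: "strict_mono r"
      and "((\<lambda>k. Rep_ell2 (X k)) \<circ> r) \<longlonglongrightarrow> l" .
    then have lim: "(\<lambda>k. Rep_ell2 (X (r k))) \<longlonglongrightarrow> l" by (simp add: comp_def)
    have lim_n: "(\<lambda>k. Rep_ell2 (X (r k)) n) \<longlonglongrightarrow> l n" for n
      using continuous_on_tendsto_compose[OF continuous_on_product_coordinates lim] by simp
    have l_le: "cmod (l n) \<le> d n" for n using l by (auto simp: PiE_iff)
    have "square_summable l"
      unfolding square_summable_def
      by (rule summable_comparison_test'[OF d]) (use l_le in \<open>auto intro: power_mono\<close>)
    then have Rl: "Rep_ell2 (Abs_ell2 l) = l" by (simp add: Abs_ell2_inverse)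
    have bd: "cmod (Rep_ell2 (X (r k)) n - l n) \<le> 2 * d n" for k n
    proof -
      have "cmod (Rep_ell2 (X (r k)) n) \<le> d n" using X by simp
      then show ?thesis
        using norm_triangle_ineq4[of "Rep_ell2 (X (r k)) n" "l n"] l_le[of n] by linarith
    qed
    have "(\<lambda>k. suminf (\<lambda>n. (cmod (Rep_ell2 (X (r k)) n - l n))\<^sup>2)) \<longlonglongrightarrow> suminf (\<lambda>n. 0)"
    proof (rule tannerys_theorem[THEN conjunct2, THEN conjunct2])
      show "(\<lambda>k. (cmod (Rep_ell2 (X (r k)) n - l n))\<^sup>2) \<longlonglongrightarrow> 0" for n
        using tendsto_power[OF tendsto_norm[OF tendsto_diff[OF lim_n tendsto_const]], of n "l n" 2]
        by simp
      show "summable (\<lambda>n. (2 * d n)\<^sup>2)"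
        using d by (simp add: power_mult_distrib summable_mult)
      show "eventually (\<lambda>(n, k). norm ((cmod (Rep_ell2 (X (r k)) n - l n))\<^sup>2) \<le> (2 * d n)\<^sup>2)
          (at_top \<times>\<^sub>F sequentially)"
        using power_mono[OF bd norm_ge_zero, of _ _ 2] by (intro always_eventually) auto
    qed simp
    then have "(\<lambda>k. (norm (X (r k) - Abs_ell2 l))\<^sup>2) \<longlonglongrightarrow> 0"
      by (simp add: norm_ell2_sq Rep_ell2_diff Rl)
    from tendsto_real_sqrt[OF this] have "(\<lambda>k. norm (X (r k) - Abs_ell2 l)) \<longlonglongrightarrow> 0"
      by simp
    then have "(X \<circ> r) \<longlonglongrightarrow> Abs_ell2 l"
      by (simp add: comp_def LIM_zero_cancel tendsto_norm_zero_iff)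
    then show "\<exists>l\<in>{x. \<forall>n. cmod (Rep_ell2 x n) \<le> d n}. \<exists>r. strict_mono r \<and> (X \<circ> r) \<longlonglongrightarrow> l"
      using r l_le Rl by (intro bexI[of _ "Abs_ell2 l"]) auto
  qed
  then show ?thesis by (simp add: compact_eq_seq_compact_metric)
qed

text \<open>The criterion for the error terms below: one square summable bound on the entries,
  uniform over the unit ball, puts its image into a product of two Hilbert cubes.\<close>

lemma compact_ops_hilbI:
  fixes T :: "hilb \<Rightarrow> hilb"
  assumes "T \<in> bounded_ops" "summable (\<lambda>n. (d n)\<^sup>2)"
    and "\<And>v n. norm v \<le> 1 \<Longrightarrow> cmod (Rep_ell2 (fst (T v)) n) \<le> d n"
    and "\<And>v n. norm v \<le> 1 \<Longrightarrow> cmod (Rep_ell2 (snd (T v)) n) \<le> d n"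
  shows "T \<in> compact_ops"
proof (rule compact_opsI[OF assms(1)])
  let ?Q = "{x. \<forall>n. cmod (Rep_ell2 x n) \<le> d n}"
  show "compact (?Q \<times> ?Q)"
    by (intro compact_Times compact_Hilbert_cube assms)
  show "T v \<in> ?Q \<times> ?Q" if "norm v \<le> 1" for v
    using assms(3,4)[OF that] by (simp add: mem_Times_iff)
qed

section \<open>Toeplitz operators and their symbols\<close>

lemma poly_mapping_eq_sum_single:
  "(\<Sum>k\<in>Poly_Mapping.keys p. Poly_Mapping.single k (Poly_Mapping.lookup p k)) = p"
proof (rule poly_mapping_eqI)
  fix j
  have "(\<Sum>k\<in>Poly_Mapping.keys p. Poly_Mapping.lookup (Poly_Mapping.single k (Poly_Mapping.lookup p k)) j)
      = (\<Sum>k\<in>Poly_Mapping.keys p. if k = j then Poly_Mapping.lookup p j else 0)"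
    by (rule sum.cong) (auto simp: lookup_single when_def)
  then show "Poly_Mapping.lookup (\<Sum>k\<in>Poly_Mapping.keys p.
      Poly_Mapping.single k (Poly_Mapping.lookup p k)) j = Poly_Mapping.lookup p j"
    by (simp add: lookup_sum in_keys_iff)
qed

text \<open>Zero is a monomial with coefficient 0, so a property stable under sums need only be
  checked on monomials.\<close>

lemma poly_mapping_add_induct [case_names single add]:
  fixes p :: "'k \<Rightarrow>\<^sub>0 'b::comm_monoid_add"
  assumes single: "\<And>k b. P (Poly_Mapping.single k b)"
    and add: "\<And>p q. P p \<Longrightarrow> P q \<Longrightarrow> P (p + q)"
  shows "P p"
proof -
  have "P (\<Sum>k\<in>F. Poly_Mapping.single k (Poly_Mapping.lookup p k))" if "finite F" for F
    using that
  proof induction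
    case empty
    show ?case using single[of undefined 0] by simp
  qed (simp add: single add)
  from this[OF finite_keys[of p]] show ?thesis
    by (simp only: poly_mapping_eq_sum_single)
qed

section \<open>Weighted shifts\<close>

text \<open>Extending a sequence by 0 to negative indices lets one formula cover the shifts in both
  directions.\<close>

definition coord :: "ell2 \<Rightarrow> int \<Rightarrow> complex" where
  "coord x k = (if k < 0 then 0 else Rep_ell2 x (nat k))"

text \<open>With all weights 1 this is the Toeplitz operator with symbol z^k. The convention that z
  lowers the index by 1 matches B, which maps \<open>ket n\<close> to a multiple of
  \<open>ket (n - 1)\<close>.\<close>

definition wshift :: "int \<Rightarrow> (nat \<Rightarrow> complex) \<Rightarrow> ell2 \<Rightarrow> ell2" where
  "wshift k w x = Abs_ell2 (\<lambda>n. w n * coord x (int n + k))"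

lemma coord_linear:
  "coord (x + y) k = coord x k + coord y k" "coord (z *\<^sub>C x) k = z * coord x k"
  by (simp_all add: coord_def Rep_ell2_ops(2,3))

lemma norm_coord_le: "cmod (coord x k) \<le> norm x"
  by (simp add: coord_def norm_Rep_ell2_le)

text \<open>The translation of indices by k is injective where the result is nonnegative, so the sum
  consists of zeros and of distinct terms of the series for the squared norm.\<close>

lemma sum_coord_le: "(\<Sum>n<N. (cmod (coord x (int n + k)))\<^sup>2) \<le> (norm x)\<^sup>2"
proof -
  let ?I = "{n. n < N \<and> 0 \<le> int n + k}"
  have "(\<Sum>n<N. (cmod (coord x (int n + k)))\<^sup>2) = (\<Sum>n\<in>?I. (cmod (Rep_ell2 x (nat (int n + k))))\<^sup>2)"
    by (rule sum.mono_neutral_cong_right) (auto simp: coord_def)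
  also have "\<dots> = (\<Sum>m\<in>(\<lambda>n. nat (int n + k)) ` ?I. (cmod (Rep_ell2 x m))\<^sup>2)"
    by (subst sum.reindex) (auto simp: inj_on_def)
  also have "\<dots> \<le> suminf (\<lambda>m. (cmod (Rep_ell2 x m))\<^sup>2)"
    by (rule sum_le_suminf) (use square_summable_Rep[of x] in \<open>auto simp: square_summable_def\<close>)
  finally show ?thesis by (simp add: norm_ell2_sq)
qed

lemma square_summable_weighted:
  assumes "bounded (range w)"
  shows "square_summable (\<lambda>n. w n * coord x (int n + k))"
proof -
  obtain M where M: "\<And>n. cmod (w n) \<le> M"
    using assms by (auto simp: bounded_iff)
  have "summable (\<lambda>n. (cmod (coord x (int n + k)))\<^sup>2)"
    by (rule summableI_nonneg_bounded[OF _ sum_coord_le]) simp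
  then have "summable (\<lambda>n. M\<^sup>2 * (cmod (coord x (int n + k)))\<^sup>2)"
    by (rule summable_mult)
  then show ?thesis
    unfolding square_summable_def
    by (rule summable_comparison_test')
      (simp add: norm_mult power_mult_distrib mult_right_mono power_mono M)
qed

lemma Rep_wshift:
  assumes "bounded (range w)"
  shows "Rep_ell2 (wshift k w x) n = w n * coord x (int n + k)"
  unfolding wshift_def using square_summable_weighted[OF assms] by (simp add: Abs_ell2_inverse)

lemma wshift_bounded_ops:
  assumes w: "bounded (range w)"
  shows "wshift k w \<in> bounded_ops"
proof -
  obtain M where M: "\<And>n. cmod (w n) \<le> M"
    using assms by (auto simp: bounded_iff)
  show ?thesis
  proof (rule bounded_opsI)
    fix x :: ell2
    have le: "(norm (wshift k w x))\<^sup>2 \<le> (norm x * M)\<^sup>2"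
      unfolding norm_ell2_sq[of "wshift k w x"] Rep_wshift[OF w]
    proof (rule suminf_le_const)
      show "summable (\<lambda>n. (cmod (w n * coord x (int n + k)))\<^sup>2)"
        using square_summable_weighted[OF w] by (simp add: square_summable_def)
      fix N
      have "(\<Sum>n<N. (cmod (w n * coord x (int n + k)))\<^sup>2)
          \<le> (\<Sum>n<N. M\<^sup>2 * (cmod (coord x (int n + k)))\<^sup>2)"
        by (rule sum_mono) (simp add: norm_mult power_mult_distrib mult_right_mono power_mono M)
      also have "\<dots> = M\<^sup>2 * (\<Sum>n<N. (cmod (coord x (int n + k)))\<^sup>2)"
        by (rule sum_distrib_left[symmetric])
      also have "\<dots> \<le> M\<^sup>2 * (norm x)\<^sup>2"
        by (rule mult_left_mono[OF sum_coord_le]) simp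
      finally show "(\<Sum>n<N. (cmod (w n * coord x (int n + k)))\<^sup>2) \<le> (norm x * M)\<^sup>2"
        by (simp add: power_mult_distrib mult.commute)
    qed
    have "0 \<le> M" using M[of 0] norm_ge_zero[of "w 0"] by linarith
    then show "norm (wshift k w x) \<le> norm x * M"
      by (intro power2_le_imp_le[OF le] mult_nonneg_nonneg norm_ge_zero)
  qed (auto intro!: ell2_eqI simp: Rep_wshift[OF w] Rep_ell2_ops(2,3) coord_linear algebra_simps)
qed

lemma bounded_range_const: "bounded (range (\<lambda>n. a))"
  by simp

lemma square_summable_imp_bounded:
  assumes "square_summable w"
  shows "bounded (range w)"
proof -
  have "cmod (w n) \<le> norm (Abs_ell2 w)" for n
    using norm_Rep_ell2_le[of "Abs_ell2 w" n] assms by (simp add: Abs_ell2_inverse)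
  then show ?thesis by (auto simp: bounded_iff)
qed

section \<open>Toeplitz operators and their diagonal and off-diagonal sums\<close>

definition Toep :: "laurent \<Rightarrow> ell2 \<Rightarrow> ell2" where
  "Toep f x = (\<Sum>k\<in>Poly_Mapping.keys f. Poly_Mapping.lookup f k *\<^sub>C wshift k (\<lambda>n. 1) x)"

lemma Toep_superset:
  assumes "finite F" "Poly_Mapping.keys f \<subseteq> F"
  shows "Toep f x = (\<Sum>k\<in>F. Poly_Mapping.lookup f k *\<^sub>C wshift k (\<lambda>n. 1) x)"
  unfolding Toep_def using assms by (intro sum.mono_neutral_left) (auto simp: in_keys_iff)

lemma Toep_single: "Toep (Poly_Mapping.single k z) x = z *\<^sub>C wshift k (\<lambda>n. 1) x"
  by (subst Toep_superset[of "{k}"]) auto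

lemma Toep_add: "Toep (f + g) x = Toep f x + Toep g x"
proof -
  let ?F = "Poly_Mapping.keys f \<union> Poly_Mapping.keys g"
  have "Poly_Mapping.keys (f + g) \<subseteq> ?F" by (rule keys_add)
  then show ?thesis
    by (simp add: Toep_superset[of ?F] lookup_add scaleC_add_left sum.distrib)
qed

lemma Toep_bounded_ops: "Toep f \<in> bounded_ops"
  unfolding Toep_def[abs_def]
  by (intro bounded_ops_sum bounded_ops_comp[OF bounded_ops_scaleC] wshift_bounded_ops
      bounded_range_const)

lemma Rep_ket: "Rep_ell2 (ket j) n = (if n = j then 1 else 0)"
proof -
  have "summable (\<lambda>n. (cmod (if n = j then 1 else 0))\<^sup>2)"
    by (rule summable_finite[of "{j}"]) auto
  then show ?thesis by (simp add: ket_def Abs_ell2_inverse square_summable_def)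
qed

lemma norm_ket: "norm (ket j) = 1"
proof -
  have "(norm (ket j))\<^sup>2 = suminf (\<lambda>n. if n = j then 1 else 0)"
    unfolding norm_ell2_sq Rep_ket by (intro arg_cong[where f = suminf]) auto
  also have "\<dots> = 1"
    using sums_unique[OF sums_single[of j "\<lambda>n. 1 :: real"]] by simp
  finally have "norm (ket j) = 1 \<or> norm (ket j) = -1" by (simp only: power2_eq_1_iff)
  then show ?thesis using norm_ge_zero[of "ket j"] by linarith
qed

lemma Rep_Toep_ket: "Rep_ell2 (Toep f (ket j)) m = Poly_Mapping.lookup f (int j - int m)"
proof -
  have "Rep_ell2 (Toep f (ket j)) m =
      (\<Sum>k\<in>Poly_Mapping.keys f. if k = int j - int m then Poly_Mapping.lookup f k else 0)"
    unfolding Toep_def Rep_ell2_sum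
    by (rule sum.cong) (auto simp: Rep_ell2_ops(3) Rep_wshift coord_def Rep_ket)
  then show ?thesis by (simp add: in_keys_iff)
qed

text \<open>The parity of n tells diagonal from off-diagonal operators; S always produces the first
  component. As D is off-diagonal, n is the number of commutator factors in a product.\<close>

definition block :: "nat \<Rightarrow> (ell2 \<Rightarrow> ell2) \<Rightarrow> (ell2 \<Rightarrow> ell2) \<Rightarrow> hilb \<Rightarrow> hilb" where
  "block n S T v = (if even n then (S (fst v), T (snd v)) else (S (snd v), T (fst v)))"

lemma block_bounded_ops:
  assumes "S \<in> bounded_ops" "T \<in> bounded_ops"
  shows "block n S T \<in> bounded_ops"
proof -
  have S: "bounded_linear S" and T: "bounded_linear T" using assms by (auto simp: bounded_ops_def)
  have "bounded_linear (block n S T)"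
  proof (cases "even n")
    case True
    then have "block n S T = (\<lambda>v. (S (fst v), T (snd v)))" by (simp add: block_def fun_eq_iff)
    then show ?thesis
      using bounded_linear_Pair[OF bounded_linear_compose[OF S bounded_linear_fst]
          bounded_linear_compose[OF T bounded_linear_snd]] by simp
  next
    case False
    then have "block n S T = (\<lambda>v. (S (snd v), T (fst v)))" by (simp add: block_def fun_eq_iff)
    then show ?thesis
      using bounded_linear_Pair[OF bounded_linear_compose[OF S bounded_linear_snd]
          bounded_linear_compose[OF T bounded_linear_fst]] by simp
  qed
  then show ?thesis
    using assms by (auto simp: bounded_ops_def block_def scaleC_prod_def)
qed

text \<open>Every entry of a vector in the unit ball has modulus at most 1, so the weights
  themselves dominate the entries of the image.\<close>

lemma block_wshift_compact:
  assumes w: "square_summable w" and w': "square_summable w'"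
  shows "block n (wshift k w) (wshift k w') \<in> compact_ops"
proof (rule compact_ops_hilbI)
  note bw = square_summable_imp_bounded[OF w] and bw' = square_summable_imp_bounded[OF w']
  show "block n (wshift k w) (wshift k w') \<in> bounded_ops"
    by (intro block_bounded_ops wshift_bounded_ops bw bw')
  show "summable (\<lambda>m. (cmod (w m) + cmod (w' m))\<^sup>2)"
    using square_summable_add[of "\<lambda>m. complex_of_real (cmod (w m))" "\<lambda>m. complex_of_real (cmod (w' m))"]
      w w' unfolding square_summable_def by (simp flip: of_real_add)
  fix v :: hilb and m assume v: "norm v \<le> 1"
  have c: "cmod (coord x i) \<le> 1" if "x = fst v \<or> x = snd v" for x i
    using that v norm_coord_le[of x i] norm_fst_le[of "fst v" "snd v"] norm_snd_le[of "snd v" "fst v"] by auto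
  have a: "cmod (u * coord x i) \<le> cmod u" if "x = fst v \<or> x = snd v" for u x i
    using mult_left_mono[OF c[OF that] norm_ge_zero[of u]] by (simp add: norm_mult)
  show "cmod (Rep_ell2 (fst (block n (wshift k w) (wshift k w') v)) m) \<le> cmod (w m) + cmod (w' m)"
    using a[of _ "w m" "int m + k"] by (simp add: block_def Rep_wshift bw add_increasing2)
  show "cmod (Rep_ell2 (snd (block n (wshift k w) (wshift k w') v)) m) \<le> cmod (w m) + cmod (w' m)"
    using a[of _ "w' m" "int m + k"] by (simp add: block_def Rep_wshift bw' add_increasing)
qed

definition model :: "nat \<Rightarrow> laurent \<Rightarrow> hilb \<Rightarrow> hilb" where
  "model n f = block n (Toep f) (Toep f)"

lemma model_bounded_ops: "model n f \<in> bounded_ops"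
  unfolding model_def by (intro block_bounded_ops Toep_bounded_ops)

lemma model_add: "model n (f + g) v = model n f v + model n g v"
  by (simp add: model_def block_def Toep_add)

lemma model_zero: "model n 0 v = 0"
  by (simp add: model_def block_def Toep_def zero_prod_def)

lemma model_single:
  "model n (Poly_Mapping.single k z) v = z *\<^sub>C block n (wshift k (\<lambda>n. 1)) (wshift k (\<lambda>n. 1)) v"
  by (simp add: model_def block_def Toep_single scaleC_prod_def)

lemma model_scaleC: "model n (Poly_Mapping.single 0 z * f) v = z *\<^sub>C model n f v"
  by (induction f rule: poly_mapping_add_induct)
    (simp_all add: model_single mult_single scaleC_scaleC model_add distrib_left scaleC_add_right)

text \<open>The result of the inner shift has no entries at negative indices, so the product loses
  exactly the rows n with n + k < 0. These are finitely many, which makes the product of Toeplitz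
  operators multiplicative up to finite rank.\<close>

lemma wshift_wshift:
  "wshift k (\<lambda>n. 1) (wshift l (\<lambda>n. 1) x) - wshift (k + l) (\<lambda>n. 1) x
    = wshift (k + l) (\<lambda>n. if int n + k < 0 then -1 else 0) x"
proof -
  have b: "bounded (range (\<lambda>n. if int n + k < 0 then -1 else 0 :: complex))"
    by (auto simp: bounded_iff intro: exI[of _ 1])
  show ?thesis
    by (rule ell2_eqI, unfold Rep_ell2_diff Rep_wshift[OF b] Rep_wshift[OF bounded_range_const])
      (simp add: Rep_wshift[OF bounded_range_const] coord_def add.assoc)
qed

text \<open>Additivity in f and in g reduces the claim to monomials, where the error is the finite
  rank term of \<open>wshift_wshift\<close>.\<close>

lemma model_mult: "(\<lambda>v. model n f (model m g v) - model (n + m) (f * g) v) \<in> compact_ops"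
proof (induction f rule: poly_mapping_add_induct)
  case (single k a)
  show ?case
  proof (induction g rule: poly_mapping_add_induct)
    case (single l b)
    let ?u = "\<lambda>i. if int i + k < 0 then -1 else 0 :: complex"
    have "finite {i. int i + k < 0}"
      by (rule finite_subset[of _ "{..<nat (- k)}"]) auto
    then have "square_summable ?u"
      unfolding square_summable_def by (rule summable_finite) auto
    then have "(\<lambda>v. (a * b) *\<^sub>C block (n + m) (wshift (k + l) ?u) (wshift (k + l) ?u) v) \<in> compact_ops"
      by (intro compact_ops_scaleC block_wshift_compact)
    moreover have "model n (Poly_Mapping.single k a) (model m (Poly_Mapping.single l b) v)
        - model (n + m) (Poly_Mapping.single k a * Poly_Mapping.single l b) v
      = (a * b) *\<^sub>C block (n + m) (wshift (k + l) ?u) (wshift (k + l) ?u) v" for v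
      using bounded_ops_linear(4)[OF wshift_bounded_ops[OF bounded_range_const[of 1]]]
      by (simp add: model_single mult_single block_def scaleC_prod_def scaleC_scaleC
          scaleC_diff_right flip: wshift_wshift)
    ultimately show ?case by simp
  next
    case (add g h)
    show ?case
      using compact_ops_add[OF add]
      by (simp add: model_add distrib_left bounded_ops_linear(1)[OF model_bounded_ops] add_diff_add)
  qed
next
  case (add f h)
  show ?case
    using compact_ops_add[OF add] by (simp add: model_add distrib_right add_diff_add)
qed

text \<open>A compact operator sends the basis vectors to a sequence with a convergent subsequence.
  Each fixed entry of \<open>Toep f (ket j)\<close> is 0 for large j, so the limit is 0 and the
  norms tend to 0. But for j >= k the entry in row j - k is the coefficient of z^k in f, so this
  coefficient vanishes.\<close>

lemma model_compact_iff: "model n f \<in> compact_ops \<longleftrightarrow> f = 0"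
proof
  assume comp: "model n f \<in> compact_ops"
  let ?K = "closure (model n f ` cball 0 1)"
  have "seq_compact ?K"
    using compact_ops_compact[OF comp] by (simp add: compact_eq_seq_compact_metric)
  moreover have "\<forall>j. model n f (ket j, 0) \<in> ?K"
    by (simp add: image_unit_ball_in_closure norm_Pair norm_ket)
  ultimately obtain L r where r: "strict_mono r"
    and lim: "((\<lambda>j. model n f (ket j, 0)) \<circ> r) \<longlonglongrightarrow> L"
    by (rule seq_compactE)
  have "Toep f 0 = 0" by (rule bounded_ops_linear(3)[OF Toep_bounded_ops])
  \<comment> \<open>One component of the image is \<open>Toep f (ket j)\<close> and the other is 0;
    adding them treats both parities at once.\<close>
  then have sum: "fst (model n f (ket j, 0)) + snd (model n f (ket j, 0)) = Toep f (ket j)" for j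
    by (simp add: model_def block_def)
  define l where "l = fst L + snd L"
  have Tl: "(\<lambda>j. Toep f (ket (r j))) \<longlonglongrightarrow> l"
    using tendsto_add[OF tendsto_fst[OF lim] tendsto_snd[OF lim]] by (simp add: l_def sum comp_def)
  then have Tn: "(\<lambda>j. norm (Toep f (ket (r j)) - l)) \<longlonglongrightarrow> 0"
    by (simp add: tendsto_norm_zero LIM_zero)
  have coord_lim: "(\<lambda>j. Rep_ell2 (Toep f (ket (r j))) m) \<longlonglongrightarrow> Rep_ell2 l m" for m
  proof (rule LIM_zero_cancel, rule Lim_null_comparison[OF _ Tn], rule always_eventually, rule allI)
    show "cmod (Rep_ell2 (Toep f (ket (r j))) m - Rep_ell2 l m) \<le> norm (Toep f (ket (r j)) - l)" for j
      using norm_Rep_ell2_le[of "Toep f (ket (r j)) - l" m] by (simp add: Rep_ell2_diff)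
  qed
  obtain B where B: "\<And>k. k \<in> Poly_Mapping.keys f \<Longrightarrow> k \<le> B"
    using bdd_above_finite[OF finite_keys[of f]] by (auto simp: bdd_above_def)
  have "Rep_ell2 l m = 0" for m
  proof (rule LIMSEQ_unique[OF coord_lim])
    have "eventually (\<lambda>j. Rep_ell2 (Toep f (ket (r j))) m = 0) sequentially"
      using eventually_gt_at_top[of "nat (B + int m)"]
    proof eventually_elim
      case (elim j)
      then have "int (r j) - int m > B" using seq_suble[OF r, of j] by linarith
      then show ?case using B by (force simp: Rep_Toep_ket in_keys_iff)
    qed
    then show "(\<lambda>j. Rep_ell2 (Toep f (ket (r j))) m) \<longlonglongrightarrow> 0" by (rule tendsto_eventually)
  qed
  then have "l = 0" by (intro ell2_eqI) (simp add: Rep_ell2_ops(1))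
  with Tn have Tn0: "(\<lambda>j. norm (Toep f (ket (r j)))) \<longlonglongrightarrow> 0" by simp
  show "f = 0"
  proof (rule poly_mapping_eqI)
    fix k
    have "eventually (\<lambda>j. cmod (Poly_Mapping.lookup f k) \<le> norm (Toep f (ket (r j)))) sequentially"
      using eventually_ge_at_top[of "nat k"]
    proof eventually_elim
      case (elim j)
      then have "int (r j) \<ge> k" using seq_suble[OF r, of j] by linarith
      then show ?case
        using norm_Rep_ell2_le[of "Toep f (ket (r j))" "nat (int (r j) - k)"] by (simp add: Rep_Toep_ket)
    qed
    then have "cmod (Poly_Mapping.lookup f k) \<le> 0"
      by (intro tendsto_le[OF _ Tn0 tendsto_const]) auto
    then show "Poly_Mapping.lookup f k = Poly_Mapping.lookup 0 k" by simp
  qed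
next
  assume "f = 0"
  then show "model n f \<in> compact_ops"
    using compact_ops_zero by (simp add: model_zero[abs_def])
qed

section \<open>Operators with a symbol modulo compact operators\<close>

text \<open>Only the parity of n matters for the operator; it is kept as a number so that it adds up
  under composition, like the degree of forms.\<close>

definition has_symbol :: "nat \<Rightarrow> (hilb \<Rightarrow> hilb) \<Rightarrow> laurent \<Rightarrow> bool" where
  "has_symbol n T f \<longleftrightarrow> T \<in> bounded_ops \<and> (\<lambda>v. T v - model n f v) \<in> compact_ops"

lemma has_symbol_bounded: "has_symbol n T f \<Longrightarrow> T \<in> bounded_ops"
  by (simp add: has_symbol_def)

lemma has_symbol_zero: "has_symbol n (\<lambda>v. 0) 0"
  by (simp add: has_symbol_def model_zero bounded_ops_zero compact_ops_zero)

lemma has_symbol_id: "has_symbol 0 (\<lambda>v. v) 1"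
proof -
  have "wshift 0 (\<lambda>n. 1) x = x" for x
    by (rule ell2_eqI) (simp add: Rep_wshift coord_def)
  then have "model 0 1 v = v" for v
    unfolding single_one[symmetric] model_single by (simp add: block_def)
  then show ?thesis by (simp add: has_symbol_def bounded_ops_id compact_ops_zero)
qed

lemma has_symbol_add:
  assumes "has_symbol n S f" "has_symbol n T g"
  shows "has_symbol n (\<lambda>v. S v + T v) (f + g)"
proof -
  have "(\<lambda>v. (S v - model n f v) + (T v - model n g v)) \<in> compact_ops"
    using assms by (intro compact_ops_add) (auto simp: has_symbol_def)
  then show ?thesis
    using assms by (simp add: has_symbol_def model_add add_diff_add bounded_ops_add)
qed

lemma has_symbol_scaleC:
  assumes "has_symbol n T f"
  shows "has_symbol n (\<lambda>v. z *\<^sub>C T v) (Poly_Mapping.single 0 z * f)"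
  using assms bounded_ops_comp[OF bounded_ops_scaleC, of T z]
    compact_ops_scaleC[of "\<lambda>v. T v - model n f v" z]
  by (simp add: has_symbol_def model_scaleC scaleC_diff_right)

lemma has_symbol_mult:
  assumes "has_symbol n S f" "has_symbol m T g"
  shows "has_symbol (n + m) (\<lambda>v. S (T v)) (f * g)"
proof -
  have S: "S \<in> bounded_ops" "(\<lambda>v. S v - model n f v) \<in> compact_ops"
    and T: "T \<in> bounded_ops" "(\<lambda>v. T v - model m g v) \<in> compact_ops"
    using assms by (auto simp: has_symbol_def)
  have "(\<lambda>v. (S (T v) - model n f (T v)) + model n f (T v - model m g v)) \<in> compact_ops"
    by (rule compact_ops_add[OF compact_ops_comp_right[OF S(2) T(1)]
          compact_ops_comp_left[OF model_bounded_ops T(2)]])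
  from compact_ops_add[OF this model_mult[of n f m g]]
  have "(\<lambda>v. S (T v) - model (n + m) (f * g) v) \<in> compact_ops"
    by (simp add: bounded_ops_linear(2)[OF model_bounded_ops])
  then show ?thesis
    using bounded_ops_comp[OF S(1) T(1)] by (simp add: has_symbol_def)
qed

lemma has_symbol_sum:
  "(\<And>i. i \<in> I \<Longrightarrow> has_symbol n (T i) (f i)) \<Longrightarrow> has_symbol n (\<lambda>v. \<Sum>i\<in>I. T i v) (\<Sum>i\<in>I. f i)"
  by (induction I rule: infinite_finite_induct) (auto intro: has_symbol_zero has_symbol_add)

lemma has_symbol_calkin: "has_symbol n T f \<Longrightarrow> calkin T = calkin (model n f)"
  by (intro calkin_cong model_bounded_ops) (auto simp: has_symbol_def)

lemma calkin_model_eq_zero_iff: "calkin (model n f) = calkin (\<lambda>v. 0) \<longleftrightarrow> f = 0"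
  by (simp add: calkin_eq_zero_iff model_bounded_ops model_compact_iff)

section \<open>Commutators with the Dirac operator\<close>

text \<open>The derivation \<partial> of the overview. The sign comes from the commutator of N with
  the shift (S x)_n = x_(n+k): N contributes n on the left of S and n + k on the right, hence [N, S]
  = - k S.\<close>

definition dlog :: "laurent \<Rightarrow> laurent" where
  "dlog f = Poly_Mapping.mapp (\<lambda>k z. - of_int k * z) f"

lemma lookup_dlog: "Poly_Mapping.lookup (dlog f) k = - of_int k * Poly_Mapping.lookup f k"
  by (auto simp: dlog_def lookup_mapp when_def in_keys_iff)

lemma dlog_single: "dlog (Poly_Mapping.single k z) = Poly_Mapping.single k (- of_int k * z)"
  by (rule poly_mapping_eqI) (simp add: lookup_dlog lookup_single when_def)

lemma dlog_add: "dlog (f + g) = dlog f + dlog g"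
  by (rule poly_mapping_eqI) (simp add: lookup_dlog lookup_add algebra_simps)

lemma dlog_scale: "dlog (Poly_Mapping.single 0 z * f) = Poly_Mapping.single 0 z * dlog f"
  by (induction f rule: poly_mapping_add_induct)
    (simp_all add: dlog_single mult_single dlog_add distrib_left mult.left_commute)

lemma dlog_mult: "dlog (f * g) = f * dlog g + dlog f * g"
proof (induction f rule: poly_mapping_add_induct)
  case (single k a)
  show ?case
    by (induction g rule: poly_mapping_add_induct)
      (simp_all add: dlog_single mult_single dlog_add distrib_left algebra_simps flip: single_add)
qed (simp add: dlog_add distrib_right)

section \<open>Square summability of weights\<close>

lemma square_summable_mono:
  assumes "square_summable g" "\<And>n. cmod (f n) \<le> K * cmod (g n)"
  shows "square_summable f"
  unfolding square_summable_def
proof (rule summable_comparison_test')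
  show "summable (\<lambda>n. K\<^sup>2 * (cmod (g n))\<^sup>2)"
    using assms(1) by (simp add: square_summable_def summable_mult)
  show "norm ((cmod (f n))\<^sup>2) \<le> K\<^sup>2 * (cmod (g n))\<^sup>2" for n
    using power_mono[OF assms(2)[of n] norm_ge_zero, of 2] by (simp add: power_mult_distrib)
qed

lemma square_summable_diff:
  "square_summable f \<Longrightarrow> square_summable g \<Longrightarrow> square_summable (\<lambda>n. f n - g n)"
  using square_summable_add[OF _ square_summable_scale[of g "-1"], of f] by simp

text \<open>(n + 1) r^n is the general term of the differentiated geometric series. Being summable
  it is bounded, and a bounded summable sequence of nonnegative terms is square summable.\<close>

lemma square_summable_geometric:
  assumes "0 \<le> r" "r < 1" "\<And>n. cmod (f n) \<le> K * r ^ n"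
  shows "square_summable (\<lambda>n. of_nat (Suc n) * f n)"
proof -
  let ?g = "\<lambda>n. real (Suc n) * r ^ n"
  have g: "summable ?g"
    using geometric_deriv_sums[of r] assms(1,2) by (simp add: sums_iff)
  then obtain M where M: "\<And>n. norm (?g n) \<le> M"
    using summable_imp_Bseq[of ?g] by (auto simp: Bseq_def)
  have "square_summable (\<lambda>n. complex_of_real (?g n))"
    unfolding square_summable_def
  proof (rule summable_comparison_test')
    show "summable (\<lambda>n. M * ?g n)" by (rule summable_mult[OF g])
    show "norm ((cmod (complex_of_real (?g n)))\<^sup>2) \<le> M * ?g n" for n
    proof -
      have "?g n \<ge> 0" using assms(1) by simp
      then have "?g n * ?g n \<le> M * ?g n"
        using M[of n] by (intro mult_right_mono) auto
      then show ?thesis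
        unfolding norm_of_real power2_abs real_norm_def abs_power2
        unfolding power2_eq_square .
    qed
  qed
  then show ?thesis
  proof (rule square_summable_mono)
    show "cmod (of_nat (Suc n) * f n) \<le> K * cmod (complex_of_real (?g n))" for n
    proof -
      have "real (Suc n) * cmod (f n) \<le> real (Suc n) * (K * r ^ n)"
        using assms(3)[of n] by (intro mult_left_mono) auto
      moreover have "cmod (complex_of_real (?g n)) = ?g n"
        unfolding norm_of_real using assms(1) by simp
      moreover have "cmod (of_nat (Suc n) * f n) = real (Suc n) * cmod (f n)"
        by (simp only: norm_mult norm_of_nat)
      ultimately show ?thesis by (simp only: mult.left_commute)
    qed
  qed
qed

section \<open>The domains of N and D, and uniqueness of the extended commutator\<close>

lemma dom_N_add: "x \<in> dom_N \<Longrightarrow> y \<in> dom_N \<Longrightarrow> x + y \<in> dom_N"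
  unfolding dom_N_def mem_Collect_eq Rep_ell2_ops
  using square_summable_add by (fastforce simp: distrib_left)

lemma dom_N_scaleC: "x \<in> dom_N \<Longrightarrow> z *\<^sub>C x \<in> dom_N"
  unfolding dom_N_def mem_Collect_eq Rep_ell2_ops
  using square_summable_scale[of "\<lambda>n. of_nat n * Rep_ell2 x n" z] by (simp add: mult.left_commute)

lemma Rep_op_N: "x \<in> dom_N \<Longrightarrow> Rep_ell2 (op_N x) n = of_nat n * Rep_ell2 x n"
  by (simp add: op_N_def dom_N_def Abs_ell2_inverse)

lemma coord_op_N: "x \<in> dom_N \<Longrightarrow> coord (op_N x) k = of_int k * coord x k"
  by (simp add: coord_def Rep_op_N)

lemma op_N_add: "x \<in> dom_N \<Longrightarrow> y \<in> dom_N \<Longrightarrow> op_N (x + y) = op_N x + op_N y"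
  by (rule ell2_eqI) (simp add: Rep_op_N dom_N_add Rep_ell2_ops(2) distrib_left)

lemma op_N_scaleC: "x \<in> dom_N \<Longrightarrow> op_N (z *\<^sub>C x) = z *\<^sub>C op_N x"
  by (rule ell2_eqI) (simp add: Rep_op_N dom_N_scaleC Rep_ell2_ops(3) mult.left_commute)

lemma dom_D_add: "v \<in> dom_D \<Longrightarrow> w \<in> dom_D \<Longrightarrow> v + w \<in> dom_D"
  by (auto simp: dom_D_def dom_N_add)

lemma dom_D_scaleC: "v \<in> dom_D \<Longrightarrow> z *\<^sub>C v \<in> dom_D"
  by (auto simp: dom_D_def scaleC_prod_def dom_N_scaleC)

lemma op_D_add: "v \<in> dom_D \<Longrightarrow> w \<in> dom_D \<Longrightarrow> op_D (v + w) = op_D v + op_D w"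
  by (auto simp: dom_D_def op_D_def op_N_add)

lemma op_D_scaleC: "v \<in> dom_D \<Longrightarrow> op_D (z *\<^sub>C v) = z *\<^sub>C op_D v"
  by (auto simp: dom_D_def op_D_def op_N_scaleC scaleC_prod_def)

text \<open>Truncations of x lie in the domain, having finitely many nonzero entries, and converge
  to x by Tannery's theorem.\<close>

lemma dom_N_dense:
  fixes x :: ell2
  obtains X where "\<And>j. X j \<in> dom_N" "X \<longlonglongrightarrow> x"
proof -
  define X where "X j = Abs_ell2 (\<lambda>n. if n < j then Rep_ell2 x n else 0)" for j :: nat
  have fin: "square_summable (\<lambda>n. if n < j then g n else 0)" for g and j :: nat
    unfolding square_summable_def by (rule summable_finite[of "{..<j}"]) auto
  have RX: "Rep_ell2 (X j) = (\<lambda>n. if n < j then Rep_ell2 x n else 0)" for j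
    unfolding X_def by (rule Abs_ell2_inverse) (simp add: fin)
  have "X j \<in> dom_N" for j
    using fin[of j "\<lambda>n. of_nat n * Rep_ell2 x n"]
    by (simp add: dom_N_def RX if_distrib cong: if_cong)
  moreover have "X \<longlonglongrightarrow> x"
  proof -
    have "(\<lambda>j. suminf (\<lambda>n. (cmod (Rep_ell2 (X j - x) n))\<^sup>2)) \<longlonglongrightarrow> suminf (\<lambda>n. 0)"
    proof (rule tannerys_theorem[THEN conjunct2, THEN conjunct2])
      show "(\<lambda>j. (cmod (Rep_ell2 (X j - x) n))\<^sup>2) \<longlonglongrightarrow> 0" for n
        by (rule tendsto_eventually, rule eventually_mono[OF eventually_gt_at_top[of n]])
          (simp add: Rep_ell2_diff RX)
      show "summable (\<lambda>n. (cmod (Rep_ell2 x n))\<^sup>2)"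
        using square_summable_Rep[of x] by (simp add: square_summable_def)
      show "eventually (\<lambda>(n, j). norm ((cmod (Rep_ell2 (X j - x) n))\<^sup>2) \<le> (cmod (Rep_ell2 x n))\<^sup>2)
          (at_top \<times>\<^sub>F sequentially)"
        by (intro always_eventually) (simp add: Rep_ell2_diff RX)
    qed simp
    then have "(\<lambda>j. (norm (X j - x))\<^sup>2) \<longlonglongrightarrow> 0"
      by (simp add: norm_ell2_sq)
    from tendsto_real_sqrt[OF this] show ?thesis
      by (simp add: LIM_zero_cancel tendsto_norm_zero_iff)
  qed
  ultimately show thesis by (rule that)
qed

lemma bounded_ops_eq_on_dom_D:
  assumes "S \<in> bounded_ops" "T \<in> bounded_ops" "\<And>v. v \<in> dom_D \<Longrightarrow> S v = T v"
  shows "S = T"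
proof
  fix v :: hilb
  obtain X where X: "\<And>j. X j \<in> dom_N" "X \<longlonglongrightarrow> fst v"
    using dom_N_dense[of "fst v"] by blast
  obtain Y where Y: "\<And>j. Y j \<in> dom_N" "Y \<longlonglongrightarrow> snd v"
    using dom_N_dense[of "snd v"] by blast
  have lim: "(\<lambda>j. (X j, Y j)) \<longlonglongrightarrow> v"
    using tendsto_Pair[OF X(2) Y(2)] by simp
  have S: "(\<lambda>j. S (X j, Y j)) \<longlonglongrightarrow> S v" and T: "(\<lambda>j. T (X j, Y j)) \<longlonglongrightarrow> T v"
    using assms(1,2) lim by (auto simp: bounded_ops_def intro: bounded_linear.tendsto)
  have "S (X j, Y j) = T (X j, Y j)" for j
    by (rule assms(3)) (simp add: dom_D_def X(1) Y(1))
  then show "S v = T v" using S T by (simp add: LIMSEQ_unique)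
qed

text \<open>As T preserves \<open>dom_D\<close>, the condition in the definite description applies
  on all of \<open>dom_D\<close>, and density of \<open>dom_D\<close> makes the bounded extension
  unique.\<close>

lemma bounded_commutator_eq:
  assumes "S \<in> bounded_ops" "\<And>v. v \<in> dom_D \<Longrightarrow> T v \<in> dom_D"
    and "\<And>v. v \<in> dom_D \<Longrightarrow> S v = op_D (T v) - T (op_D v)"
  shows "bounded_commutator dom_D op_D T = S"
  unfolding bounded_commutator_def
proof (rule the_equality)
  fix S' :: "hilb \<Rightarrow> hilb"
  assume S': "S' \<in> bounded_ops \<and> (\<forall>v\<in>dom_D. T v \<in> dom_D \<longrightarrow> S' v = op_D (T v) - T (op_D v))"
  then show "S' = S"
    using assms by (intro bounded_ops_eq_on_dom_D) auto
qed (use assms in auto)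

section \<open>Operators whose commutator with D has a symbol\<close>

text \<open>Stated with an explicit extension S instead of \<open>bounded_commutator\<close>, so
  that closure under the algebra operations becomes a computation with vectors of
  \<open>dom_D\<close>.\<close>

definition regular :: "(hilb \<Rightarrow> hilb) \<Rightarrow> laurent \<Rightarrow> bool" where
  "regular T f \<longleftrightarrow> has_symbol 0 T f \<and> (\<forall>v\<in>dom_D. T v \<in> dom_D) \<and>
     (\<exists>S. has_symbol 1 S (dlog f) \<and> (\<forall>v\<in>dom_D. S v = op_D (T v) - T (op_D v)))"

lemma regularE:
  assumes "regular T f"
  obtains S where "has_symbol 0 T f" "\<And>v. v \<in> dom_D \<Longrightarrow> T v \<in> dom_D" "has_symbol 1 S (dlog f)"
    "\<And>v. v \<in> dom_D \<Longrightarrow> S v = op_D (T v) - T (op_D v)"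
  using assms unfolding regular_def by blast

lemma regular_commutator:
  assumes "regular T f"
  shows "has_symbol 1 (bounded_commutator dom_D op_D T) (dlog f)"
  using assms
proof (rule regularE)
  fix S
  assume *: "\<And>v. v \<in> dom_D \<Longrightarrow> T v \<in> dom_D" "has_symbol 1 S (dlog f)"
    "\<And>v. v \<in> dom_D \<Longrightarrow> S v = op_D (T v) - T (op_D v)"
  have "bounded_commutator dom_D op_D T = S"
    by (rule bounded_commutator_eq[OF has_symbol_bounded[OF *(2)]]) (use * in auto)
  then show ?thesis using *(2) by simp
qed

lemma regular_add:
  assumes S: "regular S f" and T: "regular T g"
  shows "regular (\<lambda>v. S v + T v) (f + g)"
proof -
  obtain S' where S': "has_symbol 0 S f" "\<And>v. v \<in> dom_D \<Longrightarrow> S v \<in> dom_D" "has_symbol 1 S' (dlog f)"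
    "\<And>v. v \<in> dom_D \<Longrightarrow> S' v = op_D (S v) - S (op_D v)" using regularE[OF S] by blast
  obtain T' where T': "has_symbol 0 T g" "\<And>v. v \<in> dom_D \<Longrightarrow> T v \<in> dom_D" "has_symbol 1 T' (dlog g)"
    "\<And>v. v \<in> dom_D \<Longrightarrow> T' v = op_D (T v) - T (op_D v)" using regularE[OF T] by blast
  show ?thesis
    unfolding regular_def
  proof (intro conjI ballI exI)
    show "has_symbol 0 (\<lambda>v. S v + T v) (f + g)" by (rule has_symbol_add[OF S'(1) T'(1)])
    show "has_symbol 1 (\<lambda>v. S' v + T' v) (dlog (f + g))"
      unfolding dlog_add by (rule has_symbol_add[OF S'(3) T'(3)])
  qed (simp_all add: dom_D_add op_D_add S' T')
qed

lemma regular_scaleC: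
  assumes T: "regular T f"
  shows "regular (\<lambda>v. z *\<^sub>C T v) (Poly_Mapping.single 0 z * f)"
proof -
  obtain T' where T': "has_symbol 0 T f" "\<And>v. v \<in> dom_D \<Longrightarrow> T v \<in> dom_D" "has_symbol 1 T' (dlog f)"
    "\<And>v. v \<in> dom_D \<Longrightarrow> T' v = op_D (T v) - T (op_D v)" using regularE[OF T] by blast
  show ?thesis
    unfolding regular_def
  proof (intro conjI ballI exI)
    show "has_symbol 0 (\<lambda>v. z *\<^sub>C T v) (Poly_Mapping.single 0 z * f)"
      by (rule has_symbol_scaleC[OF T'(1)])
    show "has_symbol 1 (\<lambda>v. z *\<^sub>C T' v) (dlog (Poly_Mapping.single 0 z * f))"
      unfolding dlog_scale by (rule has_symbol_scaleC[OF T'(3)])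
  qed (simp_all add: dom_D_scaleC op_D_scaleC T' scaleC_diff_right)
qed

lemma regular_mult:
  assumes S: "regular S f" and T: "regular T g"
  shows "regular (\<lambda>v. S (T v)) (f * g)"
proof -
  obtain S' where S': "has_symbol 0 S f" "\<And>v. v \<in> dom_D \<Longrightarrow> S v \<in> dom_D" "has_symbol 1 S' (dlog f)"
    "\<And>v. v \<in> dom_D \<Longrightarrow> S' v = op_D (S v) - S (op_D v)" using regularE[OF S] by blast
  obtain T' where T': "has_symbol 0 T g" "\<And>v. v \<in> dom_D \<Longrightarrow> T v \<in> dom_D" "has_symbol 1 T' (dlog g)"
    "\<And>v. v \<in> dom_D \<Longrightarrow> T' v = op_D (T v) - T (op_D v)" using regularE[OF T] by blast
  show ?thesis
    unfolding regular_def
  proof (intro conjI ballI exI)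
    show "has_symbol 0 (\<lambda>v. S (T v)) (f * g)"
      using has_symbol_mult[OF S'(1) T'(1)] by simp
    \<comment> \<open>The Leibniz rule [D, S T] = S [D, T] + [D, S] T on the operator side meets the
      Leibniz rule for \<open>dlog\<close> on the symbol side.\<close>
    show "has_symbol 1 (\<lambda>v. S (T' v) + S' (T v)) (dlog (f * g))"
      unfolding dlog_mult
      using has_symbol_add[OF has_symbol_mult[OF S'(1) T'(3)] ] has_symbol_mult[OF S'(3) T'(1)] by simp
    fix v assume "v \<in> dom_D"
    then show "S (T v) \<in> dom_D" "S (T' v) + S' (T v) = op_D (S (T v)) - S (T (op_D v))"
      using bounded_ops_linear(2)[OF has_symbol_bounded[OF S'(1)]] by (simp_all add: S' T')
  qed
qed

section \<open>Weighted shifts are regular\<close>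

text \<open>Subtracting the common limit \<kappa> leaves square summable weights, hence a compact
  operator.\<close>

lemma block_wshift_has_symbol:
  assumes "square_summable (\<lambda>n. u n - \<kappa>)" "square_summable (\<lambda>n. u' n - \<kappa>)"
  shows "has_symbol n (block n (wshift k u) (wshift k u')) (Poly_Mapping.single k \<kappa>)"
proof -
  have b: "bounded (range u)" "bounded (range u')"
    using bounded_plus_comp[OF square_summable_imp_bounded[OF assms(1)], of "\<lambda>n. \<kappa>"]
      bounded_plus_comp[OF square_summable_imp_bounded[OF assms(2)], of "\<lambda>n. \<kappa>"] by auto
  have split: "wshift k w x - \<kappa> *\<^sub>C wshift k (\<lambda>n. 1) x = wshift k (\<lambda>n. w n - \<kappa>) x"
    if "bounded (range w)" "square_summable (\<lambda>n. w n - \<kappa>)" for w x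
    by (rule ell2_eqI, unfold Rep_ell2_diff Rep_ell2_ops(3) Rep_wshift[OF that(1)]
        Rep_wshift[OF bounded_range_const] Rep_wshift[OF square_summable_imp_bounded[OF that(2)]])
      (simp add: algebra_simps)
  have "block n (wshift k u) (wshift k u') v - model n (Poly_Mapping.single k \<kappa>) v
      = block n (wshift k (\<lambda>n. u n - \<kappa>)) (wshift k (\<lambda>n. u' n - \<kappa>)) v" for v
    by (simp add: model_single block_def scaleC_prod_def
        flip: split[OF b(1) assms(1)] split[OF b(2) assms(2)])
  then show ?thesis
    unfolding has_symbol_def
    by (simp add: block_wshift_compact assms block_bounded_ops wshift_bounded_ops b)
qed

text \<open>n u_n x_(n+k) = u_n (n + k) x_(n+k) - k u_n x_(n+k), and the first term is the shift
  applied to \<open>op_N x\<close>.\<close>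

lemma wshift_dom_N:
  assumes u: "bounded (range u)" and x: "x \<in> dom_N"
  shows "wshift k u x \<in> dom_N"
proof -
  have "square_summable (\<lambda>n. u n * coord (op_N x) (int n + k) - of_int k * (u n * coord x (int n + k)))"
    by (intro square_summable_diff square_summable_scale square_summable_weighted u)
  then show ?thesis
    unfolding dom_N_def mem_Collect_eq Rep_wshift[OF u] coord_op_N[OF x]
    by (simp add: algebra_simps)
qed

text \<open>Two weights occur because D exchanges the components. N multiplies by n when it acts on
  the output of the shift, and by n + k when it acts on the input entry x_(n+k).\<close>

lemma commutator_wshift:
  assumes u: "bounded (range u)" and u': "bounded (range u')"
    and w: "bounded (range (\<lambda>n. of_nat n * u' n - of_int (int n + k) * u n))" and x: "x \<in> dom_N"
  shows "wshift k (\<lambda>n. of_nat n * u' n - of_int (int n + k) * u n) x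
    = op_N (wshift k u' x) - wshift k u (op_N x)"
  by (rule ell2_eqI, unfold Rep_ell2_diff Rep_wshift[OF u] Rep_wshift[OF w]
      Rep_op_N[OF wshift_dom_N[OF u' x]] Rep_wshift[OF u'] coord_op_N[OF x])
    (simp add: algebra_simps)

text \<open>The sequence equals n (u'_n - \<kappa>) - (n + k) (u_n - \<kappa>): the terms n \<kappa>
  cancel since both weights have the same limit.\<close>

lemma square_summable_commutator_weight:
  assumes "square_summable (\<lambda>n. of_nat (Suc n) * (u n - \<kappa>))"
    and "square_summable (\<lambda>n. of_nat (Suc n) * (u' n - \<kappa>))"
  shows "square_summable (\<lambda>n. (of_nat n * u' n - of_int (int n + k) * u n) - (- of_int k * \<kappa>))"
proof -
  have "square_summable (\<lambda>n. of_nat n * (u' n - \<kappa>))"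
    using assms(2) by (rule square_summable_mono[where K = 1])
      (simp add: norm_mult mult_right_mono del: of_nat_Suc)
  moreover have "square_summable (\<lambda>n. of_int (int n + k) * (u n - \<kappa>))"
    using assms(1)
  proof (rule square_summable_mono)
    fix n
    have "\<bar>real_of_int (int n + k)\<bar> \<le> real n + \<bar>real_of_int k\<bar>" by simp
    also have "\<dots> \<le> (1 + \<bar>real_of_int k\<bar>) * real (Suc n)" by (simp add: algebra_simps)
    finally have "\<bar>real_of_int (int n + k)\<bar> \<le> (1 + \<bar>real_of_int k\<bar>) * real (Suc n)" .
    from mult_right_mono[OF this norm_ge_zero[of "u n - \<kappa>"]]
    show "cmod (of_int (int n + k) * (u n - \<kappa>)) \<le> (1 + \<bar>real_of_int k\<bar>) * cmod (of_nat (Suc n) * (u n - \<kappa>))"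
      by (simp only: norm_mult norm_of_int norm_of_nat mult.assoc)
  qed
  ultimately have "square_summable (\<lambda>n. of_nat n * (u' n - \<kappa>) - of_int (int n + k) * (u n - \<kappa>))"
    by (rule square_summable_diff)
  then show ?thesis by (simp add: algebra_simps)
qed

lemma regular_block_wshift:
  assumes u: "square_summable (\<lambda>n. of_nat (Suc n) * (u n - \<kappa>))"
    and u': "square_summable (\<lambda>n. of_nat (Suc n) * (u' n - \<kappa>))"
  shows "regular (block 0 (wshift k u) (wshift k u')) (Poly_Mapping.single k \<kappa>)"
proof -
  have ss: "square_summable f" if "square_summable (\<lambda>n. of_nat (Suc n) * f n)" for f
    using that
  proof (rule square_summable_mono[where K = 1])
    show "cmod (f n) \<le> 1 * cmod (of_nat (Suc n) * f n)" for n
      using mult_right_mono[of 1 "real (Suc n)" "cmod (f n)"] by (simp add: norm_mult del: of_nat_Suc)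
  qed
  have bd: "bounded (range f)" if "square_summable (\<lambda>n. f n - a)" for f a
    using bounded_plus_comp[OF square_summable_imp_bounded[OF that], of "\<lambda>n. a"] by simp
  note b = bd[OF ss[OF u]] and b' = bd[OF ss[OF u']]
  \<comment> \<open>The two entries of the commutator exchange the roles of u and u'. Both weights
    tend to - k \<kappa>, the coefficient of \<open>dlog\<close> of \<kappa> z^k.\<close>
  define w where "w = (\<lambda>n. of_nat n * u' n - of_int (int n + k) * u n)"
  define w' where "w' = (\<lambda>n. of_nat n * u n - of_int (int n + k) * u' n)"
  have w: "square_summable (\<lambda>n. w n - (- of_int k * \<kappa>))"
    unfolding w_def by (rule square_summable_commutator_weight[OF u u'])
  have w': "square_summable (\<lambda>n. w' n - (- of_int k * \<kappa>))"
    unfolding w'_def by (rule square_summable_commutator_weight[OF u' u])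
  have cw: "wshift k w x = op_N (wshift k u' x) - wshift k u (op_N x)" if "x \<in> dom_N" for x
    using commutator_wshift[OF b b' bd[OF w, unfolded w_def] that] by (simp add: w_def)
  have cw': "wshift k w' x = op_N (wshift k u x) - wshift k u' (op_N x)" if "x \<in> dom_N" for x
    using commutator_wshift[OF b' b bd[OF w', unfolded w'_def] that] by (simp add: w'_def)
  show ?thesis
    unfolding regular_def
  proof (intro conjI ballI exI)
    show "has_symbol 0 (block 0 (wshift k u) (wshift k u')) (Poly_Mapping.single k \<kappa>)"
      by (rule block_wshift_has_symbol[OF ss[OF u] ss[OF u']])
    show "has_symbol 1 (block 1 (wshift k w) (wshift k w')) (dlog (Poly_Mapping.single k \<kappa>))"
      unfolding dlog_single by (rule block_wshift_has_symbol[OF w w'])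
    fix v assume v: "v \<in> dom_D"
    then show "block 0 (wshift k u) (wshift k u') v \<in> dom_D"
      by (auto simp: block_def dom_D_def wshift_dom_N b b')
    from v show "block 1 (wshift k w) (wshift k w') v
        = op_D (block 0 (wshift k u) (wshift k u') v) - block 0 (wshift k u) (wshift k u') (op_D v)"
      by (auto simp: block_def dom_D_def op_D_def cw cw')
  qed
qed

section \<open>The representations of the Podles sphere as weighted shifts\<close>

lemma cinner_ket_left: "cinner (ket n) x = Rep_ell2 x n"
proof -
  have "cinner (ket n) x = suminf (\<lambda>k. if k = n then Rep_ell2 x k else 0)"
    unfolding cinner_def Rep_ket by (intro arg_cong[where f = suminf]) auto
  also have "\<dots> = Rep_ell2 x n"
    by (rule sums_unique[OF sums_single, symmetric])
  finally show ?thesis .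
qed

lemma cinner_scaled_ket_left: "cinner (z *\<^sub>C ket n) x = cnj z * Rep_ell2 x n"
proof -
  have "cinner (z *\<^sub>C ket n) x = suminf (\<lambda>k. if k = n then cnj z * Rep_ell2 x k else 0)"
    unfolding cinner_def Rep_ket Rep_ell2_ops(3) by (intro arg_cong[where f = suminf]) auto
  also have "\<dots> = cnj z * Rep_ell2 x n"
    by (rule sums_unique[OF sums_single, symmetric])
  finally show ?thesis .
qed

text \<open>For a >= 0 the difference of squares gives the bound even without the factor 2. For a <
  0 the function \<open>sqrt\<close> is the odd extension, with value - sqrt (- a); writing s = sqrt
  (- a) and t = sqrt c, the claim becomes (s + t) t <= 2 (s^2 + t^2).\<close>

lemma abs_sqrt_diff_le:
  assumes "c > 0"
  shows "\<bar>sqrt a - sqrt c\<bar> \<le> 2 / sqrt c * \<bar>a - c\<bar>"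
proof -
  define t where "t = sqrt c"
  have t: "t > 0" "t\<^sup>2 = c" using assms by (auto simp: t_def)
  have "\<bar>sqrt a - t\<bar> * t \<le> 2 * \<bar>a - c\<bar>"
  proof (cases "a \<ge> 0")
    case True
    define s where "s = sqrt a"
    have s: "s \<ge> 0" "s\<^sup>2 = a" using True by (auto simp: s_def)
    have "\<bar>s - t\<bar> * t \<le> \<bar>s - t\<bar> * (s + t)" using s by (intro mult_left_mono) auto
    also have "\<dots> = \<bar>a - c\<bar>"
      unfolding s(2)[symmetric] t(2)[symmetric] power2_eq_square
      using s t by (subst square_diff_square_factored) (simp add: abs_mult)
    also have "\<dots> \<le> 2 * \<bar>a - c\<bar>" by simp
    finally show ?thesis by (simp only: s_def)
  next
    case False
    define s where "s = sqrt (- a)"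
    have s: "s \<ge> 0" "s\<^sup>2 = - a"
      unfolding s_def by (rule real_sqrt_ge_zero, use False in simp) (rule real_sqrt_pow2, use False in simp)
    have "sqrt a = - s" by (simp only: s_def real_sqrt_minus minus_minus)
    have "0 \<le> (s - t)\<^sup>2" by simp
    then have "(s + t) * t \<le> 2 * (s\<^sup>2 + t\<^sup>2)"
      using s(1) t(1) mult_nonneg_nonneg[of s t] zero_le_power2[of s] zero_le_power2[of t]
      unfolding power2_eq_square by (simp only: algebra_simps)
    moreover have "\<bar>sqrt a - t\<bar> = s + t" "\<bar>a - c\<bar> = s\<^sup>2 + t\<^sup>2"
      using s t False assms \<open>sqrt a = - s\<close> by simp_all
    ultimately show ?thesis by simp
  qed
  then show ?thesis using t(1) by (simp add: t_def field_simps)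
qed

text \<open>The radicand differs from c by l q^(2n) - l^2 q^(4n), which is at most (|l| + l^2)
  q^(2n) in modulus. The limit sqrt c does not depend on l, so both representations share it. For
  general l the radicand may be negative, hence the two cases of
  \<open>abs_sqrt_diff_le\<close>.\<close>

lemma podles_coeff_decay:
  assumes "\<bar>q\<bar> < 1" "c > 0"
  obtains K where "\<And>n. \<bar>sqrt (podles_coeff l q c n) - sqrt c\<bar> \<le> K * (q\<^sup>2) ^ n" "K \<ge> 0"
proof
  define r where "r = q\<^sup>2"
  have r: "0 \<le> r" "r \<le> 1" using assms(1) by (auto simp: r_def abs_square_le_1)
  fix n
  have rn: "0 \<le> r ^ n" "r ^ n \<le> 1" using r by (auto simp: power_le_one)
  have "\<bar>podles_coeff l q c n - c\<bar> = \<bar>l * r ^ n - l\<^sup>2 * (r ^ n * r ^ n)\<bar>"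
    by (simp add: podles_coeff_def r_def power_mult power_mult_distrib power2_eq_square
        mult_ac)
  also have "\<dots> \<le> \<bar>l\<bar> * r ^ n + l\<^sup>2 * (r ^ n * r ^ n)"
    using abs_triangle_ineq4[of "l * r ^ n" "l\<^sup>2 * (r ^ n * r ^ n)"] rn by (simp add: abs_mult)
  also have "\<dots> \<le> \<bar>l\<bar> * r ^ n + l\<^sup>2 * (r ^ n * 1)"
    using rn by (intro add_left_mono mult_left_mono) auto
  finally have "\<bar>podles_coeff l q c n - c\<bar> \<le> (\<bar>l\<bar> + l\<^sup>2) * r ^ n" by (simp add: algebra_simps)
  then have "2 / sqrt c * \<bar>podles_coeff l q c n - c\<bar> \<le> 2 / sqrt c * ((\<bar>l\<bar> + l\<^sup>2) * r ^ n)"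
    using assms(2) by (intro mult_left_mono) auto
  then show "\<bar>sqrt (podles_coeff l q c n) - sqrt c\<bar> \<le> (2 / sqrt c * (\<bar>l\<bar> + l\<^sup>2)) * (q\<^sup>2) ^ n"
    using abs_sqrt_diff_le[OF assms(2), of "podles_coeff l q c n"]
    unfolding r_def mult.assoc by (rule order_trans[rotated])
qed (use assms in simp)

text \<open>The weights of A, \<open>star C B\<close> and B, in this order. For B the index is
  \<open>Suc n\<close> because row n of its image comes from \<open>ket (Suc n)\<close>.\<close>

lemma podles_weight_summable:
  assumes "\<bar>q\<bar> < 1" "c > 0"
  shows "square_summable (\<lambda>n. of_nat (Suc n) * (complex_of_real (l * q ^ (2 * n)) - 0))"
    and "square_summable (\<lambda>n. of_nat (Suc n) *
      (complex_of_real (sqrt (podles_coeff l q c n)) - complex_of_real (sqrt c)))"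
    and "square_summable (\<lambda>n. of_nat (Suc n) *
      (complex_of_real (sqrt (podles_coeff l q c (Suc n))) - complex_of_real (sqrt c)))"
proof -
  have r: "0 \<le> q\<^sup>2" "q\<^sup>2 < 1" using assms(1) by (auto simp: abs_square_less_1)
  obtain K where K: "\<And>n. \<bar>sqrt (podles_coeff l q c n) - sqrt c\<bar> \<le> K * (q\<^sup>2) ^ n" "K \<ge> 0"
    using podles_coeff_decay[OF assms] by blast
  show "square_summable (\<lambda>n. of_nat (Suc n) * (complex_of_real (l * q ^ (2 * n)) - 0))"
    by (rule square_summable_geometric[OF r, of _ "\<bar>l\<bar>"])
      (simp add: norm_mult norm_power power_mult)
  show "square_summable (\<lambda>n. of_nat (Suc n) *
      (complex_of_real (sqrt (podles_coeff l q c n)) - complex_of_real (sqrt c)))"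
    by (rule square_summable_geometric[OF r, of _ K]) (use K in \<open>simp flip: of_real_diff\<close>)
  show "square_summable (\<lambda>n. of_nat (Suc n) *
      (complex_of_real (sqrt (podles_coeff l q c (Suc n))) - complex_of_real (sqrt c)))"
  proof (rule square_summable_geometric[OF r, of _ K])
    fix n
    have "K * (q\<^sup>2) ^ Suc n \<le> K * (q\<^sup>2) ^ n"
      using r K(2) by (intro mult_left_mono power_decreasing) auto
    then show "cmod (complex_of_real (sqrt (podles_coeff l q c (Suc n))) - complex_of_real (sqrt c))
        \<le> K * (q\<^sup>2) ^ n"
      using order_trans[OF K(1)[of "Suc n"]] by (simp flip: of_real_diff)
  qed
qed

text \<open>The representation is prescribed on basis vectors only. Its values at other vectors come
  from the adjoint relation: entry n of \<open>\<rho> a x\<close> is the inner product of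
  \<open>\<rho> (star C a) (ket n)\<close> with x.\<close>

lemma podles_rep_wshift:
  assumes rep: "podles_rep l q c C A B \<rho>"
    and carrier: "A \<in> carrier C" "B \<in> carrier C" "star C B \<in> carrier C"
    and star: "star C A = A" "star C (star C B) = B"
  shows "\<rho> A = wshift 0 (\<lambda>n. complex_of_real (l * q ^ (2 * n)))"
    and "\<rho> (star C B) = wshift (-1) (\<lambda>n. complex_of_real (sqrt (podles_coeff l q c n)))"
    and "\<rho> B = wshift 1 (\<lambda>n. complex_of_real (sqrt (podles_coeff l q c (Suc n))))"
proof -
  have adj: "cinner (\<rho> (star C a) v) w = cinner v (\<rho> a w)" if "a \<in> carrier C" for a v w
    using rep that by (auto simp: podles_rep_def star_rep_def)
  have RA: "Rep_ell2 (\<rho> A x) n = complex_of_real (l * q ^ (2 * n)) * Rep_ell2 x n" for x n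
    using adj[OF carrier(1), of "ket n" x] rep
    by (simp add: podles_rep_def star(1) cinner_scaled_ket_left cinner_ket_left)
  have cinner_zero: "cinner 0 x = 0" for x
    by (simp add: cinner_def Rep_ell2_ops(1))
  \<comment> \<open>The prescribed values of \<open>\<rho> B\<close> on basis vectors determine its
    adjoint first. In row 0 both sides vanish, since \<open>\<rho> B (ket 0)\<close> is 0 and
    \<open>coord x (-1)\<close> is 0.\<close>
  have RB': "Rep_ell2 (\<rho> (star C B) x) n
      = complex_of_real (sqrt (podles_coeff l q c n)) * coord x (int n - 1)" for x n
    using adj[OF carrier(3), of "ket n" x] rep
    by (cases n) (simp_all add: podles_rep_def star(2) cinner_scaled_ket_left cinner_ket_left
        coord_def cinner_zero)
  \<comment> \<open>Knowing the adjoint on basis vectors, the same argument yields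
    \<open>\<rho> B\<close> on all vectors.\<close>
  have "\<rho> (star C B) (ket n) = complex_of_real (sqrt (podles_coeff l q c (Suc n))) *\<^sub>C ket (Suc n)" for n
    by (rule ell2_eqI) (auto simp: RB' Rep_ell2_ops(3) Rep_ket coord_def)
  then have RB: "Rep_ell2 (\<rho> B x) n
      = complex_of_real (sqrt (podles_coeff l q c (Suc n))) * Rep_ell2 x (Suc n)" for x n
    using adj[OF carrier(2), of "ket n" x] by (simp add: cinner_scaled_ket_left cinner_ket_left)
  note inv = Rep_ell2_inverse[symmetric]
  show "\<rho> A = wshift 0 (\<lambda>n. complex_of_real (l * q ^ (2 * n)))"
    by (rule ext, subst inv) (simp add: wshift_def RA[abs_def] coord_def)
  show "\<rho> (star C B) = wshift (-1) (\<lambda>n. complex_of_real (sqrt (podles_coeff l q c n)))"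
    by (rule ext, subst inv) (simp add: wshift_def RB'[abs_def])
  show "\<rho> B = wshift 1 (\<lambda>n. complex_of_real (sqrt (podles_coeff l q c (Suc n))))"
    by (rule ext, subst inv) (simp add: wshift_def RB[abs_def] coord_def nat_add_distrib)
qed

section \<open>Differential forms\<close>

text \<open>Serves for the differential, the parity automorphism and the symbol alike. Scalars are
  embedded as the constants \<open>Poly_Mapping.single 0 z\<close>.\<close>

definition linext :: "('w \<Rightarrow> ('m::monoid_add \<Rightarrow>\<^sub>0 complex)) \<Rightarrow> ('w \<Rightarrow>\<^sub>0 complex) \<Rightarrow> ('m \<Rightarrow>\<^sub>0 complex)" where
  "linext g p = (\<Sum>w\<in>Poly_Mapping.keys p. Poly_Mapping.single 0 (Poly_Mapping.lookup p w) * g w)"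

lemma linext_superset:
  assumes "finite F" "Poly_Mapping.keys p \<subseteq> F"
  shows "linext g p = (\<Sum>w\<in>F. Poly_Mapping.single 0 (Poly_Mapping.lookup p w) * g w)"
  unfolding linext_def using assms by (intro sum.mono_neutral_left) (auto simp: in_keys_iff)

lemma linext_single: "linext g (Poly_Mapping.single w z) = Poly_Mapping.single 0 z * g w"
  by (subst linext_superset[of "{w}"]) auto

lemma linext_zero: "linext g 0 = 0"
  by (simp add: linext_def)

lemma linext_add: "linext g (p + q) = linext g p + linext g q"
proof -
  let ?F = "Poly_Mapping.keys p \<union> Poly_Mapping.keys q"
  have "Poly_Mapping.keys (p + q) \<subseteq> ?F" by (rule keys_add)
  then show ?thesis
    by (simp add: linext_superset[of ?F] lookup_add single_add distrib_right sum.distrib)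
qed

lemma linext_uminus: "linext g (- p) = - linext g p"
  using linext_add[of g p "- p"] by (simp add: linext_zero eq_neg_iff_add_eq_0 add.commute)

lemma linext_diff: "linext g (p - q) = linext g p - linext g q"
  using linext_add[of g p "- q"] by (simp add: linext_uminus)

lemma single_0_central:
  "Poly_Mapping.single 0 z * p = (p :: 'm::monoid_add \<Rightarrow>\<^sub>0 complex) * Poly_Mapping.single 0 z"
  by (induction p rule: poly_mapping_add_induct)
    (simp_all add: mult_single distrib_left distrib_right mult.commute)

lemma scalar_interchange:
  fixes p q :: "'m::monoid_add \<Rightarrow>\<^sub>0 complex"
  shows "Poly_Mapping.single 0 (a * b) * (p * q)
    = (Poly_Mapping.single 0 a * p) * (Poly_Mapping.single 0 b * q)"
proof -
  have "Poly_Mapping.single 0 (a * b) * (p * q)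
      = Poly_Mapping.single 0 a * (Poly_Mapping.single 0 b * p) * q"
    by (simp add: mult_single flip: mult.assoc)
  also have "\<dots> = Poly_Mapping.single 0 a * (p * Poly_Mapping.single 0 b) * q"
    by (simp only: single_0_central[of b p])
  finally show ?thesis by (simp only: mult.assoc)
qed

text \<open>The universal property of the monoid algebra: coefficients can be collected in front
  because constants are central in the target.\<close>

lemma linext_mult:
  fixes p q :: "'w::monoid_add \<Rightarrow>\<^sub>0 complex"
  assumes "\<And>u w. g (u + w) = g u * g w"
  shows "linext g (p * q) = linext g p * linext g q"
proof (induction p rule: poly_mapping_add_induct)
  case (single u a)
  show ?case
  proof (induction q rule: poly_mapping_add_induct)
    case (single w b)
    show ?case by (simp add: mult_single linext_single assms scalar_interchange)
  qed (simp add: distrib_left linext_add)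
qed (simp add: distrib_right linext_add)

text \<open>Zero is a separate case here since S may be empty.\<close>

lemma poly_mapping_keys_induct [consumes 1, case_names zero single add]:
  fixes p :: "'k \<Rightarrow>\<^sub>0 'b::comm_monoid_add"
  assumes "Poly_Mapping.keys p \<subseteq> S"
    and "P 0" "\<And>k b. k \<in> S \<Longrightarrow> P (Poly_Mapping.single k b)" "\<And>p q. P p \<Longrightarrow> P q \<Longrightarrow> P (p + q)"
  shows "P p"
proof -
  have "P (\<Sum>k\<in>F. Poly_Mapping.single k (Poly_Mapping.lookup p k))" if "finite F" "F \<subseteq> S" for F
    using that by induction (auto intro: assms(2-4))
  from this[OF finite_keys[of p] assms(1)] show ?thesis
    by (simp only: poly_mapping_eq_sum_single)
qed

lemma monoid_algebra_simps:
  "carrier (monoid_algebra S) = {p. Poly_Mapping.keys p \<subseteq> S}"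
  "x \<otimes>\<^bsub>monoid_algebra S\<^esub> y = x * y" "\<one>\<^bsub>monoid_algebra S\<^esub> = 1"
  "x \<oplus>\<^bsub>monoid_algebra S\<^esub> y = x + y" "\<zero>\<^bsub>monoid_algebra S\<^esub> = 0"
  "z \<odot>\<^bsub>monoid_algebra S\<^esub> x = Poly_Mapping.single 0 z * x"
  by (simp_all add: monoid_algebra_def)

lemma keys_subset_closed:
  fixes p q :: "'m::monoid_add \<Rightarrow>\<^sub>0 complex"
  assumes "Poly_Mapping.keys p \<subseteq> S" "Poly_Mapping.keys q \<subseteq> S"
  shows "Poly_Mapping.keys (p + q) \<subseteq> S" "Poly_Mapping.keys (p - q) \<subseteq> S"
    "Poly_Mapping.keys (- p) \<subseteq> S"
    and "(\<And>u w. u \<in> S \<Longrightarrow> w \<in> S \<Longrightarrow> u + w \<in> S) \<Longrightarrow> Poly_Mapping.keys (p * q) \<subseteq> S"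
  using assms keys_add[of p q] keys_diff[of p q] keys_mult[of p q]
  by (auto simp: in_keys_iff lookup_uminus subset_iff)

lemma ring_monoid_algebra:
  assumes "0 \<in> S" "\<And>u w. u \<in> S \<Longrightarrow> w \<in> S \<Longrightarrow> u + w \<in> S"
  shows "ring (monoid_algebra S)"
proof (rule ringI)
  show "abelian_group (monoid_algebra S)"
  proof (rule abelian_groupI)
    fix x assume "x \<in> carrier (monoid_algebra S)"
    then show "\<exists>y\<in>carrier (monoid_algebra S). y \<oplus>\<^bsub>monoid_algebra S\<^esub> x = \<zero>\<^bsub>monoid_algebra S\<^esub>"
      by (intro bexI[of _ "- x"]) (simp_all add: monoid_algebra_simps keys_subset_closed(3))
  qed (simp_all add: monoid_algebra_simps keys_subset_closed(1) ac_simps)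
  show "monoid (monoid_algebra S)"
    by (rule monoidI)
      (use assms in \<open>simp_all add: monoid_algebra_simps keys_subset_closed(4) mult.assoc\<close>)
qed (simp_all add: monoid_algebra_simps distrib_left distrib_right)

section \<open>The parity automorphism and the graded Leibniz rule\<close>

primrec word_sign :: "'a letter list \<Rightarrow> complex" where
  "word_sign [] = 1"
| "word_sign (g # w) = (case g of Elt a \<Rightarrow> 1 | Dif a \<Rightarrow> -1) * word_sign w"

text \<open>Replaces the sign (-1)^(deg p) in the graded Leibniz rule, so that
  \<open>dform_mult\<close> holds for inhomogeneous forms as well.\<close>

definition grading :: "'a form \<Rightarrow> 'a form" where
  "grading = linext (\<lambda>w. Poly_Mapping.single w (word_sign (letters w)))"

lemma word_sign_append: "word_sign (u @ w) = word_sign u * word_sign w"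
  by (induction u) auto

lemma grading_mult: "grading (p * q) = grading p * grading q"
  unfolding grading_def
  by (rule linext_mult) (simp add: mult_single word_sign_append plus_fmon_def)

lemma letters_plus: "letters (u + w) = letters u @ letters w"
  by (simp add: plus_fmon_def)

lemma dform_eq_linext: "dform = linext (\<lambda>w. dword (letters w))"
  by (simp add: fun_eq_iff dform_def linext_def)

lemma single_FMon_Cons:
  "Poly_Mapping.single (FMon (Elt a # w)) (1::complex) = elt a * Poly_Mapping.single (FMon w) 1"
  "Poly_Mapping.single (FMon (Dif a # w)) (1::complex) = dif a * Poly_Mapping.single (FMon w) 1"
  by (simp_all add: elt_def dif_def mult_single plus_fmon_def)

lemma dword_append:
  "dword (u @ w) = dword u * Poly_Mapping.single (FMon w) 1
     + Poly_Mapping.single (FMon u) (word_sign u) * dword w"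
proof (induction u)
  case Nil
  show ?case by (simp flip: zero_fmon_def)
next
  case (Cons g u)
  have app: "Poly_Mapping.single (FMon (u @ w)) (1::complex)
      = Poly_Mapping.single (FMon u) 1 * Poly_Mapping.single (FMon w) 1"
    by (simp add: mult_single plus_fmon_def)
  have "Poly_Mapping.single (FMon (Elt a # u)) s = elt a * Poly_Mapping.single (FMon u) s"
    "Poly_Mapping.single (FMon (Dif a # u)) (- s) = - (dif a * Poly_Mapping.single (FMon u) s)"
    for a and s :: complex
    by (simp_all add: elt_def dif_def mult_single plus_fmon_def single_uminus)
  then show ?case
    by (cases g) (simp_all add: Cons app algebra_simps)
qed

lemma dform_add: "dform (p + q) = dform p + dform q"
  and dform_diff: "dform (p - q) = dform p - dform q"
  and dform_zero: "dform 0 = 0"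
  by (simp_all add: dform_eq_linext linext_add linext_diff linext_zero)

lemma grading_add: "grading (p + q) = grading p + grading q"
  and grading_diff: "grading (p - q) = grading p - grading q"
  by (simp_all add: grading_def linext_add linext_diff)

lemma dform_mult: "dform (p * q) = dform p * q + grading p * dform q"
proof (induction p rule: poly_mapping_add_induct)
  case (single u a)
  show ?case
  proof (induction q rule: poly_mapping_add_induct)
    case (single w b)
    let ?s = "\<lambda>s. Poly_Mapping.single u s :: 'a form"
    have "dform (?s a * Poly_Mapping.single w b)
        = Poly_Mapping.single 0 (a * b) * (dword (letters u) * Poly_Mapping.single w 1)
          + Poly_Mapping.single 0 (a * b) * (?s (word_sign (letters u)) * dword (letters w))"
      by (simp add: mult_single[of u] dform_eq_linext linext_single letters_plus dword_append
          distrib_left)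
    then show ?case
      unfolding scalar_interchange
      by (simp add: dform_eq_linext linext_single grading_def mult_single[of 0])
  qed (simp add: distrib_left dform_add)
qed (simp add: distrib_right dform_add grading_add)

lemma dform_elt: "dform (elt a) = dif a"
  and dform_dif: "dform (dif a) = 0"
  and dform_scalar: "dform (Poly_Mapping.single 0 z) = 0"
  and dform_one: "dform 1 = 0"
  and grading_elt: "grading (elt a) = elt a"
  and grading_dif: "grading (dif a) = - dif a"
  and grading_scalar: "grading (Poly_Mapping.single 0 z) = Poly_Mapping.single 0 z"
  and grading_one: "grading 1 = 1"
  by (simp_all add: elt_def dif_def dform_eq_linext grading_def linext_single mult_single
      single_uminus flip: single_one zero_fmon_def)
    (simp_all add: zero_fmon_def)

section \<open>The ideal of relations and its stability under the differential\<close>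

locale form_algebra =
  fixes A :: "(complex, 'a, 'x) module_scheme"
  assumes add_closed: "a \<in> carrier A \<Longrightarrow> b \<in> carrier A \<Longrightarrow> a \<oplus>\<^bsub>A\<^esub> b \<in> carrier A"
    and mult_closed: "a \<in> carrier A \<Longrightarrow> b \<in> carrier A \<Longrightarrow> a \<otimes>\<^bsub>A\<^esub> b \<in> carrier A"
    and smult_closed: "a \<in> carrier A \<Longrightarrow> z \<odot>\<^bsub>A\<^esub> a \<in> carrier A"
    and one_closed: "\<one>\<^bsub>A\<^esub> \<in> carrier A"
    and one_mult_one: "\<one>\<^bsub>A\<^esub> \<otimes>\<^bsub>A\<^esub> \<one>\<^bsub>A\<^esub> = \<one>\<^bsub>A\<^esub>"
begin

abbreviation "forms \<equiv> carrier (free_forms A)"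

lemma free_forms_simps:
  "x \<otimes>\<^bsub>free_forms A\<^esub> y = x * y" "\<one>\<^bsub>free_forms A\<^esub> = 1"
  "x \<oplus>\<^bsub>free_forms A\<^esub> y = x + y" "\<zero>\<^bsub>free_forms A\<^esub> = 0"
  by (simp_all add: free_forms_def monoid_algebra_simps)

lemma in_forms_iff:
  "p \<in> forms \<longleftrightarrow>
    (\<forall>w\<in>Poly_Mapping.keys p. set (letters w) \<subseteq> Elt ` carrier A \<union> Dif ` carrier A)"
  by (auto simp: free_forms_def monoid_algebra_simps)

lemma ring_free_forms: "ring (free_forms A)"
  unfolding free_forms_def
  by (rule ring_monoid_algebra) (auto simp: zero_fmon_def plus_fmon_def)

lemma forms_mult: "p \<in> forms \<Longrightarrow> q \<in> forms \<Longrightarrow> p * q \<in> forms"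
  and forms_add: "p \<in> forms \<Longrightarrow> q \<in> forms \<Longrightarrow> p + q \<in> forms"
  and forms_one: "1 \<in> forms"
  and forms_zero: "0 \<in> forms"
  using ring.ring_simprules(1,2,5,6)[OF ring_free_forms] by (auto simp: free_forms_simps)

lemma forms_diff: "p \<in> forms \<Longrightarrow> q \<in> forms \<Longrightarrow> p - q \<in> forms"
  and forms_uminus: "p \<in> forms \<Longrightarrow> - p \<in> forms"
  unfolding free_forms_def monoid_algebra_simps mem_Collect_eq by (rule keys_subset_closed; assumption)+

lemma forms_single:
  "set (letters w) \<subseteq> Elt ` carrier A \<union> Dif ` carrier A \<Longrightarrow> Poly_Mapping.single w z \<in> forms"
  by (auto simp: in_forms_iff)

lemma forms_scalar: "Poly_Mapping.single 0 z \<in> forms"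
  by (rule forms_single) (simp add: zero_fmon_def)

lemma forms_elt: "a \<in> carrier A \<Longrightarrow> elt a \<in> forms"
  and forms_dif: "a \<in> carrier A \<Longrightarrow> dif a \<in> forms"
  by (simp_all add: elt_def dif_def forms_single)

lemmas forms_closed = forms_mult forms_add forms_one forms_zero forms_diff forms_uminus forms_scalar
  forms_elt forms_dif

lemma form_relations_subset: "form_relations A \<subseteq> forms"
  unfolding form_relations_def
  by (auto intro!: forms_closed add_closed mult_closed smult_closed one_closed)

lemma ideal_form_ideal: "ideal (form_ideal A) (free_forms A)"
  unfolding form_ideal_def by (rule ring.genideal_ideal[OF ring_free_forms form_relations_subset])

lemma form_relations_in_ideal: "form_relations A \<subseteq> form_ideal A"
  unfolding form_ideal_def by (rule ring.genideal_self[OF ring_free_forms form_relations_subset])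

lemma form_ideal_subset: "p \<in> form_ideal A \<Longrightarrow> p \<in> forms"
  using ideal.axioms(1)[OF ideal_form_ideal] additive_subgroup.a_subset by blast

lemma form_ideal_lmult: "x \<in> forms \<Longrightarrow> p \<in> form_ideal A \<Longrightarrow> x * p \<in> form_ideal A"
  and form_ideal_rmult: "x \<in> forms \<Longrightarrow> p \<in> form_ideal A \<Longrightarrow> p * x \<in> form_ideal A"
  using ideal.I_l_closed[OF ideal_form_ideal] ideal.I_r_closed[OF ideal_form_ideal]
  by (auto simp: free_forms_simps)

lemma form_ideal_add: "p \<in> form_ideal A \<Longrightarrow> q \<in> form_ideal A \<Longrightarrow> p + q \<in> form_ideal A"
  using additive_subgroup.a_closed[OF ideal.axioms(1)[OF ideal_form_ideal]]
  by (auto simp: free_forms_simps)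

lemma form_ideal_zero: "0 \<in> form_ideal A"
  using additive_subgroup.zero_closed[OF ideal.axioms(1)[OF ideal_form_ideal]]
  by (auto simp: free_forms_simps)

lemma form_ideal_uminus: "p \<in> form_ideal A \<Longrightarrow> - p \<in> form_ideal A"
  using form_ideal_lmult[of "- 1" p] by (simp add: forms_uminus forms_one)

lemma form_ideal_diff: "p \<in> form_ideal A \<Longrightarrow> q \<in> form_ideal A \<Longrightarrow> p - q \<in> form_ideal A"
  using form_ideal_add[OF _ form_ideal_uminus, of p q] by simp

lemma form_ideal_trans:
  "p - q \<in> form_ideal A \<Longrightarrow> q - r \<in> form_ideal A \<Longrightarrow> p - r \<in> form_ideal A"
  using form_ideal_add[of "p - q" "q - r"] by simp

lemma elt_mult_rel: "a \<in> carrier A \<Longrightarrow> b \<in> carrier A \<Longrightarrow> elt (a \<otimes>\<^bsub>A\<^esub> b) - elt a * elt b \<in> form_ideal A"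
  and elt_one_rel: "elt \<one>\<^bsub>A\<^esub> - 1 \<in> form_ideal A"
  and dif_add_rel: "a \<in> carrier A \<Longrightarrow> b \<in> carrier A \<Longrightarrow>
    dif (a \<oplus>\<^bsub>A\<^esub> b) - dif a - dif b \<in> form_ideal A"
  and dif_smult_rel: "a \<in> carrier A \<Longrightarrow>
    dif (z \<odot>\<^bsub>A\<^esub> a) - Poly_Mapping.single 0 z * dif a \<in> form_ideal A"
  by (rule form_relations_in_ideal[THEN subsetD], unfold form_relations_def, blast)+

lemma dif_mult_rel:
  assumes "a \<in> carrier A" "b \<in> carrier A"
  shows "dif (a \<otimes>\<^bsub>A\<^esub> b) - (dif a * elt b + elt a * dif b) \<in> form_ideal A"
proof -
  have "dif (a \<otimes>\<^bsub>A\<^esub> b) - elt a * dif b - dif a * elt b \<in> form_relations A"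
    using assms unfolding form_relations_def by blast
  then have "dif (a \<otimes>\<^bsub>A\<^esub> b) - elt a * dif b - dif a * elt b \<in> form_ideal A"
    using form_relations_in_ideal by blast
  then show ?thesis by (simp add: algebra_simps)
qed

text \<open>Applying the Leibniz rule to the square of the unit gives \<delta>1 = \<delta>1 +
  \<delta>1 modulo the ideal.\<close>

lemma dif_one_rel: "dif \<one>\<^bsub>A\<^esub> \<in> form_ideal A"
proof -
  let ?e = "elt \<one>\<^bsub>A\<^esub>" and ?d = "dif \<one>\<^bsub>A\<^esub>"
  have "?d - (?d * ?e + ?e * ?d) \<in> form_ideal A"
    using dif_mult_rel[OF one_closed one_closed] by (simp add: one_mult_one)
  moreover have "(?e - 1) * ?d \<in> form_ideal A" "?d * (?e - 1) \<in> form_ideal A"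
    by (intro form_ideal_lmult form_ideal_rmult elt_one_rel forms_dif one_closed)+
  ultimately have "(?d - (?d * ?e + ?e * ?d)) + ((?e - 1) * ?d + ?d * (?e - 1)) \<in> form_ideal A"
    by (intro form_ideal_add)
  then have "- ?d \<in> form_ideal A" by (simp add: algebra_simps)
  then show ?thesis using form_ideal_uminus by fastforce
qed

text \<open>The members of the ideal with property P form an ideal containing the relations, and
  \<open>form_ideal\<close> is the least such ideal. Closure under negation is multiplication by
  -1.\<close>

lemma form_ideal_induct [consumes 1, case_names rel add lmult rmult]:
  assumes p: "p \<in> form_ideal A"
    and rel: "\<And>r. r \<in> form_relations A \<Longrightarrow> P r"
    and add: "\<And>p q. p \<in> form_ideal A \<Longrightarrow> P p \<Longrightarrow> q \<in> form_ideal A \<Longrightarrow> P q \<Longrightarrow> P (p + q)"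
    and lmult: "\<And>x p. x \<in> forms \<Longrightarrow> p \<in> form_ideal A \<Longrightarrow> P p \<Longrightarrow> P (x * p)"
    and rmult: "\<And>x p. x \<in> forms \<Longrightarrow> p \<in> form_ideal A \<Longrightarrow> P p \<Longrightarrow> P (p * x)"
  shows "P p"
proof -
  let ?K = "{p \<in> form_ideal A. P p}"
  interpret R: ring "free_forms A" by (rule ring_free_forms)
  have one: "elt \<one>\<^bsub>A\<^esub> - 1 \<in> form_relations A"
    by (simp add: form_relations_def)
  have "ideal ?K (free_forms A)"
  proof (rule idealI[OF ring_free_forms])
    show "subgroup ?K (add_monoid (free_forms A))"
    proof (rule group.subgroupI[OF R.a_group])
      show "?K \<noteq> {}" using one rel form_relations_in_ideal by blast
      fix p assume p: "p \<in> ?K"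
      have "\<ominus>\<^bsub>free_forms A\<^esub> p = - p"
        using p by (intro R.minus_equality) (auto simp: free_forms_simps form_ideal_subset forms_uminus)
      moreover have "- p \<in> ?K"
        using p lmult[of "- 1" p] form_ideal_uminus[of p] by (simp add: forms_uminus forms_one)
      ultimately show "inv\<^bsub>add_monoid (free_forms A)\<^esub> p \<in> ?K" by (simp add: a_inv_def)
    qed (use form_ideal_subset form_ideal_add add in \<open>auto simp: free_forms_simps\<close>)
  qed (use form_ideal_lmult form_ideal_rmult lmult rmult in \<open>auto simp: free_forms_simps\<close>)
  moreover have "form_relations A \<subseteq> ?K" using rel form_relations_in_ideal by blast
  ultimately have "form_ideal A \<subseteq> ?K"
    unfolding form_ideal_def by (rule R.genideal_minimal)
  then show ?thesis using p by blast
qed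

lemma dword_in_forms:
  "set w \<subseteq> Elt ` carrier A \<union> Dif ` carrier A \<Longrightarrow> dword w \<in> forms"
proof (induction w)
  case Nil
  show ?case by (simp add: forms_zero)
next
  case (Cons g w)
  then have "dword w \<in> forms" "Poly_Mapping.single (FMon w) 1 \<in> forms"
    by (auto intro!: forms_single)
  then show ?case
    using Cons.prems by (cases g) (auto simp: forms_closed)
qed

lemma linext_in_forms:
  assumes "p \<in> forms" "\<And>w. set (letters w) \<subseteq> Elt ` carrier A \<union> Dif ` carrier A \<Longrightarrow> g w \<in> forms"
  shows "linext g p \<in> forms"
proof -
  have "Poly_Mapping.keys p \<subseteq> {w. set (letters w) \<subseteq> Elt ` carrier A \<union> Dif ` carrier A}"
    using assms(1) by (auto simp: in_forms_iff)
  then show ?thesis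
    by (induction p rule: poly_mapping_keys_induct)
      (auto simp: linext_zero linext_add linext_single intro!: forms_closed assms(2))
qed

lemma dform_in_forms: "p \<in> forms \<Longrightarrow> dform p \<in> forms"
  unfolding dform_eq_linext by (rule linext_in_forms) (auto intro: dword_in_forms)

lemma grading_in_forms: "p \<in> forms \<Longrightarrow> grading p \<in> forms"
  unfolding grading_def by (rule linext_in_forms) (auto intro: forms_single)

text \<open>The two claims are proved together: the differential of p x is dp x + \<gamma>(p) dx,
  where \<gamma> is the grading, so \<gamma>(p) has to lie in the ideal too.\<close>

lemma dform_grading_ideal:
  assumes "p \<in> form_ideal A"
  shows "dform p \<in> form_ideal A \<and> grading p \<in> form_ideal A"
  using assms
proof (induction p rule: form_ideal_induct)
  case (rel r)
  have r: "r \<in> form_ideal A" using rel form_relations_in_ideal by blast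
  have "dform r \<in> form_ideal A"
    using rel unfolding form_relations_def
    by (auto simp: dform_diff dform_elt dform_dif dform_one dform_scalar dform_mult grading_elt grading_dif
        grading_scalar form_ideal_zero intro: dif_add_rel dif_smult_rel dif_one_rel dif_mult_rel)
  \<comment> \<open>Every relation is homogeneous for the parity.\<close>
  moreover have "grading r = r \<or> grading r = - r"
    using rel unfolding form_relations_def
    by (auto simp: grading_diff grading_elt grading_dif grading_one grading_scalar grading_mult)
  ultimately show ?case using r form_ideal_uminus by auto
next
  case (lmult x p)
  then show ?case
    by (simp add: dform_mult grading_mult form_ideal_add form_ideal_lmult dform_in_forms
        grading_in_forms)
next
  case (rmult x p)
  then show ?case
    by (simp add: dform_mult grading_mult form_ideal_add form_ideal_rmult dform_in_forms
        grading_in_forms)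
qed (simp add: dform_add grading_add form_ideal_add)

end

section \<open>Standard forms and the operations on their classes\<close>

definition word_set :: "(complex, 'a, 'x) module_scheme \<Rightarrow> nat \<Rightarrow> 'a letter fmon set" where
  "word_set A n = {FMon (Elt a # map Dif as) | a as.
     a \<in> carrier A \<and> set as \<subseteq> carrier A \<and> length as = n}"

lemma standard_forms_iff: "p \<in> standard_forms A n \<longleftrightarrow> Poly_Mapping.keys p \<subseteq> word_set A n"
  by (simp add: standard_forms_def word_set_def)

lemma standard_forms_closed:
  assumes "p \<in> standard_forms A n" "q \<in> standard_forms A n"
  shows "p + q \<in> standard_forms A n" "p - q \<in> standard_forms A n"
  using assms unfolding standard_forms_iff by (simp_all add: keys_subset_closed(1,2))

lemma standard_forms_zero: "0 \<in> standard_forms A n"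
  by (simp add: standard_forms_iff)

lemma standard_forms_single: "w \<in> word_set A n \<Longrightarrow> Poly_Mapping.single w z \<in> standard_forms A n"
  by (simp add: standard_forms_iff)

lemma standard_forms_induct [consumes 1, case_names zero single add]:
  assumes "p \<in> standard_forms A n" "P 0"
    and "\<And>a as z. a \<in> carrier A \<Longrightarrow> set as \<subseteq> carrier A \<Longrightarrow> length as = n \<Longrightarrow>
      P (Poly_Mapping.single (FMon (Elt a # map Dif as)) z)"
    and "\<And>p q. P p \<Longrightarrow> P q \<Longrightarrow> P (p + q)"
  shows "P p"
  using assms(1) unfolding standard_forms_iff
  by (induction p rule: poly_mapping_keys_induct) (auto simp: word_set_def intro: assms(2-4))

lemma dword_map_Dif: "dword (map Dif as) = 0"
  by (induction as) auto

lemma single_eq_scalar_mult: "Poly_Mapping.single w z = Poly_Mapping.single 0 z * Poly_Mapping.single w (1::complex)"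
  by (simp add: mult_single)

context form_algebra
begin

lemma standard_forms_subset: "p \<in> standard_forms A n \<Longrightarrow> p \<in> forms"
  by (induction p rule: standard_forms_induct) (auto simp: subset_iff intro!: forms_zero forms_add forms_single)

lemma forms_map_Dif: "set as \<subseteq> carrier A \<Longrightarrow> Poly_Mapping.single (FMon (map Dif as)) z \<in> forms"
  by (rule forms_single) auto

lemma form_class_eq_coset: "form_class A p = {i + p | i. i \<in> form_ideal A}"
  unfolding form_class_def a_r_coset_def' free_forms_simps by auto

lemma mem_form_class_iff: "q \<in> form_class A p \<longleftrightarrow> q - p \<in> form_ideal A"
proof
  assume "q - p \<in> form_ideal A"
  then have "(q - p) + p \<in> form_class A p" unfolding form_class_eq_coset by blast
  then show "q \<in> form_class A p" by simp
qed (auto simp: form_class_eq_coset)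

lemma form_class_eq_iff: "form_class A p = form_class A q \<longleftrightarrow> p - q \<in> form_ideal A"
proof
  assume "form_class A p = form_class A q"
  moreover have "p \<in> form_class A p" by (simp add: mem_form_class_iff form_ideal_zero)
  ultimately show "p - q \<in> form_ideal A" by (simp add: mem_form_class_iff)
next
  assume pq: "p - q \<in> form_ideal A"
  then have qp: "q - p \<in> form_ideal A" using form_ideal_uminus[of "p - q"] by simp
  show "form_class A p = form_class A q"
    using form_ideal_trans[OF _ pq] form_ideal_trans[OF _ qp] by (auto simp: mem_form_class_iff)
qed

lemma form_class_add:
  "p \<in> forms \<Longrightarrow> q \<in> forms \<Longrightarrow>
    form_class A p \<oplus>\<^bsub>Omega A\<^esub> form_class A q = form_class A (p + q)"
  using ideal.a_rcos_sum[OF ideal_form_ideal, of p q]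
  by (simp add: Omega_def FactRing_def form_class_def free_forms_simps)

lemma form_class_mult:
  "p \<in> forms \<Longrightarrow> q \<in> forms \<Longrightarrow>
    form_class A p \<otimes>\<^bsub>Omega A\<^esub> form_class A q = form_class A (p * q)"
  using ideal.rcoset_mult_add[OF ideal_form_ideal, of p q]
  by (simp add: Omega_def FactRing_def form_class_def free_forms_simps)

text \<open>All representatives of a class have congruent differentials, so the union in
  \<open>delta\<close> is a union of copies of one class.\<close>

lemma delta_form_class:
  assumes "p \<in> forms"
  shows "delta A (form_class A p) = form_class A (dform p)"
proof -
  have "form_class A (dform q) = form_class A (dform p)" if "q \<in> form_class A p" for q
    using that dform_grading_ideal[of "q - p"]
    by (simp add: mem_form_class_iff form_class_eq_iff dform_diff)
  moreover have "p \<in> form_class A p" by (simp add: mem_form_class_iff form_ideal_zero)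
  ultimately show ?thesis unfolding delta_def by blast
qed

lemma Omega_degE:
  assumes "X \<in> Omega_deg A n"
  obtains p where "p \<in> standard_forms A n" "p \<in> forms" "X = form_class A p"
  using assms standard_forms_subset unfolding Omega_deg_def by blast

lemma Omega_degI: "p \<in> standard_forms A n \<Longrightarrow> form_class A p \<in> Omega_deg A n"
  by (simp add: Omega_deg_def)

lemma Omega_degI':
  "\<exists>q\<in>standard_forms A n. p - q \<in> form_ideal A \<Longrightarrow> form_class A p \<in> Omega_deg A n"
  by (auto simp: Omega_deg_def image_iff form_class_eq_iff)

text \<open>As \<open>Omega_deg\<close> consists of classes of standard forms, its closure under an
  operation means rewriting results to standard forms modulo the ideal. This is the step for one
  word; \<open>reduce_add\<close> extends it to sums.\<close>

lemma reduce_scaled_word: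
  assumes "set as \<subseteq> carrier A" "length as = n" "a \<in> carrier A"
    and "x - elt a * Poly_Mapping.single (FMon (map Dif as)) 1 \<in> form_ideal A"
  shows "\<exists>q\<in>standard_forms A n. Poly_Mapping.single 0 z * x - q \<in> form_ideal A"
proof
  let ?w = "FMon (Elt a # map Dif as)"
  show "Poly_Mapping.single ?w z \<in> standard_forms A n"
    using assms(1-3) by (intro standard_forms_single) (auto simp: word_set_def)
  have "Poly_Mapping.single 0 z * x - Poly_Mapping.single ?w z
      = Poly_Mapping.single 0 z * (x - elt a * Poly_Mapping.single (FMon (map Dif as)) 1)"
    unfolding single_eq_scalar_mult[of ?w z] single_FMon_Cons by (simp add: algebra_simps)
  then show "Poly_Mapping.single 0 z * x - Poly_Mapping.single ?w z \<in> form_ideal A"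
    using form_ideal_lmult[OF forms_scalar assms(4)] by simp
qed

lemma reduce_add:
  assumes "\<exists>q\<in>standard_forms A n. x - q \<in> form_ideal A" "\<exists>q\<in>standard_forms A n. y - q \<in> form_ideal A"
  shows "\<exists>q\<in>standard_forms A n. x + y - q \<in> form_ideal A"
proof -
  obtain p q where "p \<in> standard_forms A n" "x - p \<in> form_ideal A"
    "q \<in> standard_forms A n" "y - q \<in> form_ideal A" using assms by blast
  then show ?thesis
    using form_ideal_add[of "x - p" "y - q"] by (intro bexI[of _ "p + q"])
      (auto simp: standard_forms_closed add_diff_add)
qed

lemma reduce_zero: "\<exists>q\<in>standard_forms A n. 0 - q \<in> form_ideal A"
  by (rule bexI[of _ 0]) (auto simp: standard_forms_zero form_ideal_zero)

text \<open>The differential of a_0 \<delta>a_1 ... \<delta>a_n is \<delta>a_0 \<delta>a_1 ...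
  \<delta>a_n, which lacks a coefficient in front; the unit of the algebra is inserted
  there.\<close>

lemma reduce_dform:
  "p \<in> standard_forms A n \<Longrightarrow> \<exists>q\<in>standard_forms A (Suc n). dform p - q \<in> form_ideal A"
proof (induction p rule: standard_forms_induct)
  case (single a as z)
  let ?m = "Poly_Mapping.single (FMon (map Dif (a # as))) 1"
  have "?m - elt \<one>\<^bsub>A\<^esub> * ?m = - ((elt \<one>\<^bsub>A\<^esub> - 1) * ?m)" by (simp add: algebra_simps)
  moreover have "?m \<in> forms" using single by (intro forms_map_Dif) auto
  ultimately have "?m - elt \<one>\<^bsub>A\<^esub> * ?m \<in> form_ideal A"
    using form_ideal_uminus[OF form_ideal_rmult[OF _ elt_one_rel]] by simp
  then have "\<exists>q\<in>standard_forms A (Suc n). Poly_Mapping.single 0 z * ?m - q \<in> form_ideal A"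
    using single by (intro reduce_scaled_word[of "a # as"]) (auto simp: one_closed)
  then show ?case
    by (simp add: dform_eq_linext linext_single dword_map_Dif single_FMon_Cons)
qed (auto simp: dform_zero dform_add intro: reduce_zero[simplified] reduce_add)

lemma reduce_lmult:
  assumes b: "b \<in> carrier A"
  shows "p \<in> standard_forms A n \<Longrightarrow> \<exists>q\<in>standard_forms A n. elt b * p - q \<in> form_ideal A"
proof (induction p rule: standard_forms_induct)
  case (single a as z)
  let ?m = "Poly_Mapping.single (FMon (map Dif as)) 1"
  have "elt b * (elt a * ?m) - elt (b \<otimes>\<^bsub>A\<^esub> a) * ?m = - ((elt (b \<otimes>\<^bsub>A\<^esub> a) - elt b * elt a) * ?m)"
    by (simp add: algebra_simps)
  moreover have "(elt (b \<otimes>\<^bsub>A\<^esub> a) - elt b * elt a) * ?m \<in> form_ideal A"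
    using single b by (intro form_ideal_rmult forms_map_Dif elt_mult_rel)
  ultimately have "elt b * (elt a * ?m) - elt (b \<otimes>\<^bsub>A\<^esub> a) * ?m \<in> form_ideal A"
    using form_ideal_uminus by simp
  then have "\<exists>q\<in>standard_forms A n. Poly_Mapping.single 0 z * (elt b * (elt a * ?m)) - q \<in> form_ideal A"
    using single b by (intro reduce_scaled_word[of as]) (auto simp: mult_closed)
  moreover have "elt b * Poly_Mapping.single (FMon (Elt a # map Dif as)) z
      = Poly_Mapping.single 0 z * (elt b * (elt a * ?m))"
    unfolding single_eq_scalar_mult[of "FMon (Elt a # map Dif as)" z] single_FMon_Cons
    by (simp only: mult.assoc[symmetric] single_0_central[of z "elt b"])
  ultimately show ?case by simp
qed (auto simp: distrib_left intro: reduce_zero[simplified] reduce_add)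

text \<open>By the Leibniz rule, (a \<delta>d) b = a \<delta>(d b) - a d \<delta>b.\<close>

lemma reduce_rmult:
  assumes b: "b \<in> carrier A"
  shows "p \<in> standard_forms A 1 \<Longrightarrow> \<exists>q\<in>standard_forms A 1. p * elt b - q \<in> form_ideal A"
proof (induction p rule: standard_forms_induct)
  case (single a as z)
  then obtain d where as: "as = [d]" and d: "d \<in> carrier A" by (auto simp: length_Suc_conv)
  have word: "Poly_Mapping.single (FMon (map Dif [x])) 1 = dif x" for x :: 'a
    by (simp add: dif_def)
  have "\<exists>q\<in>standard_forms A 1. Poly_Mapping.single 0 z * (elt a * dif (d \<otimes>\<^bsub>A\<^esub> b)) - q \<in> form_ideal A"
    using single(1) d b
    by (intro reduce_scaled_word[of "[d \<otimes>\<^bsub>A\<^esub> b]" _ a]) (auto simp: mult_closed dif_def form_ideal_zero)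
  moreover have "\<exists>q\<in>standard_forms A 1. Poly_Mapping.single 0 (- z) * (elt a * elt d * dif b) - q \<in> form_ideal A"
  proof (rule reduce_scaled_word[of "[b]" _ "a \<otimes>\<^bsub>A\<^esub> d"])
    have "(elt (a \<otimes>\<^bsub>A\<^esub> d) - elt a * elt d) * dif b \<in> form_ideal A"
      using single(1) d b by (intro form_ideal_rmult elt_mult_rel forms_dif)
    from form_ideal_uminus[OF this]
    show "elt a * elt d * dif b - elt (a \<otimes>\<^bsub>A\<^esub> d) * Poly_Mapping.single (FMon (map Dif [b])) 1 \<in> form_ideal A"
      unfolding word by (simp add: algebra_simps)
  qed (use single(1) d b in \<open>auto simp: mult_closed\<close>)
  ultimately obtain q where q: "q \<in> standard_forms A 1"
    "Poly_Mapping.single 0 z * (elt a * dif (d \<otimes>\<^bsub>A\<^esub> b))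
      + Poly_Mapping.single 0 (- z) * (elt a * elt d * dif b) - q \<in> form_ideal A"
    using reduce_add by blast
  have "Poly_Mapping.single 0 z * elt a * (dif (d \<otimes>\<^bsub>A\<^esub> b) - (dif d * elt b + elt d * dif b)) \<in> form_ideal A"
    using single(1) d b by (intro form_ideal_lmult dif_mult_rel forms_mult forms_scalar forms_elt)
  from form_ideal_diff[OF q(2) this]
  have "Poly_Mapping.single 0 z * (elt a * dif d) * elt b - q \<in> form_ideal A"
    by (simp add: algebra_simps single_uminus)
  then have "Poly_Mapping.single (FMon (Elt a # map Dif as)) z * elt b - q \<in> form_ideal A"
    unfolding as single_eq_scalar_mult[of "FMon (Elt a # map Dif [d])" z] single_FMon_Cons word .
  then show ?case using q(1) by blast
qed (auto simp: distrib_right intro: reduce_zero[simplified] reduce_add)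

lemma Omega_deg_add:
  assumes "X \<in> Omega_deg A n" "Y \<in> Omega_deg A n"
  shows "X \<oplus>\<^bsub>Omega A\<^esub> Y \<in> Omega_deg A n"
  using assms by (auto elim!: Omega_degE simp: form_class_add standard_forms_closed intro!: Omega_degI)

lemma Omega_deg_lmult:
  assumes "b \<in> carrier A" "X \<in> Omega_deg A n"
  shows "form_class A (elt b) \<otimes>\<^bsub>Omega A\<^esub> X \<in> Omega_deg A n"
  using assms(2)
proof (rule Omega_degE)
  fix p assume "p \<in> standard_forms A n" "p \<in> forms" "X = form_class A p"
  then show ?thesis
    using Omega_degI'[OF reduce_lmult[OF assms(1)]] by (simp add: form_class_mult forms_elt assms(1))
qed

lemma Omega_deg_rmult:
  assumes "b \<in> carrier A" "X \<in> Omega_deg A 1"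
  shows "X \<otimes>\<^bsub>Omega A\<^esub> form_class A (elt b) \<in> Omega_deg A 1"
  using assms(2)
proof (rule Omega_degE)
  fix p assume "p \<in> standard_forms A 1" "p \<in> forms" "X = form_class A p"
  then show ?thesis
    using Omega_degI'[OF reduce_rmult[OF assms(1)]] by (simp add: form_class_mult forms_elt assms(1))
qed

lemma delta_Omega_deg:
  assumes "X \<in> Omega_deg A n"
  shows "delta A X \<in> Omega_deg A (Suc n)"
  using assms
proof (rule Omega_degE)
  fix p assume "p \<in> standard_forms A n" "p \<in> forms" "X = form_class A p"
  then show ?thesis
    using Omega_degI'[OF reduce_dform] by (simp add: delta_form_class)
qed

end

section \<open>The symbol calculus on forms\<close>

primrec symbol_word :: "('a \<Rightarrow> laurent) \<Rightarrow> 'a letter list \<Rightarrow> laurent" where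
  "symbol_word \<sigma> [] = 1"
| "symbol_word \<sigma> (g # w) = (case g of Elt a \<Rightarrow> \<sigma> a | Dif a \<Rightarrow> dlog (\<sigma> a)) * symbol_word \<sigma> w"

definition symbol :: "('a \<Rightarrow> laurent) \<Rightarrow> 'a form \<Rightarrow> laurent" where
  "symbol \<sigma> = linext (\<lambda>w. symbol_word \<sigma> (letters w))"

lemma symbol_word_append: "symbol_word \<sigma> (u @ w) = symbol_word \<sigma> u * symbol_word \<sigma> w"
  by (induction u) (simp_all add: mult.assoc)

lemma symbol_mult: "symbol \<sigma> (p * q) = symbol \<sigma> p * symbol \<sigma> q"
  unfolding symbol_def by (rule linext_mult) (simp add: letters_plus symbol_word_append)

lemma symbol_add: "symbol \<sigma> (p + q) = symbol \<sigma> p + symbol \<sigma> q"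
  and symbol_diff: "symbol \<sigma> (p - q) = symbol \<sigma> p - symbol \<sigma> q"
  and symbol_zero: "symbol \<sigma> 0 = 0"
  by (simp_all add: symbol_def linext_add linext_diff linext_zero)

lemma symbol_elt: "symbol \<sigma> (elt a) = \<sigma> a"
  and symbol_dif: "symbol \<sigma> (dif a) = dlog (\<sigma> a)"
  by (simp_all add: symbol_def elt_def dif_def linext_single)

lemma symbol_scalar: "symbol \<sigma> (Poly_Mapping.single 0 z) = Poly_Mapping.single 0 z"
  by (simp add: symbol_def linext_single zero_fmon_def)

lemma symbol_one: "symbol \<sigma> 1 = 1"
  using symbol_scalar[of \<sigma> 1] by simp

text \<open>All that the computation of the quotients uses about the Podles sphere. Surjectivity of
  \<sigma> supplies elements with symbols z, z^(-1) and arbitrary coefficients.\<close>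

locale symbol_calculus = form_algebra +
  fixes \<pi> :: "'a \<Rightarrow> hilb \<Rightarrow> hilb" and \<sigma> :: "'a \<Rightarrow> laurent"
  assumes regular: "a \<in> carrier A \<Longrightarrow> regular (\<pi> a) (\<sigma> a)"
    and \<sigma>_add: "a \<in> carrier A \<Longrightarrow> b \<in> carrier A \<Longrightarrow> \<sigma> (a \<oplus>\<^bsub>A\<^esub> b) = \<sigma> a + \<sigma> b"
    and \<sigma>_mult: "a \<in> carrier A \<Longrightarrow> b \<in> carrier A \<Longrightarrow> \<sigma> (a \<otimes>\<^bsub>A\<^esub> b) = \<sigma> a * \<sigma> b"
    and \<sigma>_smult: "a \<in> carrier A \<Longrightarrow> \<sigma> (z \<odot>\<^bsub>A\<^esub> a) = Poly_Mapping.single 0 z * \<sigma> a"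
    and \<sigma>_one: "\<sigma> \<one>\<^bsub>A\<^esub> = 1"
    and \<sigma>_surj: "\<exists>a\<in>carrier A. \<sigma> a = f"
begin

text \<open>Keeps the degree 1 from being rewritten to \<open>Suc 0\<close>, so that facts stated
  for degree 1 keep matching.\<close>

declare One_nat_def [simp del]

text \<open>The relations hold among the symbols because \<sigma> is a homomorphism and
  \<open>dlog\<close> is a derivation.\<close>

lemma symbol_form_ideal: "p \<in> form_ideal A \<Longrightarrow> symbol \<sigma> p = 0"
proof (induction p rule: form_ideal_induct)
  case (rel r)
  then show ?case
    unfolding form_relations_def
    by (auto simp: symbol_diff symbol_elt symbol_dif symbol_mult symbol_scalar symbol_one \<sigma>_add \<sigma>_mult
        \<sigma>_smult \<sigma>_one dlog_add dlog_mult dlog_single)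
qed (auto simp: symbol_add symbol_mult)

definition class_symbol :: "'a form set \<Rightarrow> laurent" where
  "class_symbol X = the_elem (symbol \<sigma> ` X)"

lemma class_symbol_form_class: "class_symbol (form_class A p) = symbol \<sigma> p"
proof -
  have "symbol \<sigma> q = symbol \<sigma> p" if "q \<in> form_class A p" for q
    using that symbol_form_ideal[of "q - p"] by (simp add: mem_form_class_iff symbol_diff)
  moreover have "p \<in> form_class A p" by (simp add: mem_form_class_iff form_ideal_zero)
  ultimately have "symbol \<sigma> ` form_class A p = {symbol \<sigma> p}" by blast
  then show ?thesis by (simp add: class_symbol_def)
qed

text \<open>Each commutator is one off-diagonal factor, so the parity is that of the number of
  differentials.\<close>

lemma has_symbol_eval_Difs:
  "set as \<subseteq> carrier A \<Longrightarrow>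
    has_symbol (length as) (eval_word \<pi> (map Dif as)) (symbol_word \<sigma> (map Dif as))"
proof (induction as)
  case Nil
  show ?case using has_symbol_id by (simp add: id_def)
next
  case (Cons a as)
  then show ?case
    using has_symbol_mult[OF regular_commutator[OF regular[of a]]] by (simp add: comp_def One_nat_def)
qed

lemma has_symbol_eval_word:
  assumes "a \<in> carrier A" "set as \<subseteq> carrier A"
  shows "has_symbol (length as) (eval_word \<pi> (Elt a # map Dif as)) (symbol_word \<sigma> (Elt a # map Dif as))"
  using has_symbol_mult[OF _ has_symbol_eval_Difs[OF assms(2)], of 0 "\<pi> a" "\<sigma> a"]
    regularE[OF regular[OF assms(1)]] by (auto simp: comp_def)

lemma has_symbol_eval_form:
  assumes "p \<in> standard_forms A n"
  shows "has_symbol n (eval_form \<pi> p) (symbol \<sigma> p)"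
  unfolding eval_form_def[abs_def] symbol_def linext_def
proof (rule has_symbol_sum)
  fix w assume "w \<in> Poly_Mapping.keys p"
  then obtain a as where "w = FMon (Elt a # map Dif as)" "a \<in> carrier A" "set as \<subseteq> carrier A" "length as = n"
    using assms by (auto simp: standard_forms_iff word_set_def)
  then show "has_symbol n (\<lambda>v. Poly_Mapping.lookup p w *\<^sub>C eval_word \<pi> (letters w) v)
      (Poly_Mapping.single 0 (Poly_Mapping.lookup p w) * symbol_word \<sigma> (letters w))"
    using has_symbol_scaleC[OF has_symbol_eval_word] by auto
qed

text \<open>All standard representatives of X have the same symbol, hence the same coset modulo
  compact operators. So \<open>the_elem\<close> in \<open>psi\<close> is applied to a
  singleton.\<close>

lemma psi_eq_model:
  assumes "X \<in> Omega_deg A n"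
  shows "psi \<pi> A n X = calkin (model n (class_symbol X))"
proof -
  obtain p where p: "p \<in> standard_forms A n" "X = form_class A p"
    using assms by (rule Omega_degE)
  have "calkin (eval_form \<pi> q) = calkin (model n (class_symbol X))"
    if "q \<in> standard_forms A n" "form_class A q = X" for q
    using has_symbol_calkin[OF has_symbol_eval_form[OF that(1)]] class_symbol_form_class[of q] that(2)
    by simp
  then have "(\<lambda>q. calkin (eval_form \<pi> q)) ` {q \<in> standard_forms A n. form_class A q = X}
      = {calkin (model n (class_symbol X))}"
    using p by blast
  then show ?thesis by (simp add: psi_def)
qed

lemma J_eq: "J \<pi> A n = {X \<in> Omega_deg A n. class_symbol X = 0}"
  by (simp add: J_def psi_eq_model calkin_model_eq_zero_iff cong: conj_cong)

lemma class_symbol_add: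
  "X \<in> Omega_deg A n \<Longrightarrow> Y \<in> Omega_deg A m \<Longrightarrow>
    class_symbol (X \<oplus>\<^bsub>Omega A\<^esub> Y) = class_symbol X + class_symbol Y"
  by (auto elim!: Omega_degE simp: form_class_add class_symbol_form_class symbol_add)

text \<open>A difference is given as a solution Z of Z + Y = X, the shape in which cosets and
  \<open>junk\<close> ask for it.\<close>

lemma Omega_deg_diff:
  assumes "X \<in> Omega_deg A n" "Y \<in> Omega_deg A n"
  obtains Z where "Z \<in> Omega_deg A n" "Z \<oplus>\<^bsub>Omega A\<^esub> Y = X" "class_symbol Z = class_symbol X - class_symbol Y"
proof -
  obtain p q where p: "p \<in> standard_forms A n" "p \<in> forms" "X = form_class A p"
    and q: "q \<in> standard_forms A n" "q \<in> forms" "Y = form_class A q"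
    using assms by (meson Omega_degE)
  show thesis
    by (rule that[of "form_class A (p - q)"])
      (simp_all add: p q Omega_degI standard_forms_closed form_class_add forms_diff
        class_symbol_form_class symbol_diff)
qed

text \<open>If \<open>\<sigma> b = z\<close>, \<open>\<sigma> b' = z\<^sup>-\<^sup>1\<close> and \<open>\<sigma> u' = z\<^sup>2 \<sigma> u\<close>, then \<open>u \<delta>b + u' \<delta>b'\<close> has symbol \<open>0\<close>, whereas
  its differential has symbol \<open>-2 z \<sigma> u\<close>; a further factor \<open>(\<delta>b)\<^sup>m\<close> only multiplies this by a unit.\<close>
lemma exists_junk_form:
  "\<exists>p\<in>standard_forms A (Suc m). symbol \<sigma> p = 0 \<and> symbol \<sigma> (dform p) = f"
proof -
  let ?z = "\<lambda>k a. Poly_Mapping.single k a :: laurent"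
  obtain b b' where b: "b \<in> carrier A" "\<sigma> b = ?z 1 1" and b': "b' \<in> carrier A" "\<sigma> b' = ?z (-1) 1"
    using \<sigma>_surj by meson
  define D where "D = symbol_word \<sigma> (map Dif (replicate m b))"
  have D: "D = ?z (int m) ((-1) ^ m)"
    unfolding D_def
    by (induction m) (simp_all add: b dlog_single mult_single)
  \<comment> \<open>Solves s (-2 z) D = f for s, where D = (- z)^m is the symbol of the m factors
    \<delta>b.\<close>
  define s where "s = f * ?z (- 1 - int m) (- ((-1) ^ m / 2))"
  obtain u u' where u: "u \<in> carrier A" "\<sigma> u = s" and u': "u' \<in> carrier A" "\<sigma> u' = s * ?z 2 1"
    using \<sigma>_surj by meson
  define w where "w x y = FMon (Elt x # map Dif (y # replicate m b))" for x y
  define p where "p = Poly_Mapping.single (w u b) 1 + Poly_Mapping.single (w u' b') (1::complex)"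
  have std: "Poly_Mapping.single (w x y) 1 \<in> standard_forms A (Suc m)"
    if "x \<in> carrier A" "y \<in> carrier A" for x y
  proof (rule standard_forms_single)
    have "w x y = FMon (Elt x # map Dif (y # replicate m b)) \<and> x \<in> carrier A \<and>
        set (y # replicate m b) \<subseteq> carrier A \<and> length (y # replicate m b) = Suc m"
      using that b by (auto simp: w_def)
    then show "w x y \<in> word_set A (Suc m)" unfolding word_set_def by blast
  qed
  have sym: "symbol \<sigma> (Poly_Mapping.single (w x y) 1) = \<sigma> x * (dlog (\<sigma> y) * D)" for x y
    by (simp add: symbol_def linext_single w_def D_def)
  have dsym: "symbol \<sigma> (dform (Poly_Mapping.single (w x y) 1)) = dlog (\<sigma> x) * (dlog (\<sigma> y) * D)" for x y
  proof -
    have "dform (Poly_Mapping.single (w x y) 1) = dif x * Poly_Mapping.single (FMon (map Dif (y # replicate m b))) 1"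
      using dword_map_Dif[of "y # replicate m b"] by (simp add: dform_eq_linext linext_single w_def)
    then show ?thesis
      by (simp add: symbol_mult symbol_dif) (simp add: symbol_def linext_single D_def)
  qed
  have "symbol \<sigma> p = 0"
  proof -
    have "?z 2 1 * ?z (- 1) 1 = ?z 1 1" by (simp add: mult_single)
    then have "symbol \<sigma> p = (s * (- ?z 1 1) + s * (?z 2 1 * ?z (- 1) 1)) * D"
      by (simp add: p_def symbol_add sym u u' b b' dlog_single single_uminus algebra_simps)
    then show ?thesis by (simp add: mult_single)
  qed
  moreover have "symbol \<sigma> (dform p) = f"
  proof -
    have "symbol \<sigma> (dform p) = (dlog s * (- ?z 1 1) + dlog (s * ?z 2 1) * ?z (- 1) 1) * D"
      by (simp add: p_def dform_add symbol_add dsym u u' b b' dlog_single single_uminus algebra_simps)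
    also have "dlog (s * ?z 2 1) * ?z (- 1) 1 = dlog s * ?z 1 1 + s * ?z 1 (- 2)"
      by (simp add: dlog_mult dlog_single distrib_right mult.assoc mult_single)
    also have "(dlog s * (- ?z 1 1) + (dlog s * ?z 1 1 + s * ?z 1 (- 2))) * D = f * (?z (- 1 - int m) (- ((-1) ^ m / 2)) * ?z 1 (- 2) * D)"
      by (simp add: s_def algebra_simps)
    also have "?z (- 1 - int m) (- ((-1) ^ m / 2)) * ?z 1 (- 2) * D = 1"
      by (simp add: D mult_single flip: power_mult_distrib)
    finally show ?thesis by simp
  qed
  ultimately show ?thesis
    using std[OF u(1) b(1)] std[OF u'(1) b'(1)] by (intro bexI[of _ p]) (auto simp: p_def standard_forms_closed)
qed

text \<open>Given X, choose P of degree n - 1 with symbol 0 whose differential has the symbol of X.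
  Then X - \<delta>P has symbol 0 and lies in J_n. As \<open>exists_junk_form\<close> provides P in
  degree at least 1, this requires n >= 2.\<close>

lemma junk_eq_Omega_deg:
  assumes "n \<ge> 2"
  shows "junk \<pi> A n = Omega_deg A n"
proof
  obtain m where n: "n = Suc (Suc m)" using assms by (cases n; cases "n - 1") auto
  have "delta A X \<in> Omega_deg A n" if "X \<in> J \<pi> A (n - 1)" for X
    using delta_Omega_deg[of X "Suc m"] that by (simp add: J_eq n)
  then show "junk \<pi> A n \<subseteq> Omega_deg A n"
    unfolding junk_def set_add_def' J_eq[of n] by (auto intro: Omega_deg_add)
  show "Omega_deg A n \<subseteq> junk \<pi> A n"
  proof
    fix X assume X: "X \<in> Omega_deg A n"
    obtain p where p: "p \<in> standard_forms A (Suc m)" "symbol \<sigma> p = 0" "symbol \<sigma> (dform p) = class_symbol X"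
      using exists_junk_form by blast
    let ?P = "form_class A p"
    have P: "?P \<in> J \<pi> A (n - 1)"
      by (simp add: J_eq n Omega_degI class_symbol_form_class p)
    have dP: "delta A ?P \<in> Omega_deg A n" "class_symbol (delta A ?P) = class_symbol X"
      using delta_Omega_deg[OF Omega_degI[OF p(1)]] standard_forms_subset[OF p(1)]
      by (simp_all add: n delta_form_class class_symbol_form_class p)
    obtain Z where "Z \<in> Omega_deg A n" "Z \<oplus>\<^bsub>Omega A\<^esub> delta A ?P = X" "class_symbol Z = 0"
      using Omega_deg_diff[OF X dP(1)] dP(2) by auto
    then show "X \<in> junk \<pi> A n"
      unfolding junk_def set_add_def' J_eq[of n] using P by blast
  qed
qed

lemma coset_Omega_deg:
  assumes "X \<in> Omega_deg A n"
  shows "Omega_deg A n +>\<^bsub>Omega A\<^esub> X = Omega_deg A n"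
proof
  show "Omega_deg A n +>\<^bsub>Omega A\<^esub> X \<subseteq> Omega_deg A n"
    unfolding a_r_coset_def' using assms by (auto intro: Omega_deg_add)
  show "Omega_deg A n \<subseteq> Omega_deg A n +>\<^bsub>Omega A\<^esub> X"
  proof
    fix Y assume "Y \<in> Omega_deg A n"
    then obtain Z where "Z \<in> Omega_deg A n" "Z \<oplus>\<^bsub>Omega A\<^esub> X = Y"
      using assms by (rule Omega_deg_diff)
    then show "Y \<in> Omega_deg A n +>\<^bsub>Omega A\<^esub> X" unfolding a_r_coset_def' by blast
  qed
qed

lemma Omega_d_simps:
  "carrier (Omega_d \<pi> A n) = (\<lambda>X. junk \<pi> A n +>\<^bsub>Omega A\<^esub> X) ` Omega_deg A n"
  "X \<otimes>\<^bsub>Omega_d \<pi> A n\<^esub> Y = X <+>\<^bsub>Omega A\<^esub> Y"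
  "\<one>\<^bsub>Omega_d \<pi> A n\<^esub> = junk \<pi> A n"
  "lact (Omega_d \<pi> A n) a X =
    (\<Union>\<omega>\<in>X. junk \<pi> A n +>\<^bsub>Omega A\<^esub> (form_class A (elt a) \<otimes>\<^bsub>Omega A\<^esub> \<omega>))"
  "ract (Omega_d \<pi> A n) X a =
    (\<Union>\<omega>\<in>X. junk \<pi> A n +>\<^bsub>Omega A\<^esub> (\<omega> \<otimes>\<^bsub>Omega A\<^esub> form_class A (elt a)))"
  by (auto simp: Omega_d_def Let_def A_FactGroup_def' A_RCOSETS_def' a_r_coset_def' set_add_def')

text \<open>The junk is everything, so each coset is the junk itself; the class of 0 shows that
  there is a coset.\<close>

lemma Omega_d_trivial:
  assumes "n \<ge> 2"
  shows "carrier (Omega_d \<pi> A n) = {\<one>\<^bsub>Omega_d \<pi> A n\<^esub>}"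
proof -
  have "form_class A 0 \<in> Omega_deg A n" by (rule Omega_degI[OF standard_forms_zero])
  then show ?thesis
    unfolding Omega_d_simps junk_eq_Omega_deg[OF assms] using coset_Omega_deg by force
qed

section \<open>The quotient in degree 1\<close>

text \<open>By \<open>junk_1\<close> and \<open>coset_fiber\<close> these are the cosets of the junk
  in degree 1, so calculations in the quotient become calculations with Laurent polynomials.\<close>

definition fiber :: "laurent \<Rightarrow> 'a form set set" where
  "fiber f = {X \<in> Omega_deg A 1. class_symbol X = f}"

lemma fiber_nonempty: "\<exists>X. X \<in> fiber f"
proof -
  obtain b where b: "b \<in> carrier A" "\<sigma> b = Poly_Mapping.single 1 1" using \<sigma>_surj by blast
  \<comment> \<open>Since \<partial>z = - z, the coefficient u has to have the symbol - f z^(-1) for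
    u \<delta>b to have symbol f.\<close>
  obtain u where u: "u \<in> carrier A" "\<sigma> u = f * Poly_Mapping.single (-1) (-1)" using \<sigma>_surj by blast
  have "Poly_Mapping.single (FMon (Elt u # map Dif [b])) 1 \<in> standard_forms A 1"
    using b u by (intro standard_forms_single) (auto simp: word_set_def intro!: exI[of _ "[b]"])
  moreover have "symbol \<sigma> (Poly_Mapping.single (FMon (Elt u # map Dif [b])) 1) = f"
    by (simp add: symbol_def linext_single b u dlog_single mult.assoc mult_single)
  ultimately show ?thesis
    using Omega_degI class_symbol_form_class unfolding fiber_def by blast
qed

lemma class_symbol_fiber: "the_elem (class_symbol ` fiber f) = f"
proof -
  have "class_symbol ` fiber f = {f}" using fiber_nonempty[of f] by (auto simp: fiber_def)
  then show ?thesis by simp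
qed

lemma fiber_add: "fiber f <+>\<^bsub>Omega A\<^esub> fiber g = fiber (f + g)"
proof
  show "fiber f <+>\<^bsub>Omega A\<^esub> fiber g \<subseteq> fiber (f + g)"
    unfolding set_add_def' fiber_def by (auto simp: Omega_deg_add class_symbol_add)
  show "fiber (f + g) \<subseteq> fiber f <+>\<^bsub>Omega A\<^esub> fiber g"
  proof
    fix X assume X: "X \<in> fiber (f + g)"
    obtain Y where Y: "Y \<in> fiber g" using fiber_nonempty by blast
    obtain Z where "Z \<in> Omega_deg A 1" "Z \<oplus>\<^bsub>Omega A\<^esub> Y = X" "class_symbol Z = class_symbol X - class_symbol Y"
      using X Y Omega_deg_diff unfolding fiber_def by blast
    then show "X \<in> fiber f <+>\<^bsub>Omega A\<^esub> fiber g"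
      using X Y unfolding set_add_def' fiber_def by force
  qed
qed

lemma coset_fiber:
  assumes X: "X \<in> Omega_deg A 1"
  shows "fiber 0 +>\<^bsub>Omega A\<^esub> X = fiber (class_symbol X)"
proof
  show "fiber 0 +>\<^bsub>Omega A\<^esub> X \<subseteq> fiber (class_symbol X)"
    unfolding a_r_coset_def' fiber_def using X by (auto simp: Omega_deg_add class_symbol_add)
  show "fiber (class_symbol X) \<subseteq> fiber 0 +>\<^bsub>Omega A\<^esub> X"
  proof
    fix Y assume Y: "Y \<in> fiber (class_symbol X)"
    obtain Z where "Z \<in> Omega_deg A 1" "Z \<oplus>\<^bsub>Omega A\<^esub> X = Y" "class_symbol Z = class_symbol Y - class_symbol X"
      using X Y Omega_deg_diff unfolding fiber_def by blast
    then show "Y \<in> fiber 0 +>\<^bsub>Omega A\<^esub> X"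
      using Y unfolding a_r_coset_def' fiber_def by force
  qed
qed

text \<open>In degree 0 the symbol of a form determines the symbol of its differential; hence
  \<delta> maps J_0 into J_1, as used in \<open>junk_1\<close>.\<close>

lemma dform_standard_0:
  "p \<in> standard_forms A 0 \<Longrightarrow> symbol \<sigma> (dform p) = dlog (symbol \<sigma> p)"
proof (induction p rule: standard_forms_induct)
  case zero
  show ?case using dlog_single[of 0 0] by (simp add: dform_zero symbol_zero)
next
  case (single a as z)
  have "dform (Poly_Mapping.single (FMon [Elt a]) z) = Poly_Mapping.single 0 z * dif a"
    by (simp add: dform_eq_linext linext_single flip: zero_fmon_def)
  moreover have "symbol \<sigma> (Poly_Mapping.single (FMon [Elt a]) z) = Poly_Mapping.single 0 z * \<sigma> a"
    by (simp add: symbol_def linext_single)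
  ultimately show ?case
    using single by (simp add: symbol_mult symbol_scalar symbol_dif dlog_scale)
qed (simp add: dform_add symbol_add dlog_add)

lemma junk_1: "junk \<pi> A 1 = fiber 0"
proof -
  have J: "J \<pi> A 1 = fiber 0" by (simp add: J_eq fiber_def)
  have dlog_0: "dlog 0 = 0" using dlog_single[of 0 0] by simp
  have delta: "delta A X \<in> fiber 0" if "X \<in> J \<pi> A 0" for X
  proof -
    have "X \<in> Omega_deg A 0" using that by (simp add: J_eq)
    then obtain p where p: "p \<in> standard_forms A 0" "p \<in> forms" "X = form_class A p"
      by (rule Omega_degE)
    have "symbol \<sigma> p = 0" using that by (simp add: J_eq p class_symbol_form_class)
    then show ?thesis
      using that delta_Omega_deg[of X 0] p dform_standard_0[OF p(1)]
      by (simp add: J_eq fiber_def delta_form_class class_symbol_form_class dlog_0 One_nat_def)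
  qed
  have zero: "form_class A 0 \<in> J \<pi> A 0"
    by (simp add: J_eq Omega_degI standard_forms_zero class_symbol_form_class symbol_zero)
  have "fiber 0 <+>\<^bsub>Omega A\<^esub> delta A ` J \<pi> A 0 = fiber 0"
  proof
    show "fiber 0 <+>\<^bsub>Omega A\<^esub> delta A ` J \<pi> A 0 \<subseteq> fiber 0"
      using delta fiber_add[of 0 0] unfolding set_add_def' by auto
    have "X \<oplus>\<^bsub>Omega A\<^esub> delta A (form_class A 0) = X" if "X \<in> fiber 0" for X
      using that forms_zero
      by (auto simp: fiber_def delta_form_class dform_zero form_class_add elim!: Omega_degE)
    then show "fiber 0 \<subseteq> fiber 0 <+>\<^bsub>Omega A\<^esub> delta A ` J \<pi> A 0"
      using zero unfolding set_add_def' by force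
  qed
  then show ?thesis by (simp add: junk_def J)
qed

lemma Omega_d_1_carrier: "carrier (Omega_d \<pi> A 1) = range fiber"
proof -
  have "f \<in> class_symbol ` Omega_deg A 1" for f
    using fiber_nonempty[of f] by (auto simp: fiber_def)
  then have "class_symbol ` Omega_deg A 1 = UNIV" by blast
  moreover have "carrier (Omega_d \<pi> A 1) = fiber ` class_symbol ` Omega_deg A 1"
    unfolding Omega_d_simps junk_1 image_image by (rule image_cong[OF refl]) (rule coset_fiber)
  ultimately show ?thesis by simp
qed

lemma Omega_d_1_lact:
  assumes "a \<in> carrier A"
  shows "lact (Omega_d \<pi> A 1) a (fiber f) = fiber (\<sigma> a * f)"
proof -
  have "fiber 0 +>\<^bsub>Omega A\<^esub> (form_class A (elt a) \<otimes>\<^bsub>Omega A\<^esub> X) = fiber (\<sigma> a * f)"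
    if "X \<in> fiber f" for X
  proof -
    have X: "X \<in> Omega_deg A 1" "class_symbol X = f" using that by (auto simp: fiber_def)
    have "class_symbol (form_class A (elt a) \<otimes>\<^bsub>Omega A\<^esub> X) = \<sigma> a * f"
      using X by (auto elim!: Omega_degE
          simp: form_class_mult forms_elt assms class_symbol_form_class symbol_mult symbol_elt)
    then show ?thesis using coset_fiber[OF Omega_deg_lmult[OF assms X(1)]] by simp
  qed
  then show ?thesis
    unfolding Omega_d_simps junk_1 using fiber_nonempty[of f] by auto
qed

lemma Omega_d_1_ract:
  assumes "a \<in> carrier A"
  shows "ract (Omega_d \<pi> A 1) (fiber f) a = fiber (f * \<sigma> a)"
proof -
  have "fiber 0 +>\<^bsub>Omega A\<^esub> (X \<otimes>\<^bsub>Omega A\<^esub> form_class A (elt a)) = fiber (f * \<sigma> a)"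
    if "X \<in> fiber f" for X
  proof -
    have X: "X \<in> Omega_deg A 1" "class_symbol X = f" using that by (auto simp: fiber_def)
    have "class_symbol (X \<otimes>\<^bsub>Omega A\<^esub> form_class A (elt a)) = f * \<sigma> a"
      using X by (auto elim!: Omega_degE
          simp: form_class_mult forms_elt assms class_symbol_form_class symbol_mult symbol_elt)
    then show ?thesis using coset_fiber[OF Omega_deg_rmult[OF assms X(1)]] by simp
  qed
  then show ?thesis
    unfolding Omega_d_simps junk_1 using fiber_nonempty[of f] by auto
qed

lemmas Omega_d_1_simps = Omega_d_1_carrier Omega_d_1_lact Omega_d_1_ract Omega_d_simps(2)
  Omega_d_simps(3)[of 1, unfolded junk_1] fiber_add

text \<open>The bimodule laws are transported from the Laurent polynomials along
  \<open>fiber\<close>.\<close>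

lemma is_bimodule_Omega_d_1: "is_bimodule A (Omega_d \<pi> A 1)"
  unfolding is_bimodule_def
proof (intro conjI)
  show "comm_group (Omega_d \<pi> A 1)"
  proof (rule comm_groupI)
    fix X assume "X \<in> carrier (Omega_d \<pi> A 1)"
    then obtain f where "X = fiber f" by (auto simp: Omega_d_1_carrier)
    then show "\<exists>Y\<in>carrier (Omega_d \<pi> A 1). Y \<otimes>\<^bsub>Omega_d \<pi> A 1\<^esub> X = \<one>\<^bsub>Omega_d \<pi> A 1\<^esub>"
      by (intro bexI[of _ "fiber (- f)"]) (simp_all add: Omega_d_1_simps)
  qed (auto simp: Omega_d_1_simps ac_simps)
qed (auto simp: Omega_d_1_simps add_closed mult_closed smult_closed one_closed \<sigma>_add \<sigma>_mult \<sigma>_smult \<sigma>_one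
    algebra_simps)

lemma is_bimodule_laurent: "is_bimodule A (laurent_bimodule \<sigma>)"
proof -
  have "comm_group (laurent_bimodule \<sigma>)"
  proof (rule comm_groupI)
    fix f :: laurent
    show "\<exists>g\<in>carrier (laurent_bimodule \<sigma>). g \<otimes>\<^bsub>laurent_bimodule \<sigma>\<^esub> f = \<one>\<^bsub>laurent_bimodule \<sigma>\<^esub>"
      by (intro bexI[of _ "- f"]) (simp_all add: laurent_bimodule_def)
  qed (simp_all add: laurent_bimodule_def ac_simps)
  then show ?thesis
    by (simp add: is_bimodule_def laurent_bimodule_def \<sigma>_add \<sigma>_mult \<sigma>_smult \<sigma>_one one_closed
        algebra_simps)
qed

lemma bimodule_isomorphic_Omega_d_1:
  "bimodule_isomorphic A (Omega_d \<pi> A 1) (laurent_bimodule \<sigma>)"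
proof -
  let ?h = "\<lambda>X. the_elem (class_symbol ` X)"
  have "bij_betw ?h (range fiber) UNIV"
    by (rule bij_betwI[where g = fiber]) (auto simp: class_symbol_fiber)
  then have "?h \<in> bimodule_iso A (Omega_d \<pi> A 1) (laurent_bimodule \<sigma>)"
    by (auto simp: bimodule_iso_def iso_def hom_def Omega_d_1_simps class_symbol_fiber
        laurent_bimodule_def)
  then show ?thesis
    unfolding bimodule_isomorphic_def using is_bimodule_Omega_d_1 is_bimodule_laurent by blast
qed

end

section \<open>The Podles sphere\<close>

lemma cstar_algebraD:
  assumes "cstar_algebra C"
  shows "ring C" "Module.module complex_ring C"
    and "x \<in> carrier C \<Longrightarrow> star C x \<in> carrier C"
    and "x \<in> carrier C \<Longrightarrow> star C (star C x) = x"
    and "x \<in> carrier C \<Longrightarrow> y \<in> carrier C \<Longrightarrow> star C (x \<oplus>\<^bsub>C\<^esub> y) = star C x \<oplus>\<^bsub>C\<^esub> star C y"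
    and "x \<in> carrier C \<Longrightarrow> y \<in> carrier C \<Longrightarrow> star C (x \<otimes>\<^bsub>C\<^esub> y) = star C y \<otimes>\<^bsub>C\<^esub> star C x"
    and "x \<in> carrier C \<Longrightarrow> star C (z \<odot>\<^bsub>C\<^esub> x) = cnj z \<odot>\<^bsub>C\<^esub> star C x"
  using assms unfolding cstar_algebra_def complex_algebra_def by blast+

lemma complex_smult_closed:
  assumes "Module.module complex_ring C" "x \<in> carrier C"
  shows "z \<odot>\<^bsub>C\<^esub> x \<in> carrier C"
  using module.smult_closed[OF assms(1) _ assms(2), of z] by (simp add: complex_ring_def)

lemma complex_smult_minus_one:
  assumes "Module.module complex_ring C" "x \<in> carrier C"
  shows "(-1) \<odot>\<^bsub>C\<^esub> x = \<ominus>\<^bsub>C\<^esub> x"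
proof -
  interpret module complex_ring C by (rule assms(1))
  have "(-1) \<odot>\<^bsub>C\<^esub> x \<oplus>\<^bsub>C\<^esub> 1 \<odot>\<^bsub>C\<^esub> x = ((-1) \<oplus>\<^bsub>complex_ring\<^esub> 1) \<odot>\<^bsub>C\<^esub> x"
    by (rule smult_l_distr[symmetric]) (simp_all add: complex_ring_def assms(2))
  also have "\<dots> = \<zero>\<^bsub>C\<^esub>"
    using smult_l_null[OF assms(2)] by (simp add: complex_ring_def)
  finally have "(-1) \<odot>\<^bsub>C\<^esub> x \<oplus>\<^bsub>C\<^esub> x = \<zero>\<^bsub>C\<^esub>"
    using smult_one[OF assms(2)] by (simp add: complex_ring_def)
  then show ?thesis
    using M.minus_equality[OF _ assms(2) complex_smult_closed[OF assms]] by simp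
qed

lemma star_generated_closed:
  assumes "cstar_algebra C" "G \<subseteq> carrier C" "x \<in> star_generated C G"
  shows "x \<in> carrier C"
  using assms(3)
  by induction (use assms(2) in \<open>auto intro: cstar_algebraD[OF assms(1)] ring.ring_simprules(1,5)
      complex_smult_closed\<close>)

text \<open>\<open>star_generated\<close> has no rule for the unit. The relation for
  \<open>star C B\<close> times B expresses c times the unit through A and B, and c is
  invertible.\<close>

lemma one_in_star_generated:
  assumes C: "cstar_algebra C" and rel: "podles_relations q c C A B" and c: "c > 0"
  shows "\<one>\<^bsub>C\<^esub> \<in> star_generated C {A, B}"
proof -
  interpret ring C by (rule cstar_algebraD(1)[OF C])
  interpret M: module complex_ring C by (rule cstar_algebraD(2)[OF C])
  note smult = complex_smult_closed[OF cstar_algebraD(2)[OF C]]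
  have AB: "A \<in> carrier C" "B \<in> carrier C" using rel by (auto simp: podles_relations_def)
  let ?S = "star_generated C {A, B}"
  let ?d = "A \<oplus>\<^bsub>C\<^esub> (-1) \<odot>\<^bsub>C\<^esub> (A \<otimes>\<^bsub>C\<^esub> A)" and ?e = "complex_of_real c \<odot>\<^bsub>C\<^esub> \<one>\<^bsub>C\<^esub>"
  have neg: "(-1) \<odot>\<^bsub>C\<^esub> x = \<ominus>\<^bsub>C\<^esub> x" if "x \<in> carrier C" for x
    by (rule complex_smult_minus_one[OF cstar_algebraD(2)[OF C] that])
  have d: "?d \<in> carrier C" "?d \<in> ?S"
    using AB smult by (auto intro: star_generated.intros)
  have "star C B \<otimes>\<^bsub>C\<^esub> B = ?d \<oplus>\<^bsub>C\<^esub> ?e"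
    using rel AB by (simp add: podles_relations_def neg a_minus_def)
  moreover have "(star C B \<otimes>\<^bsub>C\<^esub> B) \<oplus>\<^bsub>C\<^esub> (-1) \<odot>\<^bsub>C\<^esub> ?d \<in> ?S"
    using d(2) by (auto intro: star_generated.intros)
  ultimately have "(?d \<oplus>\<^bsub>C\<^esub> ?e) \<oplus>\<^bsub>C\<^esub> \<ominus>\<^bsub>C\<^esub> ?d \<in> ?S" using neg[OF d(1)] by simp
  moreover have "(?d \<oplus>\<^bsub>C\<^esub> ?e) \<oplus>\<^bsub>C\<^esub> \<ominus>\<^bsub>C\<^esub> ?d = ?e"
  proof -
    have "?e \<in> carrier C" using smult by simp
    then have "(?d \<oplus>\<^bsub>C\<^esub> ?e) \<oplus>\<^bsub>C\<^esub> \<ominus>\<^bsub>C\<^esub> ?d = (?e \<oplus>\<^bsub>C\<^esub> ?d) \<oplus>\<^bsub>C\<^esub> \<ominus>\<^bsub>C\<^esub> ?d"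
      using d(1) a_comm by presburger
    also have "\<dots> = ?e \<oplus>\<^bsub>C\<^esub> (?d \<oplus>\<^bsub>C\<^esub> \<ominus>\<^bsub>C\<^esub> ?d)"
      using d(1) \<open>?e \<in> carrier C\<close> by (intro a_assoc a_inv_closed)
    finally show ?thesis using d(1) \<open>?e \<in> carrier C\<close> by (simp only: r_neg r_zero)
  qed
  ultimately have "?e \<in> ?S" by simp
  then have "complex_of_real (1 / c) \<odot>\<^bsub>C\<^esub> ?e \<in> ?S" by (rule star_generated.smult)
  moreover have "complex_of_real (1 / c) \<odot>\<^bsub>C\<^esub> ?e = \<one>\<^bsub>C\<^esub>"
    using M.smult_assoc1[of "complex_of_real (1 / c)" "complex_of_real c" "\<one>\<^bsub>C\<^esub>"]
      M.smult_one[of "\<one>\<^bsub>C\<^esub>"] c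
    by (simp add: complex_ring_def flip: of_real_mult)
  ultimately show ?thesis by simp
qed

lemma direct_sum_rep_eq_block: "direct_sum_rep \<rho> \<rho>' a = block 0 (\<rho> a) (\<rho>' a)"
  by (simp add: fun_eq_iff direct_sum_rep_def block_def)

lemma is_symbol_homD:
  assumes "is_symbol_hom c C A B \<sigma>"
  shows "a \<in> star_generated C {A, B} \<Longrightarrow> b \<in> star_generated C {A, B} \<Longrightarrow>
      \<sigma> (a \<oplus>\<^bsub>C\<^esub> b) = \<sigma> a + \<sigma> b"
    and "a \<in> star_generated C {A, B} \<Longrightarrow> b \<in> star_generated C {A, B} \<Longrightarrow>
      \<sigma> (a \<otimes>\<^bsub>C\<^esub> b) = \<sigma> a * \<sigma> b"
    and "a \<in> star_generated C {A, B} \<Longrightarrow> \<sigma> (z \<odot>\<^bsub>C\<^esub> a) = Poly_Mapping.single 0 z * \<sigma> a"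
    and "\<sigma> \<one>\<^bsub>C\<^esub> = 1"
proof -
  have hom: "\<sigma> \<in> ring_hom (podles_fin C A B) (monoid_algebra UNIV)"
    using assms by (auto simp: is_symbol_hom_def alg_hom_def)
  show "\<sigma> (a \<oplus>\<^bsub>C\<^esub> b) = \<sigma> a + \<sigma> b" "\<sigma> (a \<otimes>\<^bsub>C\<^esub> b) = \<sigma> a * \<sigma> b"
    if "a \<in> star_generated C {A, B}" "b \<in> star_generated C {A, B}"
    using ring_hom_add[OF hom, of a b] ring_hom_mult[OF hom, of a b] that
    by (simp_all add: podles_fin_def monoid_algebra_simps)
  show "\<sigma> (z \<odot>\<^bsub>C\<^esub> a) = Poly_Mapping.single 0 z * \<sigma> a" if "a \<in> star_generated C {A, B}"
    using assms that by (auto simp: is_symbol_hom_def alg_hom_def podles_fin_def monoid_algebra_simps)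
  show "\<sigma> \<one>\<^bsub>C\<^esub> = 1"
    using ring_hom_one[OF hom] by (simp add: podles_fin_def monoid_algebra_simps)
qed

text \<open>Positive powers of z come from powers of B and negative ones from powers of
  \<open>star C B\<close>, each factor divided by sqrt c; linear combinations of these give all
  Laurent polynomials.\<close>

lemma symbol_hom_surj:
  assumes \<sigma>: "is_symbol_hom c C A B \<sigma>" and c: "c > 0" and one: "\<one>\<^bsub>C\<^esub> \<in> star_generated C {A, B}"
  shows "\<exists>a\<in>star_generated C {A, B}. \<sigma> a = f"
proof -
  let ?S = "star_generated C {A, B}"
  note mult = is_symbol_homD(2)[OF \<sigma>]
    and smult = is_symbol_homD(3)[OF \<sigma>] and unit = is_symbol_homD(4)[OF \<sigma>]
  have gens: "B \<in> ?S" "star C B \<in> ?S" by (auto intro: star_generated.intros)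
  have power: "\<exists>a\<in>?S. \<sigma> a = Poly_Mapping.single (int n * k) 1"
    if g: "g \<in> ?S" "\<sigma> g = Poly_Mapping.single k (complex_of_real (sqrt c))" for g k n
  proof (induction n)
    case 0
    show ?case using one unit by (intro bexI[of _ "\<one>\<^bsub>C\<^esub>"]) auto
  next
    case (Suc n)
    then obtain a where a: "a \<in> ?S" "\<sigma> a = Poly_Mapping.single (int n * k) 1" by blast
    let ?b = "complex_of_real (1 / sqrt c) \<odot>\<^bsub>C\<^esub> (g \<otimes>\<^bsub>C\<^esub> a)"
    have "complex_of_real (1 / sqrt c) * complex_of_real (sqrt c) = 1"
      using c by (simp flip: of_real_mult)
    then have "\<sigma> ?b = Poly_Mapping.single (int (Suc n) * k) 1"
      using a g smult[OF star_generated.mult[OF g(1) a(1)]]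
      by (simp add: mult mult_single algebra_simps)
    then show ?case
      using star_generated.smult[OF star_generated.mult[OF g(1) a(1)]] by blast
  qed
  have mono: "\<exists>a\<in>?S. \<sigma> a = Poly_Mapping.single k 1" for k
  proof (cases "k \<ge> 0")
    case True
    then show ?thesis
      using power[OF gens(1), of 1 "nat k"] \<sigma> by (simp add: is_symbol_hom_def)
  next
    case False
    then show ?thesis
      using power[OF gens(2), of "-1" "nat (- k)"] \<sigma> by (simp add: is_symbol_hom_def)
  qed
  show ?thesis
  proof (induction f rule: poly_mapping_add_induct)
    case (single k z)
    obtain a where "a \<in> ?S" "\<sigma> a = Poly_Mapping.single k 1" using mono by blast
    then show ?case
      using smult[of a z] star_generated.smult[of a C "{A, B}" z]
      by (intro bexI[of _ "z \<odot>\<^bsub>C\<^esub> a"]) (simp_all add: mult_single)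
  next
    case (add f g)
    then obtain a b where "a \<in> ?S" "\<sigma> a = f" "b \<in> ?S" "\<sigma> b = g" by blast
    then show ?case
      using is_symbol_homD(1)[OF \<sigma>, of a b] by (auto intro: star_generated.add)
  qed
qed

theorem theorem5p5:
  fixes q c :: real
    and C :: "'a cstar" and A B :: 'a
    and \<pi>_plus \<pi>_minus :: "'a \<Rightarrow> ell2 \<Rightarrow> ell2"
    and \<sigma> :: "'a \<Rightarrow> laurent"
  assumes "\<bar>q\<bar> < 1" and "c > 0"
    and "podles_sphere q c C A B"
    and "podles_rep (lam_plus c) q c C A B \<pi>_plus"
    and "podles_rep (lam_minus c) q c C A B \<pi>_minus"
    and "is_symbol_hom c C A B \<sigma>"
  defines "\<pi> \<equiv> direct_sum_rep \<pi>_plus \<pi>_minus"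
    and "Afin \<equiv> podles_fin C A B"
  shows "(\<forall>n\<ge>2. carrier (Omega_d \<pi> Afin n) = {\<one>\<^bsub>Omega_d \<pi> Afin n\<^esub>}) \<and>
         bimodule_isomorphic Afin (Omega_d \<pi> Afin 1) (laurent_bimodule \<sigma>)"
proof -
  let ?S = "star_generated C {A, B}"
  have C: "cstar_algebra C" and rel: "podles_relations q c C A B"
    using assms(3) by (auto simp: podles_sphere_def)
  note CD = cstar_algebraD[OF C]
  have AB: "A \<in> carrier C" "B \<in> carrier C" "star C A = A"
    using rel by (auto simp: podles_relations_def)
  have sub: "x \<in> carrier C" if "x \<in> ?S" for x
    using star_generated_closed[OF C _ that] AB by simp
  have one: "\<one>\<^bsub>C\<^esub> \<in> ?S" by (rule one_in_star_generated[OF C rel assms(2)])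
  have Afin: "carrier Afin = ?S" "mult Afin = mult C" "add Afin = add C" "smult Afin = smult C"
    "\<one>\<^bsub>Afin\<^esub> = \<one>\<^bsub>C\<^esub>"
    by (simp_all add: Afin_def podles_fin_def)
  note \<sigma>_simps = is_symbol_homD[OF assms(6)]
  have rep: "star_rep C \<pi>_plus" "star_rep C \<pi>_minus"
    using assms(4,5) by (auto simp: podles_rep_def)
  have \<pi>_add: "\<pi> (a \<oplus>\<^bsub>C\<^esub> b) = (\<lambda>v. \<pi> a v + \<pi> b v)" and \<pi>_mult: "\<pi> (a \<otimes>\<^bsub>C\<^esub> b) = (\<lambda>v. \<pi> a (\<pi> b v))"
    if "a \<in> carrier C" "b \<in> carrier C" for a b
    using rep that by (auto simp: star_rep_def \<pi>_def direct_sum_rep_def)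
  have \<pi>_smult: "\<pi> (z \<odot>\<^bsub>C\<^esub> a) = (\<lambda>v. z *\<^sub>C \<pi> a v)" if "a \<in> carrier C" for a z
    using rep that by (auto simp: star_rep_def \<pi>_def direct_sum_rep_def scaleC_prod_def)
  note wplus = podles_rep_wshift[OF assms(4) AB(1,2) CD(3)[OF AB(2)] AB(3) CD(4)[OF AB(2)]]
    and wminus = podles_rep_wshift[OF assms(5) AB(1,2) CD(3)[OF AB(2)] AB(3) CD(4)[OF AB(2)]]
  note weights = podles_weight_summable[OF assms(1,2)]
  \<comment> \<open>The limit of the weights is 0 for A and sqrt c for B and
    \<open>star C B\<close>, in agreement with the prescribed symbols; the shifts are by 0, 1 and
    -1.\<close>
  have gens: "regular (\<pi> A) (\<sigma> A)" "regular (\<pi> B) (\<sigma> B)" "regular (\<pi> (star C B)) (\<sigma> (star C B))"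
  proof -
    show "regular (\<pi> A) (\<sigma> A)"
      using regular_block_wshift[OF weights(1) weights(1), where k = 0] assms(6)
      by (simp add: \<pi>_def direct_sum_rep_eq_block wplus wminus is_symbol_hom_def)
    show "regular (\<pi> B) (\<sigma> B)"
      using regular_block_wshift[OF weights(3) weights(3), where k = 1] assms(6)
      by (simp add: \<pi>_def direct_sum_rep_eq_block wplus wminus is_symbol_hom_def)
    show "regular (\<pi> (star C B)) (\<sigma> (star C B))"
      using regular_block_wshift[OF weights(2) weights(2), where k = "-1"] assms(6)
      by (simp add: \<pi>_def direct_sum_rep_eq_block wplus wminus is_symbol_hom_def)
  qed
  \<comment> \<open>The claim for \<open>star C a\<close> is carried along since
    \<open>star_generated\<close> is closed under \<open>star\<close>, whereas \<sigma> is only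
    given as an algebra homomorphism with prescribed values at A, B and
    \<open>star C B\<close>.\<close>
  have regular: "regular (\<pi> a) (\<sigma> a) \<and> regular (\<pi> (star C a)) (\<sigma> (star C a))" if "a \<in> ?S" for a
    using that
  proof induction
    case (gen x)
    then show ?case using gens AB(3) by auto
  next
    case (add x y)
    then show ?case
      using sub star_generated.star[of _ C "{A, B}"] CD(3,5)
      by (simp add: \<pi>_add \<sigma>_simps regular_add)
  next
    case (mult x y)
    then show ?case
      using sub star_generated.star[of _ C "{A, B}"] CD(3,6)
      by (simp add: \<pi>_mult \<sigma>_simps regular_mult)
  next
    case (smult x z)
    then show ?case
      using sub star_generated.star[of _ C "{A, B}"] CD(3,7)
      by (simp add: \<pi>_smult \<sigma>_simps regular_scaleC)
  next
    case (star x)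
    then show ?case using CD(4) sub by simp
  qed
  interpret symbol_calculus Afin \<pi> \<sigma>
  proof
    show "\<one>\<^bsub>Afin\<^esub> \<otimes>\<^bsub>Afin\<^esub> \<one>\<^bsub>Afin\<^esub> = \<one>\<^bsub>Afin\<^esub>"
      using ring.ring_simprules(12)[OF CD(1)] ring.ring_simprules(6)[OF CD(1)] by (simp add: Afin)
    show "\<exists>a\<in>carrier Afin. \<sigma> a = f" for f
      unfolding Afin by (rule symbol_hom_surj[OF assms(6,2) one])
  qed (use regular one in \<open>auto simp: Afin \<sigma>_simps intro: star_generated.intros\<close>)
  show ?thesis using Omega_d_trivial bimodule_isomorphic_Omega_d_1 by blast
qed

end
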